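(* Let $X$ and $Y$ be based, connected, countable CW complexes with non-degenerate basepoints, and suppose $X$ is a co-H-space. Let $d \colon X\to Y$ be any cyclic map. Then for each based map $f \colon X \to Y$, the path components $\mathrm{map}(X,Y;f)$ and $\mathrm{map}(X,Y; f + d)$ are homotopy equivalent. If $X$ is a finite complex, then the corresponding evaluation fibrations $\omega_f\colon \mathrm{map}(X,Y;f)\to Y$ and $\omega_{f +d}\colon \mathrm{map}(X,Y;f+d)\to Y$ are fibre-homotopy equivalent.
   Context: $\mathrm{map}(X,Y)$ is the space of all continuous (not necessarily based) maps with the compact-open topology, and $\mathrm{map}(X,Y;f)$ is its path component containing $f$, with basepoint $f$. With $x_0\in X$ the basepoint, $\omega_f\colon \mathrm{map}(X,Y;f)\to Y$ is the evaluation $\omega_f(h)=h(x_0)$, which is a Hurewicz fibration. A co-H-space is a based space $X$ with a based map $\sigma\colon X\to X\vee X$ such that $J\circ\sigma$ is based homotopic to $\Delta\colon X\to X\times X$, where $J\colon X\vee X\to X\times X$ is the inclusion and $\Delta$ is the diagonal. For based maps $a,b\colon X\to Y$, $a+b=(a\mid b)\circ\sigma$, where $(a\mid b)\colon X\vee X\to Y$ is $a$ on the first and $b$ on the second wedge summand. A based map $d\colon X\to Y$ is cyclic if $(d\mid 1)\colon X\vee Y\to Y$ extends to a map $\Gamma\colon X\times Y\to Y$. Fibrations $p_1\colon E_1\to B$ and $p_2\colon E_2\to B$ are fibre-homotopy equivalent if there are based maps $h\colon E_1\to E_2$ and $k\colon E_2\to E_1$ over $B$ such that $k\circ h$ and $h\circ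 k$ are homotopic to the respective identities by based homotopies $F$ and $H$ satisfying $p_1F(x,t)=p_1(x)$ and $p_2H(y,t)=p_2(y)$ for all $x\in E_1$, $y\in E_2$, $t\in[0,1]$. *)

theory Defs
  imports "HOL-Analysis.Analysis"
begin

section \<open>CW complexes\<close>

definition disc :: "nat \<Rightarrow> (nat \<Rightarrow> real) set" where
  "disc n = {x \<in> topspace (Euclidean_space n). (\<Sum>i<n. (x i)\<^sup>2) \<le> 1}"

definition open_disc :: "nat \<Rightarrow> (nat \<Rightarrow> real) set" where
  "open_disc n = {x \<in> topspace (Euclidean_space n). (\<Sum>i<n. (x i)\<^sup>2) < 1}"

text \<open>
  The definition of J. H. C. Whitehead: \<open>C\<close> is the set of open cells of \<open>X\<close> and \<open>dm\<close> gives
  their dimensions.  Only the existence of characteristic maps is required.  The last two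
  clauses are closure-finiteness and the weak topology.
\<close>

definition cw_complex :: "'a topology \<Rightarrow> 'a set set \<Rightarrow> ('a set \<Rightarrow> nat) \<Rightarrow> bool" where
  "cw_complex X C dm \<longleftrightarrow>
     Hausdorff_space X \<and>
     \<Union>C = topspace X \<and>
     disjoint C \<and>
     (\<forall>e\<in>C. \<exists>\<phi>. continuous_map (subtopology (Euclidean_space (dm e)) (disc (dm e))) X \<phi> \<and>
        homeomorphic_map (subtopology (Euclidean_space (dm e)) (open_disc (dm e)))
          (subtopology X e) \<phi> \<and>
        \<phi> ` (disc (dm e) - open_disc (dm e)) \<subseteq> \<Union>{e'\<in>C. dm e' < dm e}) \<and>
     (\<forall>e\<in>C. finite {e'\<in>C. e' \<inter> X closure_of e \<noteq> {}}) \<and>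
     (\<forall>S. S \<subseteq> topspace X \<longrightarrow> (\<forall>e\<in>C. closedin X (S \<inter> X closure_of e)) \<longrightarrow> closedin X S)"


section \<open>Based spaces and maps\<close>

definition based_map :: "'a topology \<Rightarrow> 'a \<Rightarrow> 'b topology \<Rightarrow> 'b \<Rightarrow> ('a \<Rightarrow> 'b) \<Rightarrow> bool" where
  "based_map X x0 Y y0 f \<longleftrightarrow> continuous_map X Y f \<and> f x0 = y0"

text \<open>The pair \<open>(X, {x0})\<close> is an NDR pair, in the sense of Steenrod.\<close>

definition nondegenerate_basepoint :: "'a topology \<Rightarrow> 'a \<Rightarrow> bool" where
  "nondegenerate_basepoint X x0 \<longleftrightarrow>
     x0 \<in> topspace X \<and>
     (\<exists>u h. continuous_map X (top_of_set {0..1::real}) u \<and>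
        {x \<in> topspace X. u x = 0} = {x0} \<and>
        continuous_map (prod_topology (top_of_set {0..1::real}) X) X h \<and>
        (\<forall>x\<in>topspace X. h (0, x) = x) \<and>
        (\<forall>t\<in>{0..1}. h (t, x0) = x0) \<and>
        (\<forall>x\<in>topspace X. u x < 1 \<longrightarrow> h (1, x) = x0))"

text \<open>
  The wedge is realised inside the product, so that the inclusion of the wedge into the
  product is the identity function.  The subspace topology agrees with the quotient topology
  from the disjoint union.
\<close>

definition wedge :: "'a topology \<Rightarrow> 'a \<Rightarrow> 'b topology \<Rightarrow> 'b \<Rightarrow> ('a \<times> 'b) topology" where
  "wedge X x0 Y y0 =
     subtopology (prod_topology X Y) (topspace X \<times> {y0} \<union> {x0} \<times> topspace Y)"

text \<open>
  \<open>wedge_case y0 a b\<close> is the map \<open>(a | b)\<close>; a point of the wedge whose second coordinate is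
  not \<open>y0\<close> lies in the second summand.  It is only used when \<open>a x0 = b y0\<close>.
\<close>

definition wedge_case :: "'b \<Rightarrow> ('a \<Rightarrow> 'c) \<Rightarrow> ('b \<Rightarrow> 'c) \<Rightarrow> 'a \<times> 'b \<Rightarrow> 'c" where
  "wedge_case y0 a b = (\<lambda>(x, y). if y = y0 then a x else b y)"

lemma topspace_wedge:
  assumes "x0 \<in> topspace X" "y0 \<in> topspace Y"
  shows "topspace (wedge X x0 Y y0) = topspace X \<times> {y0} \<union> {x0} \<times> topspace Y"
  using assms by (auto simp: wedge_def)

lemma wedge_case_inl: "wedge_case y0 a b (x, y0) = a x"
  by (simp add: wedge_case_def)

lemma wedge_case_inr: "a x0 = b y0 \<Longrightarrow> wedge_case y0 a b (x0, y) = b y"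
  by (simp add: wedge_case_def)


section \<open>Co-H-spaces and cyclic maps\<close>

definition co_H_space :: "'a topology \<Rightarrow> 'a \<Rightarrow> ('a \<Rightarrow> 'a \<times> 'a) \<Rightarrow> bool" where
  "co_H_space X x0 \<sigma> \<longleftrightarrow>
     x0 \<in> topspace X \<and>
     based_map X x0 (wedge X x0 X x0) (x0, x0) \<sigma> \<and>
     homotopic_with (\<lambda>h. h x0 = (x0, x0)) X (prod_topology X X) \<sigma> (\<lambda>x. (x, x))"

definition co_H_add :: "'a \<Rightarrow> ('a \<Rightarrow> 'a \<times> 'a) \<Rightarrow> ('a \<Rightarrow> 'b) \<Rightarrow> ('a \<Rightarrow> 'b) \<Rightarrow> 'a \<Rightarrow> 'b" where
  "co_H_add x0 \<sigma> a b = wedge_case x0 a b \<circ> \<sigma>"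

definition cyclic_map :: "'a topology \<Rightarrow> 'a \<Rightarrow> 'b topology \<Rightarrow> 'b \<Rightarrow> ('a \<Rightarrow> 'b) \<Rightarrow> bool" where
  "cyclic_map X x0 Y y0 d \<longleftrightarrow>
     based_map X x0 Y y0 d \<and>
     (\<exists>\<Gamma>. continuous_map (prod_topology X Y) Y \<Gamma> \<and>
        (\<forall>z\<in>topspace (wedge X x0 Y y0). \<Gamma> z = wedge_case y0 d id z))"


section \<open>Mapping spaces\<close>

text \<open>
  Points of the mapping space are continuous maps that are \<open>undefined\<close> outside \<open>topspace X\<close>,
  so that two maps are equal as soon as they agree on \<open>X\<close>.
\<close>

definition maps :: "'a topology \<Rightarrow> 'b topology \<Rightarrow> ('a \<Rightarrow> 'b) set" where
  "maps X Y = {h \<in> extensional (topspace X). continuous_map X Y h}"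

definition compact_open :: "'a topology \<Rightarrow> 'b topology \<Rightarrow> ('a \<Rightarrow> 'b) topology" where
  "compact_open X Y =
     topology_generated_by {{h \<in> maps X Y. h ` K \<subseteq> U} | K U. compactin X K \<and> openin Y U}"

lemma topspace_compact_open: "topspace (compact_open X Y) = maps X Y"
proof -
  have "maps X Y \<in> {{h \<in> maps X Y. h ` K \<subseteq> U} | K U. compactin X K \<and> openin Y U}"
    by (rule CollectI, rule exI[of _ "{}"], rule exI[of _ "{}"]) auto
  then show ?thesis
    unfolding compact_open_def topology_generated_by_topspace by blast
qed

definition map_basepoint :: "'a topology \<Rightarrow> ('a \<Rightarrow> 'b) \<Rightarrow> 'a \<Rightarrow> 'b" where
  "map_basepoint X f = restrict f (topspace X)"

definition map_component :: "'a topology \<Rightarrow> 'b topology \<Rightarrow> ('a \<Rightarrow> 'b) \<Rightarrow> ('a \<Rightarrow> 'b) topology" where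
  "map_component X Y f =
     subtopology (compact_open X Y)
       (path_component_of_set (compact_open X Y) (map_basepoint X f))"

definition evaluation :: "'a \<Rightarrow> ('a \<Rightarrow> 'b) \<Rightarrow> 'b" where
  "evaluation x0 h = h x0"


section \<open>Fibre-homotopy equivalence\<close>

text \<open>
  The relation compares maps \<open>p1\<close> and \<open>p2\<close> over \<open>B\<close> with based total spaces, and is used for
  fibrations.  That evaluation at a non-degenerate basepoint of a finite complex is a Hurewicz
  fibration is a separate fact and not built into it.  The predicate passed to
  \<^const>\<open>homotopic_with\<close> is imposed at every time \<open>t\<close> of the homotopy.
\<close>

definition fibre_homotopy_equivalent ::
  "'e1 topology \<Rightarrow> 'e1 \<Rightarrow> ('e1 \<Rightarrow> 'b) \<Rightarrow> 'e2 topology \<Rightarrow> 'e2 \<Rightarrow> ('e2 \<Rightarrow> 'b) \<Rightarrow> 'b topology \<Rightarrow> bool" where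
  "fibre_homotopy_equivalent E1 e1 p1 E2 e2 p2 B \<longleftrightarrow>
     continuous_map E1 B p1 \<and> continuous_map E2 B p2 \<and>
     (\<exists>h k. based_map E1 e1 E2 e2 h \<and> (\<forall>x\<in>topspace E1. p2 (h x) = p1 x) \<and>
        based_map E2 e2 E1 e1 k \<and> (\<forall>y\<in>topspace E2. p1 (k y) = p2 y) \<and>
        homotopic_with (\<lambda>F. F e1 = e1 \<and> (\<forall>x\<in>topspace E1. p1 (F x) = p1 x)) E1 E1 (k \<circ> h) id \<and>
        homotopic_with (\<lambda>H. H e2 = e2 \<and> (\<forall>y\<in>topspace E2. p2 (H y) = p2 y)) E2 E2 (h \<circ> k) id)"

end

theory Submission
  imports Defs
begin

text \<open>
  Let \<open>\<Gamma>\<close> be the extension of \<open>(d | 1)\<close>.  The map \<open>g \<mapsto> (x \<mapsto> \<Gamma> (x, g x))\<close> of the mapping space lies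
  over \<open>Y\<close>, and it sends \<open>f\<close> into the component of \<open>f + d\<close>, because the diagonal of \<open>X\<close> is homotopic
  to \<open>\<sigma>\<close> followed by the interchange of factors.  It is a homotopy equivalence over \<open>Y\<close>: the
  co-H-structure covers \<open>X\<close> by two sets contractible in \<open>X\<close>, so \<open>\<Gamma>\<close>, as a family of self-maps of
  \<open>Y\<close> parametrised by \<open>X\<close>, is given by a family of loops of self-maps based at the identity, and
  reversing the loops gives an inverse family.

  For finite \<open>X\<close> this equivalence has to be made based.  By relative homotopy lifting for the
  evaluation map this is possible as soon as \<open>f\<close> and \<open>f + d\<close> have neighbourhoods in the mapping
  space that contract to them pointwise in \<open>X\<close>.  Such contractions come from local
  equiconnectedness of finite CW complexes, by induction over the cells, applied to a finite
  subcomplex that contains the image of the map; they then extend over the remaining cells of \<open>Y\<close>.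
\<close>

section \<open>Continuity and the compact-open topology\<close>

text \<open>The comultiplication \<open>\<sigma>\<close> is assumed neither coassociative nor to
  have inverses, so \<open>d\<close> has no negative among the maps from \<open>X\<close> to
  \<open>Y\<close> that would lead back from \<open>f + d\<close> to \<open>f\<close>. The inverse
  is therefore sought among families of self-maps of \<open>Y\<close>, whose composition is
  associative with the identity as strict unit. Behind the loops stands Ganea's description of
  co-H-spaces as homotopy retracts of suspensions of their loop spaces. The based statement is
  harder than the free one because a homotopy over \<open>Y\<close> may move the basepoint within
  its fibre. To correct this, homotopies have to be extended from the single point \<open>f\<close>
  of the mapping space while evaluation at \<open>x0\<close> stays fixed. A contraction towards
  \<open>f\<close> changes the evaluation, so extension and lifting have to be done at once.
  Throughout, a neighbourhood is given by a real gauge and a local contraction by a map defined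
  everywhere that arrives where the gauge is small. Pieces can then be damped, composed and glued by
  formulas.\<close>

abbreviation unit_interval :: "real topology" where
  "unit_interval \<equiv> top_of_set {0..1}"

section \<open>Gluing and reparametrising continuous maps\<close>

lemma continuous_map_compose2:
  "continuous_map Y Z F \<Longrightarrow> continuous_map X Y f \<Longrightarrow> continuous_map X Z (\<lambda>x. F (f x))"
  using continuous_map_compose[of X Y f Z F] by (simp add: o_def)

lemma continuous_map_ident: "continuous_map X X (\<lambda>x. x)"
  using continuous_map_id[unfolded id_def] .

lemma continuous_map_subtopology_ident: "continuous_map (subtopology X S) X (\<lambda>x. x)"
  using continuous_map_id_subt[unfolded id_def] .

lemma continuous_map_clamp:
  assumes "continuous_map A euclideanreal m"
  shows "continuous_map A unit_interval (\<lambda>a. max 0 (min 1 (m a)))"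
  using assms by (auto simp: continuous_map_in_subtopology
      intro!: continuous_map_real_max continuous_map_real_min)

lemma continuous_map_fst_snd:
  "continuous_map (prod_topology A (prod_topology B C)) B (\<lambda>z. fst (snd z))"
  by (rule continuous_map_compose2[OF continuous_map_fst continuous_map_snd])

lemma continuous_map_snd_snd:
  "continuous_map (prod_topology A (prod_topology B C)) C (\<lambda>z. snd (snd z))"
  by (rule continuous_map_compose2[OF continuous_map_snd continuous_map_snd])

lemma openin_prod_topologyE:
  assumes "openin (prod_topology X Y) S" "(x, y) \<in> S"
  obtains U V where "openin X U" "openin Y V" "x \<in> U" "y \<in> V" "U \<times> V \<subseteq> S"
proof -
  have "\<exists>U V. openin X U \<and> openin Y V \<and> x \<in> U \<and> y \<in> V \<and> U \<times> V \<subseteq> S"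
    using assms(1)[unfolded openin_prod_topology_alt, rule_format, OF assms(2)] .
  then show ?thesis using that by metis
qed

text \<open>A map from a compact space to a Hausdorff space is closed, so the preimage of a closed
  set is a union of two closed sets, one of them pushed forward from \<open>D\<close>. This stands
  in for the quotient topology of a cell attachment or of polar coordinates; as \<open>F\<close> is
  one function on \<open>A\<close>, no compatibility has to be checked.\<close>

lemma continuous_map_from_closed_Un_image:
  assumes A1: "closedin A A1" and phi: "continuous_map D A \<phi>" and D: "compact_space D"
    and A: "Hausdorff_space A" and top: "topspace A \<subseteq> A1 \<union> \<phi> ` topspace D"
    and F1: "continuous_map (subtopology A A1) W F" and F2: "continuous_map D W (\<lambda>d. F (\<phi> d))"
  shows "continuous_map A W F"
  unfolding continuous_map_closedin
proof (intro conjI allI impI)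
  show "F \<in> topspace A \<rightarrow> topspace W"
  proof
    fix a assume "a \<in> topspace A"
    then consider "a \<in> A1 \<inter> topspace A" | d where "d \<in> topspace D" "a = \<phi> d"
      using top by blast
    then show "F a \<in> topspace W"
      using F1 F2 by cases (auto simp: continuous_map_def)
  qed
  fix C assume C: "closedin W C"
  have "closedin (subtopology A A1) {x \<in> topspace (subtopology A A1). F x \<in> C}"
    by (rule closedin_continuous_map_preimage[OF F1 C])
  then have 1: "closedin A {x \<in> topspace (subtopology A A1). F x \<in> C}"
    using A1 closedin_trans_full by blast
  have "closedin D {d \<in> topspace D. F (\<phi> d) \<in> C}"
    by (rule closedin_continuous_map_preimage[OF F2 C])
  then have "compactin D {d \<in> topspace D. F (\<phi> d) \<in> C}"
    using D closedin_compact_space by blast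
  then have "compactin A (\<phi> ` {d \<in> topspace D. F (\<phi> d) \<in> C})"
    using phi image_compactin by blast
  then have 2: "closedin A (\<phi> ` {d \<in> topspace D. F (\<phi> d) \<in> C})"
    using A compactin_imp_closedin by blast
  have "{x \<in> topspace A. F x \<in> C} =
      {x \<in> topspace (subtopology A A1). F x \<in> C} \<union> \<phi> ` {d \<in> topspace D. F (\<phi> d) \<in> C}"
  proof -
    have "\<phi> d \<in> topspace A" if "d \<in> topspace D" for d
      using phi that by (auto simp: continuous_map_def)
    then show ?thesis using top by auto
  qed
  then show "closedin A {x \<in> topspace A. F x \<in> C}"
    using 1 2 by (simp add: closedin_Un)
qed

text \<open>
  Where \<open>c\<close> vanishes, \<open>m / c\<close> has no limit, but there \<open>H\<close> does not depend on its first
  argument, so the tube lemma gives continuity.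
\<close>

lemma continuous_map_singular_ratio:
  assumes H: "continuous_map (prod_topology unit_interval A) B H"
    and m: "continuous_map A euclideanreal m" and c: "continuous_map A euclideanreal c"
    and const: "\<And>a t. \<lbrakk>a \<in> topspace A; c a = 0; 0 \<le> t; t \<le> 1\<rbrakk> \<Longrightarrow> H (t, a) = H (0, a)"
  shows "continuous_map A B (\<lambda>a. H (max 0 (min 1 (m a / c a)), a))"
    (is "continuous_map A B ?F")
  unfolding continuous_map_def
proof (intro conjI allI impI)
  show "?F \<in> topspace A \<rightarrow> topspace B"
    using H by (auto simp: continuous_map_def Pi_iff)
  fix U assume U: "openin B U"
  show "openin A {x \<in> topspace A. ?F x \<in> U}"
  proof (subst openin_subopen, clarify)
    fix a assume a: "a \<in> topspace A" "?F a \<in> U"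
    show "\<exists>T. openin A T \<and> a \<in> T \<and> T \<subseteq> {x \<in> topspace A. ?F x \<in> U}"
    proof (cases "c a = 0")
      case False
      let ?V = "{x \<in> topspace A. c x \<noteq> 0}"
      have V: "openin A ?V"
        using openin_continuous_map_preimage[OF c, of "- {0}"] by (simp add: open_Compl)
      have mc: "continuous_map (subtopology A ?V) euclideanreal (\<lambda>x. m x / c x)"
        by (rule continuous_map_real_divide[OF continuous_map_from_subtopology[OF m]
              continuous_map_from_subtopology[OF c]]) auto
      have "continuous_map (subtopology A ?V) unit_interval (\<lambda>x. max 0 (min 1 (m x / c x)))"
        by (rule continuous_map_clamp[OF mc])
      then have "continuous_map (subtopology A ?V) B ?F"
        by (rule continuous_map_compose2[OF H continuous_map_pairedI[OF _
            continuous_map_subtopology_ident]])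
      then have "openin (subtopology A ?V) {x \<in> topspace (subtopology A ?V). ?F x \<in> U}"
        using U openin_continuous_map_preimage by blast
      then have "openin A {x \<in> topspace (subtopology A ?V). ?F x \<in> U}"
        using V openin_trans_full by blast
      then show ?thesis using a False
        by (intro exI[of _ "{x \<in> topspace (subtopology A ?V). ?F x \<in> U}"]) auto
    next
      case True
      let ?W = "{z \<in> topspace (prod_topology unit_interval A). H z \<in> U}"
      have W: "openin (prod_topology unit_interval A) ?W"
        by (rule openin_continuous_map_preimage[OF H U])
      have "H (0, a) \<in> U" using a(2) True by simp
      then have "H (t, a) \<in> U" if "0 \<le> t" "t \<le> 1" for t
        using const[OF a(1) True that] by simp
      then have "{0..1} \<times> {a} \<subseteq> ?W" using a by auto
      moreover have "compactin unit_interval {0..1}" by (simp add: compactin_subtopology)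
      ultimately have "\<exists>S V. openin unit_interval S \<and> openin A V \<and> {0..1} \<subseteq> S \<and> a \<in> V \<and> S \<times> V \<subseteq> ?W"
        using tube_lemma_left[OF W _ a(1)] by meson
      then obtain S V where V: "openin A V" "{0..1} \<subseteq> S" "a \<in> V" "S \<times> V \<subseteq> ?W"
        by meson
      have "?F x \<in> U" if "x \<in> V" for x
      proof -
        have "(max 0 (min 1 (m x / c x)), x) \<in> S \<times> V" using V(2) that by auto
        then show ?thesis using V(4) by blast
      qed
      then have "V \<subseteq> {x \<in> topspace A. ?F x \<in> U}" using openin_subset[OF V(1)] by blast
      then show ?thesis using V(1,3) by blast
    qed
  qed
qed

lemma unit_interval_clamp:
  assumes "continuous_map (prod_topology unit_interval A) B H"
  shows "continuous_map (prod_topology euclideanreal A) B (\<lambda>(t, a). H (max 0 (min 1 t), a))"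
proof -
  have "continuous_map (prod_topology euclideanreal A) B (\<lambda>z. H (max 0 (min 1 (fst z)), snd z))"
    by (intro continuous_map_compose2[OF assms] continuous_map_pairedI continuous_map_clamp
        continuous_map_fst continuous_map_snd)
  then show ?thesis by (simp add: case_prod_unfold)
qed

section \<open>The compact-open topology: currying, evaluation, pointwise action\<close>

lemma openin_compact_open:
  assumes "compactin X K" "openin Y U"
  shows "openin (compact_open X Y) {h \<in> maps X Y. h ` K \<subseteq> U}"
  unfolding compact_open_def using assms by (intro topology_generated_by_Basis) blast

lemma continuous_map_into_compact_open:
  assumes "\<And>w. w \<in> topspace W \<Longrightarrow> f w \<in> maps X Y"
    and "\<And>K U. \<lbrakk>compactin X K; openin Y U\<rbrakk> \<Longrightarrow> openin W {w \<in> topspace W. f w ` K \<subseteq> U}"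
  shows "continuous_map W (compact_open X Y) f"
proof -
  have "maps X Y \<in> {{h \<in> maps X Y. h ` K \<subseteq> U} | K U. compactin X K \<and> openin Y U}"
    by (rule CollectI, rule exI[of _ "{}"], rule exI[of _ "{}"]) auto
  then have "f ` topspace W \<subseteq> \<Union> {{h \<in> maps X Y. h ` K \<subseteq> U} | K U. compactin X K \<and> openin Y U}"
    using assms(1) by blast
  moreover have "openin W (f -` V \<inter> topspace W)"
    if V: "V \<in> {{h \<in> maps X Y. h ` K \<subseteq> U} | K U. compactin X K \<and> openin Y U}" for V
  proof -
    obtain K U where KU: "V = {h \<in> maps X Y. h ` K \<subseteq> U}" "compactin X K" "openin Y U"
      using V by blast
    have "f -` V \<inter> topspace W = {w \<in> topspace W. f w ` K \<subseteq> U}"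
      using assms(1) KU(1) by auto
    then show ?thesis using assms(2)[OF KU(2,3)] by simp
  qed
  ultimately show ?thesis
    unfolding compact_open_def continuous_on_generated_topo_iff by blast
qed

lemma maps_restrict:
  "continuous_map X Y f \<Longrightarrow> restrict f (topspace X) \<in> maps X Y"
  unfolding maps_def by (auto intro: continuous_map_eq[where f = f])

lemma maps_continuous: "g \<in> maps X Y \<Longrightarrow> continuous_map X Y g"
  by (simp add: maps_def)

lemma maps_apply: "g \<in> maps X Y \<Longrightarrow> x \<in> topspace X \<Longrightarrow> g x \<in> topspace Y"
  by (auto simp: maps_def continuous_map_def)

lemma maps_eqI:
  "g \<in> maps X Y \<Longrightarrow> h \<in> maps X Y \<Longrightarrow> (\<And>x. x \<in> topspace X \<Longrightarrow> g x = h x) \<Longrightarrow> g = h"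
  by (auto simp: maps_def intro: extensionalityI)

lemma continuous_map_curry:
  assumes F: "continuous_map (prod_topology W X) Y F"
  shows "continuous_map W (compact_open X Y) (\<lambda>w. restrict (\<lambda>x. F (w, x)) (topspace X))"
proof (rule continuous_map_into_compact_open)
  fix w assume "w \<in> topspace W"
  then show "restrict (\<lambda>x. F (w, x)) (topspace X) \<in> maps X Y"
    by (intro maps_restrict continuous_map_compose2[OF F] continuous_intros) auto
next
  fix K U assume K: "compactin X K" and U: "openin Y U"
  have KX: "K \<subseteq> topspace X" using K compactin_subset_topspace by blast
  let ?N = "{z \<in> topspace (prod_topology W X). F z \<in> U}"
  have N: "openin (prod_topology W X) ?N"
    using F U openin_continuous_map_preimage by blast
  show "openin W {w \<in> topspace W. restrict (\<lambda>x. F (w, x)) (topspace X) ` K \<subseteq> U}"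
  proof (subst openin_subopen, clarify)
    fix w assume w: "w \<in> topspace W" "restrict (\<lambda>x. F (w, x)) (topspace X) ` K \<subseteq> U"
    then have "{w} \<times> K \<subseteq> ?N" using KX by auto
    then obtain S V where "openin W S" "w \<in> S" "K \<subseteq> V" "S \<times> V \<subseteq> ?N"
      using tube_lemma_right[OF N K w(1)] by auto
    then show "\<exists>T. openin W T \<and> w \<in> T \<and>
        T \<subseteq> {w \<in> topspace W. restrict (\<lambda>x. F (w, x)) (topspace X) ` K \<subseteq> U}"
      using KX by (intro exI[of _ S]) (fastforce dest: openin_subset)
  qed
qed

lemma continuous_map_eval:
  assumes "compact_space X" "Hausdorff_space X"
  shows "continuous_map (prod_topology (compact_open X Y) X) Y (\<lambda>(g, x). g x)"
  unfolding continuous_map_def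
proof (intro conjI allI impI)
  show "(\<lambda>(g, x). g x) \<in> topspace (prod_topology (compact_open X Y) X) \<rightarrow> topspace Y"
    by (auto simp: topspace_compact_open maps_apply)
  fix U assume U: "openin Y U"
  show "openin (prod_topology (compact_open X Y) X)
      {z \<in> topspace (prod_topology (compact_open X Y) X). (case z of (g, x) \<Rightarrow> g x) \<in> U}"
  proof (subst openin_subopen, clarify)
    fix g x assume gx: "(g, x) \<in> topspace (prod_topology (compact_open X Y) X)" "g x \<in> U"
    then have g: "g \<in> maps X Y" and x: "x \<in> topspace X" by (auto simp: topspace_compact_open)
    let ?V = "{x \<in> topspace X. g x \<in> U}"
    have V: "openin X ?V"
      using maps_continuous[OF g] U openin_continuous_map_preimage by blast
    have "regular_space X"
      using assms by (simp add: compact_Hausdorff_imp_regular_space)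
    then obtain N C where NC: "openin X N" "closedin X C" "x \<in> N" "N \<subseteq> C" "C \<subseteq> ?V"
      using V x gx(2) neighbourhood_base_of_closedin[of X]
      unfolding neighbourhood_base_of by (metis (no_types, lifting) mem_Collect_eq)
    have C: "compactin X C" using NC assms(1) closedin_compact_space by blast
    show "\<exists>T. openin (prod_topology (compact_open X Y) X) T \<and> (g, x) \<in> T \<and>
        T \<subseteq> {z \<in> topspace (prod_topology (compact_open X Y) X). (case z of (g, x) \<Rightarrow> g x) \<in> U}"
    proof (intro exI conjI)
      show "openin (prod_topology (compact_open X Y) X) ({h \<in> maps X Y. h ` C \<subseteq> U} \<times> N)"
        using openin_compact_open[OF C U] NC(1) by (simp add: openin_prod_Times_iff)
      show "{h \<in> maps X Y. h ` C \<subseteq> U} \<times> N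
          \<subseteq> {z \<in> topspace (prod_topology (compact_open X Y) X). (case z of (g, x) \<Rightarrow> g x) \<in> U}"
        using NC(4) openin_subset[OF NC(1)] by (fastforce simp: topspace_compact_open)
    qed (use NC g in auto)
  qed
qed

lemma continuous_map_eval_at:
  assumes "x \<in> topspace X"
  shows "continuous_map (compact_open X Y) Y (\<lambda>g. g x)"
  unfolding continuous_map_def
proof (intro conjI allI impI)
  show "(\<lambda>g. g x) \<in> topspace (compact_open X Y) \<rightarrow> topspace Y"
    using assms by (auto simp: topspace_compact_open maps_apply)
  fix U assume "openin Y U"
  then have "openin (compact_open X Y) {h \<in> maps X Y. h ` {x} \<subseteq> U}"
    using assms by (intro openin_compact_open) auto
  then show "openin (compact_open X Y) {h \<in> topspace (compact_open X Y). h x \<in> U}"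
    by (simp add: topspace_compact_open)
qed

text \<open>
  Compact subsets of the Hausdorff space \<open>X\<close> are regular, which replaces local compactness of \<open>X\<close>.
\<close>

lemma continuous_map_act:
  assumes X: "Hausdorff_space X"
    and H: "continuous_map (prod_topology W (prod_topology X Y)) Z H"
  shows "continuous_map (prod_topology W (compact_open X Y)) (compact_open X Z)
           (\<lambda>(w, g). restrict (\<lambda>x. H (w, x, g x)) (topspace X))"
proof (rule continuous_map_into_compact_open)
  fix z assume "z \<in> topspace (prod_topology W (compact_open X Y))"
  then obtain w g where z: "z = (w, g)" and w: "w \<in> topspace W" and g: "g \<in> maps X Y"
    by (auto simp: topspace_compact_open)
  have "continuous_map X Z (\<lambda>x. H (w, x, g x))"
    by (intro continuous_map_compose2[OF H] continuous_intros)
       (use w g in \<open>auto simp: maps_def\<close>)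
  then show "(case z of (w, g) \<Rightarrow> restrict (\<lambda>x. H (w, x, g x)) (topspace X)) \<in> maps X Z"
    by (simp add: z maps_restrict)
next
  fix K U assume K: "compactin X K" and U: "openin Z U"
  have KX: "K \<subseteq> topspace X" using K compactin_subset_topspace by blast
  let ?N = "{z \<in> topspace (prod_topology W (prod_topology X Y)). H z \<in> U}"
  have N: "openin (prod_topology W (prod_topology X Y)) ?N"
    using H U openin_continuous_map_preimage by blast
  let ?S = "{z \<in> topspace (prod_topology W (compact_open X Y)).
    (case z of (w, g) \<Rightarrow> restrict (\<lambda>x. H (w, x, g x)) (topspace X)) ` K \<subseteq> U}"
  show "openin (prod_topology W (compact_open X Y)) ?S"
  proof (subst openin_subopen, rule ballI)
    fix z assume "z \<in> ?S"
    then obtain w g where z: "z = (w, g)" and w: "w \<in> topspace W" and g: "g \<in> maps X Y"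
      and sub: "restrict (\<lambda>x. H (w, x, g x)) (topspace X) ` K \<subseteq> U"
      by (auto simp: topspace_compact_open)
    have reg: "regular_space (subtopology X K)"
      using K X by (simp add: Hausdorff_space_subtopology compact_Hausdorff_imp_regular_space
          compactin_subspace)
    \<comment> \<open>A box around \<open>(w, x, g x)\<close> whose middle factor is a compact
      neighbourhood \<open>C\<close> of \<open>x\<close> within \<open>K\<close>, mapped into
      \<open>B\<close> by \<open>g\<close>. The last condition is open in the compact-open topology,
      so finitely many boxes whose sets \<open>A\<close> cover \<open>K\<close> give a neighbourhood
      of \<open>(w, g)\<close>.\<close>
    define good where "good x P A B C \<longleftrightarrow> openin W P \<and> w \<in> P \<and> openin (subtopology X K) A \<and> x \<in> A
        \<and> compactin X C \<and> A \<subseteq> C \<and> openin Y B \<and> g ` C \<subseteq> B \<and> P \<times> C \<times> B \<subseteq> ?N" for x P A B C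
    have "\<exists>P A B C. good x P A B C" if x: "x \<in> K" for x
    proof -
      have "(w, x, g x) \<in> ?N"
        using w x g KX sub by (auto simp: maps_apply)
      then obtain P R where PR: "openin W P" "w \<in> P" "openin (prod_topology X Y) R" "(x, g x) \<in> R"
          "P \<times> R \<subseteq> ?N"
        by (rule openin_prod_topologyE[OF N])
      obtain A0 B where AB: "openin X A0" "x \<in> A0" "openin Y B" "g x \<in> B" "A0 \<times> B \<subseteq> R"
        by (rule openin_prod_topologyE[OF PR(3,4)])
      let ?V = "K \<inter> (A0 \<inter> {x \<in> topspace X. g x \<in> B})"
      have "openin X (A0 \<inter> {x \<in> topspace X. g x \<in> B})"
        using AB maps_continuous[OF g] openin_continuous_map_preimage by blast
      then have V: "openin (subtopology X K) ?V"
        by (simp add: openin_subtopology_Int2)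
      have xV: "x \<in> ?V" using x AB KX by auto
      obtain A C where AC: "openin (subtopology X K) A" "closedin (subtopology X K) C" "x \<in> A" "A \<subseteq>
          C" "C \<subseteq> ?V"
        using V xV reg neighbourhood_base_of_closedin[of "subtopology X K"]
        unfolding neighbourhood_base_of by (metis (no_types, lifting))
      have "compactin (subtopology X K) C"
        using K AC(2) closedin_compact_space compactin_subspace by blast
      then have "compactin X C" by (simp add: compactin_subtopology)
      moreover have "P \<times> C \<times> B \<subseteq> P \<times> R" using AB(5) AC(5) by blast
      ultimately have "good x P A B C" unfolding good_def using PR AB AC by auto
      then show ?thesis by blast
    qed
    then obtain P A B C where "\<And>x. x \<in> K \<Longrightarrow> good x (P x) (A x) (B x) (C x)"
      by metis
    note * = this[unfolded good_def]
    have "compactin (subtopology X K) K" using K by (simp add: compactin_subtopology)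
    moreover have "\<And>V. V \<in> A ` K \<Longrightarrow> openin (subtopology X K) V" using * by blast
    moreover have "K \<subseteq> \<Union> (A ` K)" using * by blast
    ultimately have "\<exists>\<F>. finite \<F> \<and> \<F> \<subseteq> A ` K \<and> K \<subseteq> \<Union>\<F>"
      by (rule compactinD)
    then obtain J where J: "finite J" "J \<subseteq> K" "K \<subseteq> \<Union> (A ` J)"
      by (metis finite_subset_image)
    let ?T = "(topspace W \<inter> (\<Inter>x\<in>J. P x)) \<times> (maps X Y \<inter> (\<Inter>x\<in>J. {h \<in> maps X Y. h ` C x \<subseteq> B x}))"
    have "openin W (topspace W \<inter> (\<Inter>x\<in>J. P x))"
      using J * by (intro openin_Int_Inter) auto
    moreover have "openin (compact_open X Y) (maps X Y \<inter> (\<Inter>x\<in>J. {h \<in> maps X Y. h ` C x \<subseteq> B x}))"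
    proof (rule openin_Int_Inter)
      show "openin (compact_open X Y) (maps X Y)"
        by (metis openin_topspace topspace_compact_open)
    qed (use J * in \<open>auto intro!: openin_compact_open\<close>)
    ultimately have T: "openin (prod_topology W (compact_open X Y)) ?T"
      by (simp add: openin_prod_Times_iff)
    have "g ` C x \<subseteq> B x" if "x \<in> J" for x using J * that by blast
    then have "(w, g) \<in> ?T" using w g J * by blast
    moreover have "?T \<subseteq> ?S"
    proof
      fix z' assume "z' \<in> ?T"
      then obtain w' h where z': "z' = (w', h)" and w': "w' \<in> topspace W" and P: "\<forall>x\<in>J. w' \<in> P x"
        and h: "h \<in> maps X Y" and C: "\<forall>x\<in>J. h ` C x \<subseteq> B x"
        by auto
      have "H (w', y, h y) \<in> U" if y: "y \<in> K" for y
      proof -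
        obtain x where x: "x \<in> J" "y \<in> A x" using J y by blast
        then have "(w', y, h y) \<in> P x \<times> C x \<times> B x" using J P C * by blast
        then show ?thesis using J(2) * x by blast
      qed
      then show "z' \<in> ?S"
        using KX h w' by (auto simp: z' topspace_compact_open)
    qed
    ultimately show "\<exists>T. openin (prod_topology W (compact_open X Y)) T \<and> z \<in> T \<and> T \<subseteq> ?S"
      using T z by blast
  qed
qed

section \<open>Self-maps of mapping spaces induced by families of maps\<close>

definition act :: "'a topology \<Rightarrow> ('a \<times> 'b \<Rightarrow> 'c) \<Rightarrow> ('a \<Rightarrow> 'b) \<Rightarrow> 'a \<Rightarrow> 'c" where
  "act X A g = restrict (\<lambda>x. A (x, g x)) (topspace X)"

lemma act_apply: "x \<in> topspace X \<Longrightarrow> act X A g x = A (x, g x)"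
  by (simp add: act_def)

lemma continuous_map_act_single:
  assumes X: "Hausdorff_space X" and A: "continuous_map (prod_topology X Y) Z A"
  shows "continuous_map (compact_open X Y) (compact_open X Z) (act X A)"
proof -
  have "continuous_map (prod_topology unit_interval (prod_topology X Y)) Z (\<lambda>(t, z). A z)"
    using continuous_map_compose2[OF A continuous_map_snd, of unit_interval]
    by (simp add: case_prod_unfold)
  from continuous_map_act[OF X this]
  have "continuous_map (prod_topology unit_interval (compact_open X Y)) (compact_open X Z)
      (\<lambda>(t, g). act X A g)"
    by (simp add: act_def)
  from continuous_map_compose2[OF this, of "compact_open X Y" "\<lambda>g. (0, g)"]
  show ?thesis by (simp add: continuous_map_pairedI continuous_map_ident)
qed

lemma act_in_maps:
  assumes A: "continuous_map (prod_topology X Y) Z A" and g: "g \<in> maps X Y"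
  shows "act X A g \<in> maps X Z"
  unfolding act_def
  by (intro maps_restrict continuous_map_compose2[OF A] continuous_map_pairedI
      continuous_map_ident maps_continuous[OF g])

lemma act_act:
  assumes "g \<in> maps X Y"
  shows "act X A (act X B g) = act X (\<lambda>z. A (fst z, B z)) g"
  by (auto simp: act_def)

text \<open>Such a family is the identity at \<open>x0\<close>, so \<open>act X F\<close> keeps the
  value at \<open>x0\<close> and is a map over \<open>Y\<close>.\<close>

abbreviation (input) fixes_fibre :: "'a \<Rightarrow> 'b topology \<Rightarrow> ('a \<times> 'b \<Rightarrow> 'b) \<Rightarrow> bool" where
  "fixes_fibre x0 Y F \<equiv> \<forall>y\<in>topspace Y. F (x0, y) = y"

text \<open>
  Homotopies over the base, and based homotopies over the base, are of this form for suitable \<open>R\<close>.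
\<close>

abbreviation (input) homotopic_self :: "('a \<Rightarrow> 'a \<Rightarrow> bool) \<Rightarrow> 'a topology \<Rightarrow> ('a \<Rightarrow> 'a) \<Rightarrow> ('a \<Rightarrow> 'a) \<Rightarrow>
    bool" where
  "homotopic_self R M \<equiv> homotopic_with (\<lambda>F. \<forall>g\<in>topspace M. R g (F g)) M M"

abbreviation (input) same_value :: "'a \<Rightarrow> ('a \<Rightarrow> 'b) \<Rightarrow> ('a \<Rightarrow> 'b) \<Rightarrow> bool" where
  "same_value x0 g h \<equiv> h x0 = g x0"

lemma homotopic_self_act:
  assumes X: "Hausdorff_space X" and x0: "x0 \<in> topspace X"
    and AB: "homotopic_with (fixes_fibre x0 Y) (prod_topology X Y) Y A B"
  shows "homotopic_self (same_value x0) (compact_open X Y) (act X A) (act X B)"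
proof -
  obtain H where H: "continuous_map (prod_topology unit_interval (prod_topology X Y)) Y H"
    "\<And>z. H (0, z) = A z" "\<And>z. H (1, z) = B z"
    and fix0: "\<And>t. t \<in> {0..1} \<Longrightarrow> fixes_fibre x0 Y (\<lambda>z. H (t, z))"
    using AB unfolding homotopic_with_def by blast
  let ?h = "\<lambda>(t, g). restrict (\<lambda>x. H (t, x, g x)) (topspace X)"
  show ?thesis
    unfolding homotopic_with_def
  proof (intro exI[of _ ?h] conjI allI ballI)
    show "continuous_map (prod_topology unit_interval (compact_open X Y)) (compact_open X Y) ?h"
      by (rule continuous_map_act[OF X H(1)])
  qed (use H fix0 x0 in \<open>auto simp: act_def topspace_compact_open maps_apply\<close>)
qed

lemma homotopic_with_fibrewise_compose:
  assumes A: "homotopic_with (fixes_fibre x0 Y) (prod_topology X Y) Y A A'"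
    and B: "homotopic_with (fixes_fibre x0 Y) (prod_topology X Y) Y B B'"
    and x0: "x0 \<in> topspace X"
  shows "homotopic_with (fixes_fibre x0 Y) (prod_topology X Y) Y
           (\<lambda>z. A (fst z, B z)) (\<lambda>z. A' (fst z, B' z))"
proof -
  obtain h where h: "continuous_map (prod_topology unit_interval (prod_topology X Y)) Y h"
    "\<And>z. h (0, z) = A z" "\<And>z. h (1, z) = A' z"
    and fixh: "\<And>t. t \<in> {0..1} \<Longrightarrow> fixes_fibre x0 Y (\<lambda>z. h (t, z))"
    using A unfolding homotopic_with_def by blast
  obtain k where k: "continuous_map (prod_topology unit_interval (prod_topology X Y)) Y k"
    "\<And>z. k (0, z) = B z" "\<And>z. k (1, z) = B' z"
    and fixk: "\<And>t. t \<in> {0..1} \<Longrightarrow> fixes_fibre x0 Y (\<lambda>z. k (t, z))"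
    using B unfolding homotopic_with_def by blast
  let ?h = "\<lambda>w. h (fst w, fst (snd w), k w)"
  show ?thesis
    unfolding homotopic_with_def
  proof (intro exI[of _ ?h] conjI allI ballI)
    show "continuous_map (prod_topology unit_interval (prod_topology X Y)) Y ?h"
      by (intro continuous_map_compose2[OF h(1)] continuous_map_pairedI continuous_map_fst k(1)
          continuous_map_fst_snd)
  qed (use h k fixh fixk x0 in auto)
qed

section \<open>Inverting a family over a co-H-space\<close>

text \<open>
  A co-H-space is covered by the two open sets where \<open>\<sigma>\<close> is close to one of the two wedge summands,
  namely \<open>s < 1\<close> and \<open>s > -1\<close> below, and each of them is contractible in \<open>X\<close>.
\<close>

lemma co_H_space_contractions:
  assumes sigma: "co_H_space X x0 \<sigma>" and nd: "nondegenerate_basepoint X x0"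
  obtains Q s where "continuous_map (prod_topology euclideanreal X) X Q"
    "continuous_map X euclideanreal s"
    "\<And>x. x \<in> topspace X \<Longrightarrow> Q (0, x) = x" "\<And>t. Q (t, x0) = x0" "s x0 = 0"
    "\<And>x. x \<in> topspace X \<Longrightarrow> s x < 1 \<Longrightarrow> Q (-1, x) = x0"
    "\<And>x. x \<in> topspace X \<Longrightarrow> s x > -1 \<Longrightarrow> Q (1, x) = x0"
proof -
  have x0: "x0 \<in> topspace X" using nd by (simp add: nondegenerate_basepoint_def)
  obtain u h where u: "continuous_map X (top_of_set {0..1::real}) u"
    and u0: "{x \<in> topspace X. u x = 0} = {x0}"
    and h: "continuous_map (prod_topology unit_interval X) X h"
    and h0: "\<And>x. x \<in> topspace X \<Longrightarrow> h (0, x) = x"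
    and hx0: "\<And>t. t \<in> {0..1} \<Longrightarrow> h (t, x0) = x0"
    and h1: "\<And>x. x \<in> topspace X \<Longrightarrow> u x < 1 \<Longrightarrow> h (1, x) = x0"
    using nd unfolding nondegenerate_basepoint_def by blast
  have ur: "continuous_map X euclideanreal u"
    using u continuous_map_into_fulltopology by blast
  have s: "based_map X x0 (wedge X x0 X x0) (x0, x0) \<sigma>"
    and D: "homotopic_with (\<lambda>h. h x0 = (x0, x0)) X (prod_topology X X) \<sigma> (\<lambda>x. (x, x))"
    using sigma by (auto simp: co_H_space_def)
  have sx0: "\<sigma> x0 = (x0, x0)" using s by (simp add: based_map_def)
  have sc: "continuous_map X (prod_topology X X) \<sigma>"
    using homotopic_with_imp_continuous_maps[OF D] by blast
  have sw: "\<sigma> x \<in> topspace X \<times> {x0} \<union> {x0} \<times> topspace X" if "x \<in> topspace X" for x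
  proof -
    have "\<sigma> x \<in> topspace (wedge X x0 X x0)"
      using s that by (auto simp: based_map_def continuous_map_def)
    then show ?thesis using topspace_wedge[OF x0 x0] by simp
  qed
  \<comment> \<open>\<open>h (1, -)\<close> is based homotopic to the identity and crushes the set
    \<open>u < 1\<close> to \<open>x0\<close>; \<open>p \<circ> \<sigma>\<close> is based homotopic
    to the identity because \<open>\<sigma>\<close> deforms to the diagonal. With \<open>p\<close> a
    projection, the composite is \<open>x0\<close> wherever
    \<open>u (p (\<sigma> x)) < 1\<close>.\<close>
  have sum: "homotopic_with (\<lambda>k. k x0 = x0) X X (\<lambda>x. h (1, p (\<sigma> x))) (\<lambda>x. x)"
    if p: "continuous_map (prod_topology X X) X p" and px: "\<And>x. p (x, x) = x" for p
  proof -
    have pc: "continuous_map X X (\<lambda>x. p (\<sigma> x))"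
      by (rule continuous_map_compose2[OF p sc])
    have "homotopic_with (\<lambda>k. k x0 = x0) X X (p \<circ> \<sigma>) (p \<circ> (\<lambda>x. (x, x)))"
      by (rule homotopic_with_compose_continuous_map_left[OF D p]) (simp add: px)
    then have 1: "homotopic_with (\<lambda>k. k x0 = x0) X X (\<lambda>x. p (\<sigma> x)) (\<lambda>x. x)"
      by (simp add: o_def px)
    have "homotopic_with (\<lambda>k. k x0 = x0) X X (\<lambda>x. p (\<sigma> x)) (\<lambda>x. h (1, p (\<sigma> x)))"
    proof (subst homotopic_with)
      show "\<exists>k. continuous_map (prod_topology unit_interval X) X k \<and>
          (\<forall>x\<in>topspace X. k (0, x) = p (\<sigma> x)) \<and>
          (\<forall>x\<in>topspace X. k (1, x) = h (1, p (\<sigma> x))) \<and> (\<forall>t\<in>{0..1}. k (t, x0) = x0)"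
      proof (intro exI[of _ "\<lambda>w. h (fst w, p (\<sigma> (snd w)))"] conjI ballI)
        show "continuous_map (prod_topology unit_interval X) X (\<lambda>w. h (fst w, p (\<sigma> (snd w))))"
          by (intro continuous_map_compose2[OF h] continuous_map_pairedI continuous_map_fst
              continuous_map_compose2[OF pc continuous_map_snd])
      qed (use pc px sx0 hx0 in \<open>auto simp: continuous_map_def Pi_iff intro!: h0\<close>)
    qed (use x0 in auto)
    with 1 show ?thesis
      using homotopic_with_trans homotopic_with_symD by blast
  qed
  have ex: "\<exists>P. continuous_map (prod_topology euclideanreal X) X P \<and> (\<forall>x. P (1, x) = x) \<and>
      (\<forall>x. P (0, x) = h (1, p (\<sigma> x))) \<and> (\<forall>t. P (t, x0) = x0)"
    if p: "continuous_map (prod_topology X X) X p" and px: "\<And>x. p (x, x) = x" for p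
  proof -
    obtain k where k: "continuous_map (prod_topology unit_interval X) X k"
      "\<And>x. k (0, x) = h (1, p (\<sigma> x))" "\<And>x. k (1, x) = x" "\<And>t. t \<in> {0..1} \<Longrightarrow> k (t, x0) = x0"
      using sum[OF p px] unfolding homotopic_with_def by blast
    show ?thesis
      by (intro exI[of _ "\<lambda>(t, x). k (max 0 (min 1 t), x)"] conjI unit_interval_clamp k(1))
         (auto simp: k)
  qed
  obtain P1 where P1: "continuous_map (prod_topology euclideanreal X) X P1"
    "\<And>x. P1 (1, x) = x" "\<And>x. P1 (0, x) = h (1, fst (\<sigma> x))" "\<And>t. P1 (t, x0) = x0"
    using ex[OF continuous_map_fst] by auto
  obtain P2 where P2: "continuous_map (prod_topology euclideanreal X) X P2"
    "\<And>x. P2 (1, x) = x" "\<And>x. P2 (0, x) = h (1, snd (\<sigma> x))" "\<And>t. P2 (t, x0) = x0"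
    using ex[OF continuous_map_snd] by auto
  \<comment> \<open>The two deformations are joined at time 0, where both are the identity: towards
    -1 the first projection is used, towards 1 the second.\<close>
  define Q where "Q = (\<lambda>w. if fst w \<le> (0::real) then P1 (1 + fst w, snd w)
      else P2 (1 - fst w, snd w))"
  \<comment> \<open>On the wedge one of the coordinates is \<open>x0\<close>, where \<open>u\<close>
    vanishes. Hence \<open>s x < 1\<close> forces \<open>u (fst (\<sigma> x)) < 1\<close>, and
    \<open>s x > -1\<close> forces \<open>u (snd (\<sigma> x)) < 1\<close>.\<close>
  define s where "s = (\<lambda>x. u (fst (\<sigma> x)) - u (snd (\<sigma> x)))"
  have u01: "0 \<le> u x" "u x \<le> 1" if "x \<in> topspace X" for x
    using u that by (auto simp: continuous_map_def)
  have ux0: "u x0 = 0" using u0 by blast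
  show thesis
  proof
    show "continuous_map (prod_topology euclideanreal X) X Q"
      unfolding Q_def
    proof (rule continuous_map_cases_le)
      show "continuous_map (subtopology (prod_topology euclideanreal X)
          {x \<in> topspace (prod_topology euclideanreal X). fst x \<le> 0}) X (\<lambda>x. P1 (1 + fst x, snd x))"
        by (intro continuous_map_from_subtopology continuous_map_compose2[OF P1(1)]
            continuous_map_pairedI continuous_map_add continuous_map_fst continuous_map_snd) auto
      show "continuous_map (subtopology (prod_topology euclideanreal X)
          {x \<in> topspace (prod_topology euclideanreal X). 0 \<le> fst x}) X (\<lambda>x. P2 (1 - fst x, snd x))"
        by (intro continuous_map_from_subtopology continuous_map_compose2[OF P2(1)]
            continuous_map_pairedI continuous_map_diff continuous_map_fst continuous_map_snd) auto
    qed (auto simp: P1 P2 intro: continuous_map_fst)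
    show "continuous_map X euclideanreal s"
      unfolding s_def
      by (intro continuous_map_diff continuous_map_compose2[OF ur]
          continuous_map_compose2[OF continuous_map_fst sc]
          continuous_map_compose2[OF continuous_map_snd sc])
    show "s x0 = 0" by (simp add: s_def sx0)
    show "Q (-1, x) = x0" if x: "x \<in> topspace X" "s x < 1" for x
    proof -
      have "u (fst (\<sigma> x)) < 1"
        using sw[OF x(1)] x(2) u01 ux0 by (auto simp: s_def)
      moreover have "fst (\<sigma> x) \<in> topspace X" using sw[OF x(1)] x0 by auto
      ultimately show ?thesis using h1 by (simp add: Q_def P1)
    qed
    show "Q (1, x) = x0" if x: "x \<in> topspace X" "s x > -1" for x
    proof -
      have "u (snd (\<sigma> x)) < 1"
        using sw[OF x(1)] x(2) u01 ux0 by (auto simp: s_def)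
      moreover have "snd (\<sigma> x) \<in> topspace X" using sw[OF x(1)] x0 by auto
      ultimately show ?thesis using h1 by (simp add: Q_def P2)
    qed
  qed (auto simp: Q_def P1 P2)
qed

section \<open>Families of self-maps of \<open>Y\<close> and their inverses\<close>

locale contracting_family =
  fixes X :: "'a topology" and Y :: "'b topology" and x0 :: 'a and Q s \<Gamma>
  assumes Q: "continuous_map (prod_topology euclideanreal X) X Q"
    and s: "continuous_map X euclideanreal s"
    and Q0: "\<And>x. x \<in> topspace X \<Longrightarrow> Q (0, x) = x" and Qx0: "\<And>t. Q (t, x0) = x0" and sx0: "s x0 = 0"
    and Qm: "\<And>x. x \<in> topspace X \<Longrightarrow> s x < 1 \<Longrightarrow> Q (-1, x) = x0"
    and Qp: "\<And>x. x \<in> topspace X \<Longrightarrow> s x > -1 \<Longrightarrow> Q (1, x) = x0"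
    and x0: "x0 \<in> topspace X"
    and G: "continuous_map (prod_topology X Y) Y \<Gamma>" and Gx0: "\<And>y. y \<in> topspace Y \<Longrightarrow> \<Gamma> (x0, y) = y"
begin

text \<open>
  For fixed \<open>x\<close> with \<open>\<bar>s x\<bar> < 1\<close> the path \<open>Q (-, x)\<close> is a loop at \<open>x0\<close>.  Up to homotopy \<open>\<Gamma>\<close> is
  \<open>fam (\<lambda>a. a) (\<lambda>_. 1)\<close>, which runs through these loops as \<open>s x\<close> runs through \<open>[-1/2, 1/2]\<close>, and
  its inverse \<open>inv_fam\<close> runs through them backwards.  The composition of the two is deformed to a
  concatenation, as in the proof that loop multiplication is given by pointwise multiplication.
\<close>

definition fam :: "(real \<Rightarrow> real) \<Rightarrow> (real \<Rightarrow> real) \<Rightarrow> 'a \<times> 'b \<Rightarrow> 'b" where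
  "fam \<phi> \<psi> = (\<lambda>(x, y). if \<bar>s x\<bar> \<le> 1/2
      then \<Gamma> (Q (\<phi> (2 * s x), x), \<Gamma> (Q (\<psi> (2 * s x), x), y)) else y)"

lemma Q_in: "x \<in> topspace X \<Longrightarrow> Q (t, x) \<in> topspace X"
  using Q by (auto simp: continuous_map_def Pi_iff)

lemma G_in: "x \<in> topspace X \<Longrightarrow> y \<in> topspace Y \<Longrightarrow> \<Gamma> (x, y) \<in> topspace Y"
  using G by (auto simp: continuous_map_def Pi_iff)

lemma Q_end: "x \<in> topspace X \<Longrightarrow> \<bar>s x\<bar> \<le> 1/2 \<Longrightarrow> \<bar>t\<bar> = 1 \<Longrightarrow> Q (t, x) = x0"
  using Qm[of x] Qp[of x] by (cases "t = 1") (auto simp: abs_if split: if_splits)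

text \<open>The parameters are interpolated linearly. At \<open>\<bar>a\<bar> = 1\<close> they
  remain -1 or 1, where \<open>Q\<close> is \<open>x0\<close> and both factors are the identity, so
  the formula on the band keeps matching the identity outside. In between they may leave [-1, 1], as
  \<open>Q\<close> is defined for all real times.\<close>

lemma fam_homotopic:
  assumes c: "continuous_on UNIV \<phi>0" "continuous_on UNIV \<phi>1" "continuous_on UNIV \<psi>0" "continuous_on
      UNIV \<psi>1"
    and e: "\<And>a. \<bar>a\<bar> = 1 \<Longrightarrow> \<phi>0 a = \<phi>1 a \<and> \<psi>0 a = \<psi>1 a \<and> \<bar>\<phi>0 a\<bar> = 1 \<and> \<bar>\<psi>0 a\<bar> = 1"
  shows "homotopic_with (fixes_fibre x0 Y) (prod_topology X Y) Y (fam \<phi>0 \<psi>0) (fam \<phi>1 \<psi>1)"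
proof -
  define k where "k = (\<lambda>w. fam (\<lambda>a. (1 - fst w) * \<phi>0 a + fst w * \<phi>1 a)
     (\<lambda>a. (1 - fst w) * \<psi>0 a + fst w * \<psi>1 a) (snd w))"
  let ?W = "prod_topology unit_interval (prod_topology X Y)"
  have fr: "continuous_map ?W euclideanreal fst"
    using continuous_map_into_fulltopology[OF continuous_map_fst] .
  have X: "continuous_map ?W X (\<lambda>w. fst (snd w))"
    by (rule continuous_map_fst_snd)
  have Y: "continuous_map ?W Y (\<lambda>w. snd (snd w))"
    by (rule continuous_map_snd_snd)
  have S: "continuous_map ?W euclideanreal (\<lambda>w. s (fst (snd w)))"
    by (rule continuous_map_compose2[OF s X])
  have lin: "continuous_map ?W euclideanreal (\<lambda>w. (1 - fst w) * \<phi> (2 * s (fst (snd w))) + fst w * \<psi>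
      (2 * s (fst (snd w))))"
    if "continuous_on UNIV \<phi>" "continuous_on UNIV \<psi>" for \<phi> \<psi> :: "real \<Rightarrow> real"
  proof -
    have "continuous_map ?W euclideanreal (\<lambda>w. \<phi> (2 * s (fst (snd w))))" if "continuous_on UNIV \<phi>"
        for \<phi> :: "real \<Rightarrow> real"
    proof -
      have "continuous_map euclideanreal euclideanreal \<phi>" using that by simp
      then show ?thesis by (rule continuous_map_compose2) (rule continuous_map_real_mult_left[OF S])
    qed
    then show ?thesis using that
      by (intro continuous_map_add continuous_map_real_mult continuous_map_diff fr) auto
  qed
  have cont: "continuous_map ?W Y k"
    unfolding k_def fam_def case_prod_unfold
  proof (rule continuous_map_cases_le)
    show "continuous_map ?W euclideanreal (\<lambda>w. \<bar>s (fst (snd w))\<bar>)"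
      by (intro continuous_map_real_abs S)
    show "continuous_map (subtopology ?W {w \<in> topspace ?W. \<bar>s (fst (snd w))\<bar> \<le> 1/2}) Y
      (\<lambda>w. \<Gamma> (Q ((1 - fst w) * \<phi>0 (2 * s (fst (snd w))) + fst w * \<phi>1 (2 * s (fst (snd w))), fst
          (snd w)),
           \<Gamma> (Q ((1 - fst w) * \<psi>0 (2 * s (fst (snd w))) + fst w * \<psi>1 (2 * s (fst (snd w))), fst
               (snd w)), snd (snd w))))"
      by (intro continuous_map_from_subtopology continuous_map_compose2[OF G] continuous_map_pairedI
          continuous_map_compose2[OF Q] lin c X Y)
    show "continuous_map (subtopology ?W {w \<in> topspace ?W. 1/2 \<le> \<bar>s (fst (snd w))\<bar>}) Y (\<lambda>w. snd
        (snd w))"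
      by (intro continuous_map_from_subtopology Y)
  next
    fix w assume w: "w \<in> topspace ?W" and half: "\<bar>s (fst (snd w))\<bar> = 1/2"
    let ?a = "2 * s (fst (snd w))"
    have "\<bar>?a\<bar> = 1" using half by (auto simp: abs_if split: if_splits)
    from e[OF this] have "\<bar>(1 - fst w) * \<phi>0 ?a + fst w * \<phi>1 ?a\<bar> = 1" "\<bar>(1 - fst w) * \<psi>0 ?a + fst w
        * \<psi>1 ?a\<bar> = 1"
      by (auto simp: algebra_simps)
    moreover have "fst (snd w) \<in> topspace X" "snd (snd w) \<in> topspace Y" using w by auto
    ultimately show "\<Gamma> (Q ((1 - fst w) * \<phi>0 ?a + fst w * \<phi>1 ?a, fst (snd w)),
           \<Gamma> (Q ((1 - fst w) * \<psi>0 ?a + fst w * \<psi>1 ?a, fst (snd w)), snd (snd w))) = snd (snd w)"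
      using half Q_end Gx0 by simp
  qed simp
  show ?thesis
    unfolding homotopic_with_def
    by (intro exI[of _ k] conjI cont) (auto simp: k_def fam_def Qx0 Gx0)
qed

lemma fam_continuous:
  assumes "continuous_on UNIV \<phi>" "continuous_on UNIV \<psi>" "\<And>a. \<bar>a\<bar> = 1 \<Longrightarrow> \<bar>\<phi> a\<bar> = 1 \<and> \<bar>\<psi> a\<bar> = 1"
  shows "continuous_map (prod_topology X Y) Y (fam \<phi> \<psi>)"
  using homotopic_with_imp_continuous_maps[OF fam_homotopic[of \<phi> \<phi> \<psi> \<psi>]] assms by blast

definition inv_fam :: "'a \<times> 'b \<Rightarrow> 'b" where
  "inv_fam = fam uminus (\<lambda>_. 1)"

text \<open>The time of \<open>Q\<close> grows from 0, where \<open>Q\<close> is the identity, to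
  \<open>2 * s x\<close> cut off at -1 and 1. Outside the band the cut-off value has the sign of
  \<open>s x\<close>, and the contraction valid for that sign has arrived at
  \<open>x0\<close>.\<close>

lemma homotopic_fam: "homotopic_with (fixes_fibre x0 Y) (prod_topology X Y) Y \<Gamma> (fam (\<lambda>a. a) (\<lambda>_.
    1))"
proof -
  define k where "k = (\<lambda>w. \<Gamma> (Q (fst w * max (-1) (min 1 (2 * s (fst (snd w)))), fst (snd w)), snd
      (snd w)))"
  let ?W = "prod_topology unit_interval (prod_topology X Y)"
  have fr: "continuous_map ?W euclideanreal fst"
    using continuous_map_into_fulltopology[OF continuous_map_fst] .
  have X: "continuous_map ?W X (\<lambda>w. fst (snd w))"
    by (rule continuous_map_fst_snd)
  have Y: "continuous_map ?W Y (\<lambda>w. snd (snd w))"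
    by (rule continuous_map_snd_snd)
  have S: "continuous_map ?W euclideanreal (\<lambda>w. s (fst (snd w)))"
    by (rule continuous_map_compose2[OF s X])
  have cont: "continuous_map ?W Y k"
    unfolding k_def
    by (intro continuous_map_compose2[OF G] continuous_map_pairedI
        continuous_map_compose2[OF Q] fr X Y
        continuous_map_real_mult continuous_map_real_max continuous_map_real_min
        continuous_map_real_mult_left S) auto
  have "\<Gamma> (Q (max (-1) (min 1 (2 * s x)), x), y) = fam (\<lambda>a. a) (\<lambda>_. 1) (x, y)"
    if xy: "x \<in> topspace X" "y \<in> topspace Y" for x y
  proof (cases "\<bar>s x\<bar> \<le> 1/2")
    case True
    then have "max (-1) (min 1 (2 * s x)) = 2 * s x" by (auto simp: abs_if split: if_splits)
    then show ?thesis using True xy by (simp add: fam_def Q_end Gx0)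
  next
    case False
    then consider "s x > 1/2" | "s x < -1/2" by linarith
    then have "Q (max (-1) (min 1 (2 * s x)), x) = x0"
      using Qp[OF xy(1)] Qm[OF xy(1)] by cases (auto simp: max_def min_def)
    then show ?thesis using False xy by (simp add: fam_def Gx0)
  qed
  then show ?thesis
    by (subst homotopic_with) (use x0 in \<open>auto simp: k_def Q0 Qx0 Gx0 intro!: exI[of _ k] cont\<close>)
qed

lemma homotopic_fam_snd:
  assumes p: "\<phi> = (\<lambda>a. a) \<and> \<psi> = uminus \<or> \<phi> = uminus \<and> \<psi> = (\<lambda>a. a)"
  shows "homotopic_with (fixes_fibre x0 Y) (prod_topology X Y) Y (fam \<phi> \<psi>) snd"
proof -
  have c: "continuous_on UNIV \<phi>" "continuous_on UNIV \<psi>"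
    using p by (auto intro: continuous_intros)
  \<comment> \<open>For \<open>\<phi> a = a\<close> the cut parameter rests at -1 for
    \<open>a \<le> 0\<close> and runs from -1 to 1 on [0, 1]; for \<open>uminus\<close> the signs
    are exchanged. So at every \<open>a\<close> one factor rests at -1, where it is the identity,
    and the product becomes a single factor with parameter
    \<open>2 * \<bar>a\<bar> - 1\<close>.\<close>
  let ?cut = "\<lambda>\<phi> a. max (2 * \<phi> a - 1) (-1 :: real)"
  have "homotopic_with (fixes_fibre x0 Y) (prod_topology X Y) Y (fam \<phi> \<psi>) (fam (?cut \<phi>) (?cut \<psi>))"
    by (intro fam_homotopic c continuous_intros) (use p in \<open>auto simp: abs_if split: if_splits\<close>)
  moreover have "homotopic_with (fixes_fibre x0 Y) (prod_topology X Y) Y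
      (fam (?cut \<phi>) (?cut \<psi>)) (fam (\<lambda>a. 2 * \<bar>a\<bar> - 1) (\<lambda>_. -1))"
  proof (rule homotopic_with_equal)
    show "continuous_map (prod_topology X Y) Y (fam (?cut \<phi>) (?cut \<psi>))"
      by (intro fam_continuous c continuous_intros) (use p in \<open>auto simp: abs_if split: if_splits\<close>)
    fix z assume "z \<in> topspace (prod_topology X Y)"
    then obtain x y where z: "z = (x, y)" and x: "x \<in> topspace X" and y: "y \<in> topspace Y" by auto
    have r: "\<Gamma> (Q (t, x), y) \<in> topspace Y" for t using G_in Q_in x y by blast
    show "fam (?cut \<phi>) (?cut \<psi>) z = fam (\<lambda>a. 2 * \<bar>a\<bar> - 1) (\<lambda>_. -1) z"
    proof (cases "\<bar>s x\<bar> \<le> 1/2")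
      case True
      have "\<Gamma> (Q (-1, x), y') = y'" if "y' \<in> topspace Y" for y'
        using Q_end[OF x True, of "-1"] Gx0[OF that] by simp
      moreover have "max (- (4 * s x) - 1) (- 1) = - (4 * s x) - 1 \<and>
          max (4 * s x - 1) (- 1) = -1 \<and> \<bar>s x\<bar> = - s x
        \<or> max (- (4 * s x) - 1) (- 1) = -1 \<and> max (4 * s x - 1) (- 1) = 4 * s x - 1 \<and> \<bar>s x\<bar> = s x"
        by (auto simp: max_def)
      ultimately show ?thesis using p True r y by (auto simp: z fam_def Gx0 abs_mult)
    qed (simp add: z fam_def)
  qed (auto simp: fam_def sx0 Qx0 Gx0)
  \<comment> \<open>The parameter runs from 1 to -1 and back again. The constant 1 has the same end
    values, so this path contracts.\<close>
  moreover have "homotopic_with (fixes_fibre x0 Y) (prod_topology X Y) Y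
      (fam (\<lambda>a. 2 * \<bar>a\<bar> - 1) (\<lambda>_. -1)) (fam (\<lambda>_. 1) (\<lambda>_. -1))"
    by (intro fam_homotopic continuous_intros) auto
  moreover have "homotopic_with (fixes_fibre x0 Y) (prod_topology X Y) Y (fam (\<lambda>_. 1) (\<lambda>_. -1)) snd"
  proof (rule homotopic_with_equal)
    show "continuous_map (prod_topology X Y) Y (fam (\<lambda>_. 1) (\<lambda>_. -1))"
      by (intro fam_continuous continuous_intros) auto
  qed (auto simp: fam_def Q_end Gx0 Qx0)
  ultimately show ?thesis
    using homotopic_with_trans by blast
qed

lemma inv_fam_continuous: "continuous_map (prod_topology X Y) Y inv_fam"
  unfolding inv_fam_def by (intro fam_continuous continuous_intros) auto

lemma inv_fam_x0: "fixes_fibre x0 Y inv_fam"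
  by (simp add: inv_fam_def fam_def Qx0 Gx0)

text \<open>Once \<open>\<Gamma>\<close> is replaced by its loop form, the factors with constant
  parameter 1 are the identity on the band, so the composite agrees with the two-parameter family
  \<open>fam uminus (\<lambda>a. a)\<close>.\<close>

lemma inv_fam_left: "homotopic_with (fixes_fibre x0 Y) (prod_topology X Y) Y (\<lambda>z. inv_fam (fst z, \<Gamma>
    z)) snd"
proof -
  let ?P = "prod_topology X Y"
  have i: "homotopic_with (fixes_fibre x0 Y) ?P Y inv_fam inv_fam"
    using inv_fam_continuous inv_fam_x0 by simp
  have "homotopic_with (fixes_fibre x0 Y) ?P Y (\<lambda>z. inv_fam (fst z, fam (\<lambda>a. a) (\<lambda>_. 1) z)) (fam
      uminus (\<lambda>a. a))"
  proof (rule homotopic_with_equal)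
    show "continuous_map ?P Y (\<lambda>z. inv_fam (fst z, fam (\<lambda>a. a) (\<lambda>_. 1) z))"
      by (intro continuous_map_compose2[OF inv_fam_continuous] continuous_map_pairedI
          continuous_map_fst
          fam_continuous continuous_intros) auto
  qed (auto simp: inv_fam_def fam_def Q_end Gx0 Qx0 G_in Q_in)
  then show ?thesis
    by (intro homotopic_with_trans[OF homotopic_with_fibrewise_compose[OF i homotopic_fam x0]]
        homotopic_with_trans[OF _ homotopic_fam_snd]) blast+
qed

lemma inv_fam_right: "homotopic_with (fixes_fibre x0 Y) (prod_topology X Y) Y (\<lambda>z. \<Gamma> (fst z,
    inv_fam z)) snd"
proof -
  let ?P = "prod_topology X Y"
  have i: "homotopic_with (fixes_fibre x0 Y) ?P Y inv_fam inv_fam"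
    using inv_fam_continuous inv_fam_x0 by simp
  have "homotopic_with (fixes_fibre x0 Y) ?P Y (\<lambda>z. fam (\<lambda>a. a) (\<lambda>_. 1) (fst z, inv_fam z)) (fam
      (\<lambda>a. a) uminus)"
  proof (rule homotopic_with_equal)
    show "continuous_map ?P Y (\<lambda>z. fam (\<lambda>a. a) (\<lambda>_. 1) (fst z, inv_fam z))"
      by (intro continuous_map_compose2[OF fam_continuous] continuous_map_pairedI continuous_map_fst
          inv_fam_continuous continuous_intros) auto
  qed (auto simp: inv_fam_def fam_def Q_end Gx0 Qx0 G_in Q_in)
  then show ?thesis
    by (intro homotopic_with_trans[OF homotopic_with_fibrewise_compose[OF homotopic_fam i x0]]
        homotopic_with_trans[OF _ homotopic_fam_snd]) blast+
qed

end

section \<open>Relative homotopy lifting for the evaluation map\<close>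

text \<open>The set \<open>w < 1\<close> is a neighbourhood of the graph of \<open>e\<close> in
  \<open>X \<times> Y\<close> that deforms onto the graph over \<open>X\<close>. For compact
  \<open>X\<close> this becomes a contraction of a neighbourhood of \<open>e\<close> in the mapping
  space.\<close>

definition fibrewise_contractible_near :: "'a topology \<Rightarrow> 'b topology \<Rightarrow> ('a \<Rightarrow> 'b) \<Rightarrow> bool" where
  "fibrewise_contractible_near X Y e \<longleftrightarrow>
     (\<exists>c w. continuous_map (prod_topology unit_interval (prod_topology X Y)) Y c \<and>
        continuous_map (prod_topology X Y) euclideanreal w \<and>
        (\<forall>x\<in>topspace X. \<forall>y\<in>topspace Y. c (0, x, y) = y) \<and>
        (\<forall>x\<in>topspace X. \<forall>t\<in>{0..1}. c (t, x, e x) = e x) \<and>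
        (\<forall>x\<in>topspace X. w (x, e x) = 0) \<and>
        (\<forall>x\<in>topspace X. \<forall>y\<in>topspace Y. w (x, y) < 1 \<longrightarrow> c (1, x, y) = e x))"

section \<open>Contracting a neighbourhood in the mapping space\<close>

lemma restrict_eq_map:
  "g \<in> maps X Y \<Longrightarrow> (\<And>x. x \<in> topspace X \<Longrightarrow> f x = g x) \<Longrightarrow> restrict f (topspace X) = g"
  by (rule extensionalityI[of _ "topspace X"]) (auto simp: maps_def)

lemma maps_real_Sup:
  assumes X: "compact_space X" "topspace X \<noteq> {}" and g: "g \<in> maps X euclideanreal"
  shows "\<exists>x\<in>topspace X. Sup (g ` topspace X) = g x" "\<And>x. x \<in> topspace X \<Longrightarrow>
      g x \<le> Sup (g ` topspace X)"
proof -
  have "compactin euclideanreal (g ` topspace X)"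
    using X(1) maps_continuous[OF g] image_compactin unfolding compact_space_def by blast
  then have "compact (g ` topspace X)" by simp
  then obtain x where x: "x \<in> topspace X" "\<And>x'. x' \<in> topspace X \<Longrightarrow> g x' \<le> g x"
    using compact_attains_sup[of "g ` topspace X"] X(2) by auto
  then have S: "Sup (g ` topspace X) = g x" by (intro cSup_eq_maximum) auto
  then show "\<exists>x\<in>topspace X. Sup (g ` topspace X) = g x" using x by blast
  show "\<And>x'. x' \<in> topspace X \<Longrightarrow> g x' \<le> Sup (g ` topspace X)" using S x by simp
qed

text \<open>An upper bound is a subbasic condition with all of the compact \<open>X\<close> as test
  set; a lower bound is a union of conditions at single points.\<close>

lemma continuous_map_Sup_image:
  assumes X: "compact_space X" "topspace X \<noteq> {}"
  shows "continuous_map (compact_open X euclideanreal) euclideanreal (\<lambda>g. Sup (g ` topspace X))"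
  unfolding continuous_map_upper_lower_semicontinuous_lt topspace_compact_open
proof (intro conjI allI)
  note S = maps_real_Sup[OF X]
  fix a :: real
  have lt: "Sup (g ` topspace X) < a \<longleftrightarrow> g ` topspace X \<subseteq> {..<a}"
    and gt: "a < Sup (g ` topspace X) \<longleftrightarrow> (\<exists>x\<in>topspace X. a < g x)" if g: "g \<in> maps X euclideanreal"
        for g
  proof -
    obtain x where x: "x \<in> topspace X" "Sup (g ` topspace X) = g x" using S(1)[OF g] by blast
    have le: "g x' \<le> g x" if "x' \<in> topspace X" for x' using S(2)[OF g that] x(2) by simp
    show "Sup (g ` topspace X) < a \<longleftrightarrow> g ` topspace X \<subseteq> {..<a}"
      unfolding x(2) using x(1) le_less_trans[OF le] by blast
    show "a < Sup (g ` topspace X) \<longleftrightarrow> (\<exists>x\<in>topspace X. a < g x)"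
      unfolding x(2) using x(1) less_le_trans[OF _ le] by blast
  qed
  have "{g \<in> maps X euclideanreal. Sup (g ` topspace X) < a} = {g \<in> maps X euclideanreal. g `
      topspace X \<subseteq> {..<a}}"
    using lt by blast
  then show "openin (compact_open X euclideanreal) {g \<in> maps X euclideanreal. Sup (g ` topspace X)
      < a}"
    using X by (simp add: openin_compact_open compact_space_def)
  have "{g \<in> maps X euclideanreal. a < Sup (g ` topspace X)} =
      (\<Union>x\<in>topspace X. {g \<in> maps X euclideanreal. g ` {x} \<subseteq> {a<..}})"
    using gt by auto
  moreover have "openin (compact_open X euclideanreal) {g \<in> maps X euclideanreal. g ` {x} \<subseteq> {a<..}}"
    if "x \<in> topspace X" for x using that by (intro openin_compact_open) auto
  ultimately show "openin (compact_open X euclideanreal) {g \<in> maps X euclideanreal. a < Sup (g `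
      topspace X)}"
    by auto
qed

text \<open>The gauge of \<open>g\<close> is the supremum of the gauge along its graph. The value at
  \<open>x0\<close> moves by a homotopy \<open>c\<close> of \<open>Y\<close> that depends on this
  value alone, which is what allows its motion to be undone later.\<close>

lemma fibrewise_contractible_near_mapping_space:
  assumes X: "compact_space X" "Hausdorff_space X" "x0 \<in> topspace X"
    and e: "e \<in> maps X Y" and near: "fibrewise_contractible_near X Y e"
  obtains c S W where
    "continuous_map (prod_topology unit_interval Y) Y c"
    "\<And>y. y \<in> topspace Y \<Longrightarrow> c (0, y) = y" "\<And>t. t \<in> {0..1} \<Longrightarrow> c (t, e x0) = e x0"
    "continuous_map (prod_topology unit_interval (compact_open X Y)) (compact_open X Y) S"
    "continuous_map (compact_open X Y) euclideanreal W"
    "\<And>t g. g \<in> maps X Y \<Longrightarrow> S (t, g) x0 = c (t, g x0)"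
    "\<And>g. g \<in> maps X Y \<Longrightarrow> S (0, g) = g" "\<And>t. t \<in> {0..1} \<Longrightarrow> S (t, e) = e" "W e = 0"
    "\<And>g. g \<in> maps X Y \<Longrightarrow> W g < 1 \<Longrightarrow> S (1, g) = e"
proof -
  obtain c w where cw: "continuous_map (prod_topology unit_interval (prod_topology X Y)) Y c \<and>
        continuous_map (prod_topology X Y) euclideanreal w \<and>
        (\<forall>x\<in>topspace X. \<forall>y\<in>topspace Y. c (0, x, y) = y) \<and>
        (\<forall>x\<in>topspace X. \<forall>t\<in>{0..1}. c (t, x, e x) = e x) \<and>
        (\<forall>x\<in>topspace X. w (x, e x) = 0) \<and>
        (\<forall>x\<in>topspace X. \<forall>y\<in>topspace Y. w (x, y) < 1 \<longrightarrow> c (1, x, y) = e x)"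
    using near unfolding fibrewise_contractible_near_def by (elim exE) (rule that)
  then have c: "continuous_map (prod_topology unit_interval (prod_topology X Y)) Y c"
    and w: "continuous_map (prod_topology X Y) euclideanreal w"
    and c0: "\<And>x y. x \<in> topspace X \<Longrightarrow> y \<in> topspace Y \<Longrightarrow> c (0, x, y) = y"
    and ce: "\<And>x t. x \<in> topspace X \<Longrightarrow> t \<in> {0..1} \<Longrightarrow> c (t, x, e x) = e x"
    and we: "\<And>x. x \<in> topspace X \<Longrightarrow> w (x, e x) = 0"
    and c1: "\<And>x y. x \<in> topspace X \<Longrightarrow> y \<in> topspace Y \<Longrightarrow> w (x, y) < 1 \<Longrightarrow> c (1, x, y) = e x"
    by simp_all
  let ?S = "\<lambda>(t, g). restrict (\<lambda>x. c (t, x, g x)) (topspace X)"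
  let ?W = "\<lambda>g. Sup (act X w g ` topspace X)"
  have ne: "topspace X \<noteq> {}" using X by blast
  show thesis
  proof
    show "continuous_map (prod_topology unit_interval Y) Y (\<lambda>z. c (fst z, x0, snd z))"
      by (intro continuous_map_compose2[OF c] continuous_map_pairedI continuous_map_fst
          continuous_map_snd)
         (use X in auto)
    show "continuous_map (prod_topology unit_interval (compact_open X Y)) (compact_open X Y) ?S"
      by (rule continuous_map_act[OF X(2) c])
    show "continuous_map (compact_open X Y) euclideanreal ?W"
      by (rule continuous_map_compose2[OF continuous_map_Sup_image[OF X(1) ne]
          continuous_map_act_single[OF X(2) w]])
    show "?S (0, g) = g" if g: "g \<in> maps X Y" for g
      using maps_apply[OF g] by (auto simp: c0 intro!: restrict_eq_map[OF g])
    show "?S (t, e) = e" if "t \<in> {0..1}" for t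
      using ce that by (auto intro!: restrict_eq_map[OF e])
    have "act X w e = (\<lambda>x\<in>topspace X. 0)" by (auto simp: act_def we)
    then show "?W e = 0" using ne by simp
    show "?S (1, g) = e" if g: "g \<in> maps X Y" and W: "?W g < 1" for g
    proof -
      have "w (x, g x) < 1" if x: "x \<in> topspace X" for x
        using maps_real_Sup(2)[OF X(1) ne act_in_maps[OF w g] x] W x by (simp add: act_apply)
      then show ?thesis
        using c1 maps_apply[OF g] by (auto intro!: restrict_eq_map[OF e])
    qed
  qed (use X c0 ce in auto)
qed

text \<open>
  Stroem's relative homotopy lifting, made explicit for the evaluation map.  First contract towards
  \<open>e\<close> and then follow \<open>P\<close>.  This moves the value at \<open>x0\<close>, along a path that is constant over the
  basepoint; the motion is undone in the neighbourhood \<open>u < \<tau>\<close> of \<open>x0\<close>, whose size \<open>\<tau>\<close>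
  vanishes exactly where nothing has to be undone.
\<close>

lemma evaluation_relative_homotopy_lifting:
  assumes X: "compact_space X" "Hausdorff_space X" and nX: "nondegenerate_basepoint X x0"
    and nY: "nondegenerate_basepoint Y y0"
    and e: "e \<in> maps X Y" "e x0 = y0" and near: "fibrewise_contractible_near X Y e"
    and G: "continuous_map (prod_topology unit_interval (compact_open X Y)) (compact_open X Y) G"
    and Gx0: "\<And>z g. z \<in> {0..1} \<Longrightarrow> g \<in> maps X Y \<Longrightarrow> G (z, g) x0 = g x0"
    and P: "continuous_map (prod_topology unit_interval unit_interval) (compact_open X Y) P"
    and P0: "\<And>z. z \<in> {0..1} \<Longrightarrow> P (z, 0) = G (z, e)"
    and Px0: "\<And>z t. z \<in> {0..1} \<Longrightarrow> t \<in> {0..1} \<Longrightarrow> P (z, t) x0 = y0"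
  obtains K where
    "continuous_map (prod_topology unit_interval (prod_topology unit_interval (compact_open X Y)))
        (compact_open X Y) K"
    "\<And>z g. z \<in> {0..1} \<Longrightarrow> g \<in> maps X Y \<Longrightarrow> K (z, 0, g) = G (z, g)"
    "\<And>z t g. z \<in> {0..1} \<Longrightarrow> t \<in> {0..1} \<Longrightarrow> g \<in> maps X Y \<Longrightarrow> K (z, t, g) x0 = g x0"
    "\<And>z t. z \<in> {0..1} \<Longrightarrow> t \<in> {0..1} \<Longrightarrow> K (z, t, e) = P (z, max 0 (2 * t - 1))"
proof -
  let ?M = "compact_open X Y"
  have x0: "x0 \<in> topspace X" using nX by (simp add: nondegenerate_basepoint_def)
  obtain u h where u: "continuous_map X (top_of_set {0..1::real}) u"
    and u0: "{x \<in> topspace X. u x = 0} = {x0}"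
    and h: "continuous_map (prod_topology unit_interval X) X h"
    and h0: "\<And>x. x \<in> topspace X \<Longrightarrow> h (0, x) = x"
    and hx0: "\<And>t. t \<in> {0..1} \<Longrightarrow> h (t, x0) = x0"
    and h1: "\<And>x. x \<in> topspace X \<Longrightarrow> u x < 1 \<Longrightarrow> h (1, x) = x0"
    using nX unfolding nondegenerate_basepoint_def by blast
  have ur: "continuous_map X euclideanreal u"
    using u continuous_map_into_fulltopology by blast
  have u_nn: "0 \<le> u x" if "x \<in> topspace X" for x
    using u that by (auto simp: continuous_map_def)
  have u0D: "x = x0" if "x \<in> topspace X" "u x = 0" for x using u0 that by blast
  obtain v where v: "continuous_map Y (top_of_set {0..1::real}) v"
      and v0: "{y \<in> topspace Y. v y = 0} = {y0}"
    using nY unfolding nondegenerate_basepoint_def by blast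
  have v0D: "y = y0" if "y \<in> topspace Y" "v y = 0" for y using v0 that by blast
  have vr: "continuous_map Y euclideanreal v"
    using v continuous_map_into_fulltopology by blast
  have v01: "0 \<le> v y \<and> v y \<le> 1" if "y \<in> topspace Y" for y
    using v that by (auto simp: continuous_map_def)
  obtain c S W where
    c: "continuous_map (prod_topology unit_interval Y) Y c"
    and c0: "\<And>y. y \<in> topspace Y \<Longrightarrow> c (0, y) = y" and cy0: "\<And>t. t \<in> {0..1} \<Longrightarrow> c (t, y0) = y0"
    and S: "continuous_map (prod_topology unit_interval ?M) ?M S"
    and W: "continuous_map ?M euclideanreal W"
    and Sx0: "\<And>t g. g \<in> maps X Y \<Longrightarrow> S (t, g) x0 = c (t, g x0)"
    and S0: "\<And>g. g \<in> maps X Y \<Longrightarrow> S (0, g) = g" and Se: "\<And>t. t \<in> {0..1} \<Longrightarrow> S (t, e) = e"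
    and We: "W e = 0" and S1: "\<And>g. g \<in> maps X Y \<Longrightarrow> W g < 1 \<Longrightarrow> S (1, g) = e"
    by (rule fibrewise_contractible_near_mapping_space[OF X x0 e(1) near, unfolded e(2)]) (rule
        that; assumption)
  define clamp :: "real \<Rightarrow> real" where "clamp r = max 0 (min 1 r)" for r
  have clamp01: "clamp r \<in> {0..1}" for r by (simp add: clamp_def)
  have clamp0: "clamp 0 = 0" by (simp add: clamp_def)
  have clamp_c: "continuous_map A unit_interval (\<lambda>a. clamp (m a))"
      if "continuous_map A euclideanreal m"
    for A :: "'c topology" and m
    unfolding clamp_def using that by (rule continuous_map_clamp)
  \<comment> \<open>\<open>\<rho> (\<tau>, -)\<close> is the identity for \<open>\<tau> = 0\<close>,
    and for \<open>0 < \<tau> < 1\<close> it sends the points with \<open>u x = \<tau>\<close> to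
    \<open>x0\<close>.\<close>
  define \<rho> where "\<rho> = (\<lambda>(\<tau>, x). h (clamp (\<tau> / u x), x))"
  have rho: "continuous_map (prod_topology euclideanreal X) X \<rho>"
  proof -
    have "continuous_map (prod_topology unit_interval (prod_topology euclideanreal X)) X (\<lambda>w. h
        (fst w, snd (snd w)))"
      by (intro continuous_map_compose2[OF h] continuous_map_pairedI continuous_map_fst
          continuous_map_snd_snd)
    then have "continuous_map (prod_topology euclideanreal X) X
        (\<lambda>a. (\<lambda>w. h (fst w, snd (snd w))) (max 0 (min 1 (fst a / u (snd a))), a))"
      by (rule continuous_map_singular_ratio)
        (use hx0 in \<open>auto dest!: u0D intro: continuous_map_fst continuous_map_compose2[OF ur
            continuous_map_snd]\<close>)
    then show ?thesis by (simp add: \<rho>_def clamp_def case_prod_unfold)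
  qed
  \<comment> \<open>The path of \<open>y\<close> under \<open>c\<close> with the distance
    \<open>r\<close> from \<open>x0\<close> as time: it starts at \<open>y\<close>, and at
    \<open>r = clamp (2 * t) * (v y / 2)\<close> it has reached
    \<open>c (clamp (2 * t), y)\<close>.\<close>
  define b where "b = (\<lambda>(r, y). c (clamp (r / (v y / 2)), y))"
  have b: "continuous_map (prod_topology euclideanreal Y) Y b"
  proof -
    have "continuous_map (prod_topology unit_interval (prod_topology euclideanreal Y)) Y (\<lambda>w. c
        (fst w, snd (snd w)))"
      by (intro continuous_map_compose2[OF c] continuous_map_pairedI continuous_map_fst
          continuous_map_snd_snd)
    moreover have "continuous_map (prod_topology euclideanreal Y) euclideanreal (\<lambda>a. v (snd a) / 2)"
      using continuous_map_compose2[OF vr continuous_map_snd] by (intro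
          continuous_map_real_divide) auto
    ultimately have "continuous_map (prod_topology euclideanreal Y) Y
        (\<lambda>a. (\<lambda>w. c (fst w, snd (snd w))) (max 0 (min 1 (fst a / (v (snd a) / 2))), a))"
      by (rule continuous_map_singular_ratio[OF _ continuous_map_fst])
         (use cy0 in \<open>auto dest!: v0D\<close>)
    then show ?thesis by (simp add: b_def clamp_def case_prod_unfold)
  qed
  \<comment> \<open>In the first half \<open>S\<close> acts before \<open>G\<close>. In the second
    half a map with \<open>W g \<le> 1/2\<close> has become \<open>e\<close>, so \<open>P\<close>
    can take over from \<open>G (z, e)\<close>; the factor \<open>1 - 2 * W g\<close> brings
    \<open>P\<close> to rest at the edge of this region.\<close>
  define Gh where "Gh = (\<lambda>(z, t, g). if W g \<le> 1/2 then
      (if t \<le> 1/2 then G (z, S (clamp (2 * t), g)) else P (z, clamp ((2 * t - 1) * (1 - 2 * W g))))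
      else G (z, S (clamp (2 * t), g)))"
  let ?D = "prod_topology unit_interval (prod_topology unit_interval ?M)"
  have pz: "continuous_map ?D unit_interval fst" by (rule continuous_map_fst)
  have pt: "continuous_map ?D euclideanreal (\<lambda>w. fst (snd w))"
    using continuous_map_fst_snd continuous_map_into_fulltopology by blast
  have pg: "continuous_map ?D ?M (\<lambda>w. snd (snd w))"
    by (rule continuous_map_snd_snd)
  have Wg: "continuous_map ?D euclideanreal (\<lambda>w. W (snd (snd w)))"
    by (rule continuous_map_compose2[OF W pg])
  let ?G = "\<lambda>w. G (fst w, S (clamp (2 * fst (snd w)), snd (snd w)))"
  let ?P = "\<lambda>w. P (fst w, clamp ((2 * fst (snd w) - 1) * (1 - 2 * W (snd (snd w)))))"
  let ?tau = "\<lambda>a. clamp (2 * fst (snd (fst a))) * (v (snd (snd (fst a)) x0) / 2)"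
  let ?d = "\<lambda>a. (fst (fst a), fst (snd (fst a)), snd (snd (fst a)))"
  have GS: "continuous_map ?D ?M ?G"
    by (intro continuous_map_compose2[OF G] continuous_map_compose2[OF S]
        continuous_map_pairedI pz pg
        clamp_c continuous_map_real_mult_left pt)
  have PP: "continuous_map ?D ?M ?P"
    by (intro continuous_map_compose2[OF P] continuous_map_pairedI pz
        clamp_c continuous_map_real_mult continuous_map_diff
            continuous_map_real_mult_left pt Wg) auto
  have S1': "S (1, g) = e" if "g \<in> maps X Y" "W g \<le> 1/2" for g using S1 that by simp
  have Gh: "continuous_map ?D ?M Gh"
    unfolding Gh_def case_prod_unfold
  proof (rule continuous_map_cases_le[OF Wg])
    show "continuous_map (subtopology ?D {w \<in> topspace ?D. W (snd (snd w)) \<le> 1/2}) ?M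
     (\<lambda>w. if fst (snd w) \<le> 1/2 then ?G w
        else ?P w)"
    proof (rule continuous_map_cases_le)
      fix w assume w: "w \<in> topspace (subtopology ?D {w \<in> topspace ?D. W (snd (snd w)) \<le> 1/2})"
        and half: "fst (snd w) = 1/2"
      have cl: "clamp (2 * fst (snd w)) = 1" "clamp ((2 * fst (snd w) - 1) * r) = 0" for r
        by (simp_all add: half clamp_def)
      show "?G w =
          ?P w"
        unfolding cl using w by (auto simp: P0 S1' topspace_compact_open)
    qed (auto intro!: continuous_map_from_subtopology pt GS PP)
  next
    fix w assume w: "w \<in> topspace ?D" and half: "W (snd (snd w)) = 1/2"
    have cl: "clamp (r * (1 - 2 * W (snd (snd w)))) = 0" for r
      by (simp add: half clamp_def)
    have "S (clamp (2 * fst (snd w)), snd (snd w)) = e" if "\<not> fst (snd w) \<le> 1/2"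
      using that w half by (auto simp: S1' clamp_def topspace_compact_open)
    then show "(if fst (snd w) \<le> 1/2 then ?G w
        else ?P w) =
        ?G w"
      unfolding cl using w by (auto simp: P0)
  qed (auto intro!: continuous_map_from_subtopology GS)
  have Ghx0: "Gh (z, t, g) x0 = c (clamp (2 * t), g x0)"
    if "z \<in> {0..1}" "t \<in> {0..1}" "g \<in> maps X Y" for z t g
  proof -
    have "S (clamp (2 * t), g) \<in> maps X Y"
      using S that clamp01 by (auto simp: continuous_map_def Pi_iff topspace_compact_open)
    then have 1: "G (z, S (clamp (2 * t), g)) x0 = c (clamp (2 * t), g x0)"
      using Gx0 Sx0 that by simp
    have "y0 = c (clamp (2 * t), g x0)" if "W g \<le> 1/2" "t > 1/2"
      using S1'[OF \<open>g \<in> maps X Y\<close> that(1)] Sx0[OF \<open>g \<in> maps X Y\<close>, of 1] e(2) that(2)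
          by (simp add: clamp_def)
    then show ?thesis using 1 Px0[OF that(1) clamp01] by (auto simp: Gh_def)
  qed
  \<comment> \<open>The factor 1/2 gives \<open>\<tau> \<le> 1/2\<close>, so \<open>h (1, -)\<close>
    sends the edge \<open>u x = \<tau>\<close> to \<open>x0\<close>. There \<open>Gh\<close> has the
    value \<open>c (clamp (2 * t), g x0)\<close>, which is the end of the path \<open>b\<close>, and
    the two formulas fit.\<close>
  define F where "F = (\<lambda>((z, t, g), x). let \<tau> = clamp (2 * t) * (v (g x0) / 2) in
     if \<tau> \<le> u x then Gh (z, t, g) (\<rho> (\<tau>, x)) else b (u x, g x0))"
  have F: "continuous_map (prod_topology ?D X) Y F"
    unfolding F_def case_prod_unfold Let_def
  proof (rule continuous_map_cases_le)
    have pg0: "continuous_map (prod_topology ?D X) Y (\<lambda>a. snd (snd (fst a)) x0)"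
      using continuous_map_compose2[OF continuous_map_eval_at[OF x0] continuous_map_compose2[OF pg
          continuous_map_fst]] .
    show tau: "continuous_map (prod_topology ?D X) euclideanreal
        (\<lambda>a. ?tau a)"
    proof -
      have "continuous_map (prod_topology ?D X) unit_interval (\<lambda>a. clamp (2 * fst (snd (fst a))))"
        by (intro clamp_c continuous_map_real_mult_left continuous_map_compose2[OF pt
            continuous_map_fst])
      moreover have "continuous_map (prod_topology ?D X) euclideanreal (\<lambda>a. v (snd (snd (fst a))
          x0) / 2)"
        using continuous_map_compose2[OF vr pg0] by (intro continuous_map_real_divide) auto
      ultimately show ?thesis
        by (intro continuous_map_real_mult) (use continuous_map_into_fulltopology in blast)+
    qed
    show us: "continuous_map (prod_topology ?D X) euclideanreal (\<lambda>a. u (snd a))"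
      by (rule continuous_map_compose2[OF ur continuous_map_snd])
    have "continuous_map (prod_topology ?D X) Y (\<lambda>a. (\<lambda>(g, x). g x)
        (Gh (?d a),
         \<rho> (?tau a, snd a)))"
      by (intro continuous_map_compose2[OF continuous_map_eval[OF X]] continuous_map_pairedI
           continuous_map_compose2[OF rho] tau continuous_map_snd)
         (simp add: continuous_map_compose2[OF Gh continuous_map_fst])
    then show "continuous_map (subtopology (prod_topology ?D X) {a \<in> topspace (prod_topology ?D X).
         ?tau a \<le> u (snd a)}) Y
       (\<lambda>a. Gh (?d a)
         (\<rho> (?tau a, snd a)))"
      by (simp add: continuous_map_from_subtopology)
    show "continuous_map (subtopology (prod_topology ?D X) {a \<in> topspace (prod_topology ?D X).
         u (snd a) \<le> ?tau a}) Y
       (\<lambda>a. b (u (snd a), snd (snd (fst a)) x0))"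
      by (intro continuous_map_from_subtopology continuous_map_compose2[OF b]
          continuous_map_pairedI us pg0)
  next
    fix a assume a: "a \<in> topspace (prod_topology ?D X)"
      and eq: "?tau a = u (snd a)"
    obtain z t g x where a_eq: "a = ((z, t, g), x)" by (metis prod.collapse)
    have z: "z \<in> {0..1}" and t: "t \<in> {0..1}" and g: "g \<in> maps X Y" and x: "x \<in> topspace X"
      using a by (auto simp: a_eq topspace_compact_open)
    let ?y = "g x0" and ?\<tau> = "clamp (2 * t) * (v (g x0) / 2)"
    have y: "?y \<in> topspace Y" using maps_apply[OF g x0] .
    have ux: "u x = ?\<tau>" using eq by (simp add: a_eq)
    have "Gh (z, t, g) (\<rho> (?\<tau>, x)) = b (u x, ?y)"
    proof (cases "u x = 0")
      case True
      then have "x = x0" using u0 x by blast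
      then have "\<rho> (?\<tau>, x) = x0" using hx0[OF clamp01] by (simp add: \<rho>_def)
      moreover have "clamp (2 * t) = 0 \<or> ?y = y0" using True ux v0 y by auto
      ultimately show ?thesis
        using Ghx0[OF z t g] True c0[OF y] cy0[OF clamp01] by (auto simp: b_def clamp_def)
    next
      case False
      have "u x \<le> 1 * (1/2)"
        unfolding ux using v01[OF y] clamp01[of "2 * t"] by (intro mult_mono) auto
      then have "h (1, x) = x0" using h1[OF x] by simp
      moreover have "clamp (?\<tau> / u x) = 1" using False unfolding ux[symmetric]
          by (simp add: clamp_def)
      ultimately have "\<rho> (?\<tau>, x) = x0" by (simp add: \<rho>_def)
      moreover have "v ?y \<noteq> 0" using False ux by auto
      then have "u x / (v ?y / 2) = clamp (2 * t)" using ux by (simp add: field_simps)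
      ultimately show ?thesis
        using Ghx0[OF z t g] by (simp add: b_def clamp_def)
    qed
    then show "Gh (?d a)
         (\<rho> (?tau a, snd a)) =
        b (u (snd a), snd (snd (fst a)) x0)"
      by (simp add: a_eq)
  qed
  define K where "K = (\<lambda>d. restrict (\<lambda>x. F (d, x)) (topspace X))"
  have id_case: "K (z, t, g) = Gh (z, t, g)"
    if "z \<in> {0..1}" "t \<in> {0..1}" "g \<in> maps X Y" "t = 0 \<or> g x0 = y0" for z t g
  proof (rule maps_eqI)
    have d: "(z, t, g) \<in> topspace ?D" using that by (auto simp: topspace_compact_open)
    show "Gh (z, t, g) \<in> maps X Y"
      using Gh d by (metis continuous_map_image_subset_topspace image_subset_iff
          topspace_compact_open)
    show "K (z, t, g) \<in> maps X Y" unfolding K_def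
      by (intro maps_restrict continuous_map_compose2[OF F] continuous_map_pairedI
          continuous_map_ident) (use d in auto)
    have "y0 \<in> topspace Y" "v y0 = 0" using v0 by blast+
    then have tau: "clamp (2 * t) * (v (g x0) / 2) = 0" using that(4) by (auto simp: clamp_def)
    have c00: "clamp (0 / r) = 0" for r by (simp add: clamp_def)
    then show "K (z, t, g) x = Gh (z, t, g) x" if "x \<in> topspace X" for x
      using u_nn[OF that] h0[OF that] that by (simp only: K_def F_def \<rho>_def prod.case tau Let_def
          c00 if_True restrict_apply)
  qed
  show thesis
  proof
    show "continuous_map ?D ?M K"
      unfolding K_def by (rule continuous_map_curry[OF F])
    show "K (z, 0, g) = G (z, g)" if "z \<in> {0..1}" "g \<in> maps X Y" for z g
      using id_case[of z 0 g] that S0 by (simp add: Gh_def clamp_def)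
    show "K (z, t, e) = P (z, max 0 (2 * t - 1))" if "z \<in> {0..1}" "t \<in> {0..1}" for z t
    proof -
      have "K (z, t, e) = Gh (z, t, e)" using id_case that e by blast
      moreover have "clamp (2 * t - 1) = max 0 (2 * t - 1)" using that(2) by (auto simp: clamp_def)
      ultimately show ?thesis using We P0[OF that(1)] by (simp add: Gh_def Se[OF clamp01])
    qed
    show "K (z, t, g) x0 = g x0" if "z \<in> {0..1}" "t \<in> {0..1}" "g \<in> maps X Y" for z t g
    proof (cases "clamp (2 * t) * (v (g x0) / 2) \<le> u x0")
      case False
      have "u x0 = 0" using u0 by blast
      then show ?thesis using False c0[OF maps_apply[OF that(3) x0]] x0
        by (simp add: K_def F_def b_def Let_def clamp0)
    next
      case True
      have "u x0 = 0" using u0 by blast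
      then have "clamp (2 * t) = 0 \<or> v (g x0) = 0"
        using True v01[OF maps_apply[OF that(3) x0]] clamp01[of "2 * t"]
        by (smt (verit) atLeastAtMost_iff divide_pos_pos mult_pos_pos)
      then have "t = 0 \<or> g x0 = y0"
        using that(2) v0 maps_apply[OF that(3) x0] by (auto simp: clamp_def max_def min_def split:
            if_splits)
      then show ?thesis
        using id_case[OF that] Ghx0[OF that] c0[OF maps_apply[OF that(3) x0]] cy0[OF clamp01]
        by (auto simp: clamp_def)
    qed
  qed
qed


section \<open>From an equivalence over \<open>Y\<close> to a based one\<close>

abbreviation (input) based_over :: "'a \<Rightarrow> ('a \<Rightarrow> 'b) \<Rightarrow> ('a \<Rightarrow> 'b) \<Rightarrow> ('a \<Rightarrow> 'b) \<Rightarrow> bool" where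
  "based_over x0 e \<equiv> \<lambda>g h. (g = e \<longrightarrow> h = e) \<and> h x0 = g x0"

definition over_self_map :: "'a \<Rightarrow> 'a topology \<Rightarrow> 'b topology \<Rightarrow> (('a \<Rightarrow> 'b) \<Rightarrow> ('a \<Rightarrow> 'b)) \<Rightarrow> bool" where
  "over_self_map x0 X Y a \<longleftrightarrow>
     continuous_map (compact_open X Y) (compact_open X Y) a \<and> (\<forall>g\<in>maps X Y. a g x0 = g x0)"

lemma over_self_map_in: "over_self_map x0 X Y a \<Longrightarrow> g \<in> maps X Y \<Longrightarrow> a g \<in> maps X Y"
  by (auto simp: over_self_map_def continuous_map_def Pi_iff topspace_compact_open)

locale evaluation_fibration =
  fixes X :: "'a topology" and Y :: "'b topology" and x0 :: 'a and y0 :: 'b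
  assumes X: "compact_space X" "Hausdorff_space X" and nX: "nondegenerate_basepoint X x0"
    and nY: "nondegenerate_basepoint Y y0"
begin

abbreviation M :: "('a \<Rightarrow> 'b) topology" where "M \<equiv> compact_open X Y"

definition good_point :: "('a \<Rightarrow> 'b) \<Rightarrow> bool" where
  "good_point e \<longleftrightarrow> e \<in> maps X Y \<and> e x0 = y0 \<and> fibrewise_contractible_near X Y e"

text \<open>Relative lifting with the parameter \<open>z\<close> frozen: a path of the image of
  \<open>e\<close> within the fibre over \<open>y0\<close> extends to a homotopy of \<open>a\<close>
  over \<open>Y\<close>. The path starts at time 1/2 only, because the first half is spent
  contracting towards \<open>e\<close>.\<close>

lemma move_point:
  assumes e: "good_point e" and a: "over_self_map x0 X Y a"
    and p: "continuous_map unit_interval M p" "p 0 = a e" "\<And>t. t \<in> {0..1} \<Longrightarrow> p t x0 = y0"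
  obtains N where "continuous_map (prod_topology unit_interval M) M N"
    "\<And>g. g \<in> maps X Y \<Longrightarrow> N (0, g) = a g"
    "\<And>t g. t \<in> {0..1} \<Longrightarrow> g \<in> maps X Y \<Longrightarrow> N (t, g) x0 = g x0"
    "\<And>t. t \<in> {0..1} \<Longrightarrow> N (t, e) = p (max 0 (2 * t - 1))"
proof -
  have ac: "continuous_map M M a" and ax: "\<And>g. g \<in> maps X Y \<Longrightarrow> a g x0 = g x0"
    using a by (auto simp: over_self_map_def)
  have 1: "continuous_map (prod_topology unit_interval M) M (\<lambda>w. a (snd w))"
    by (rule continuous_map_compose2[OF ac continuous_map_snd])
  have 2: "continuous_map (prod_topology unit_interval unit_interval) M (\<lambda>w. p (snd w))"
    by (rule continuous_map_compose2[OF p(1) continuous_map_snd])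
  obtain K where K: "continuous_map (prod_topology unit_interval (prod_topology unit_interval M)) M
      K"
    "\<And>z g. z \<in> {0..1} \<Longrightarrow> g \<in> maps X Y \<Longrightarrow> K (z, 0, g) = a g"
    "\<And>z t g. z \<in> {0..1} \<Longrightarrow> t \<in> {0..1} \<Longrightarrow> g \<in> maps X Y \<Longrightarrow> K (z, t, g) x0 = g x0"
    "\<And>z t. z \<in> {0..1} \<Longrightarrow> t \<in> {0..1} \<Longrightarrow> K (z, t, e) = p (max 0 (2 * t - 1))"
    by (rule evaluation_relative_homotopy_lifting[OF X nX nY _ _ _ 1 _ 2])
       (use e p ax in \<open>auto simp: good_point_def\<close>)
  show thesis
  proof
    show "continuous_map (prod_topology unit_interval M) M (\<lambda>w. K (0, w))"
      by (intro continuous_map_compose2[OF K(1)] continuous_map_pairedI continuous_map_ident) auto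
  qed (use K in auto)
qed

lemma homotopic_selfI:
  assumes "continuous_map (prod_topology unit_interval M) M N"
    and "\<And>g. g \<in> maps X Y \<Longrightarrow> N (0, g) = a g" "\<And>g. g \<in> maps X Y \<Longrightarrow> N (1, g) = b g"
    and "\<And>t g. t \<in> {0..1} \<Longrightarrow> g \<in> maps X Y \<Longrightarrow> R g (N (t, g))"
  shows "homotopic_self R M a b"
  by (subst homotopic_with) (use assms in \<open>auto simp: topspace_compact_open intro!: exI[of _ N]\<close>)

text \<open>
  If \<open>\<kappa>\<close> is the trace at \<open>e\<close> of the homotopy from \<open>id\<close> to \<open>b \<circ> a\<close>, then \<open>b\<close> is deformed to \<open>b'\<close>
  by moving \<open>b e'\<close> back along \<open>\<kappa>\<close>.  The resulting homotopy from \<open>id\<close> to \<open>b' \<circ> a\<close> has a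
  nullhomotopic trace, and a second application of relative lifting makes it based.
\<close>

lemma based_left_inverse:
  assumes e: "good_point e" and e': "good_point e'"
    and a: "over_self_map x0 X Y a" "a e = e'" and b: "over_self_map x0 X Y b"
    and ba: "homotopic_self (same_value x0) M id (b \<circ> a)"
  obtains b' where "over_self_map x0 X Y b'" "b' e' = e" "homotopic_self (same_value x0) M b b'"
    "homotopic_self (based_over x0 e) M (b' \<circ> a) id"
proof -
  have em: "e \<in> maps X Y" "e x0 = y0" and em': "e' \<in> maps X Y" "e' x0 = y0"
    using e e' by (auto simp: good_point_def)
  obtain k where k: "continuous_map (prod_topology unit_interval M) M k"
    "\<And>g. k (0, g) = g" "\<And>g. k (1, g) = b (a g)"
    "\<And>t g. t \<in> {0..1} \<Longrightarrow> g \<in> maps X Y \<Longrightarrow> k (t, g) x0 = g x0"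
    using ba unfolding homotopic_with_def topspace_compact_open by auto
  define \<kappa> where "\<kappa> = (\<lambda>t. k (t, e))"
  have kap: "continuous_map unit_interval M \<kappa>"
    unfolding \<kappa>_def by (intro continuous_map_compose2[OF k(1)] continuous_map_pairedI
        continuous_map_ident)
      (use em in \<open>auto simp: topspace_compact_open\<close>)
  have kap0: "\<kappa> 0 = e" "\<kappa> 1 = b e'" by (simp_all add: \<kappa>_def k a(2))
  have kapx: "\<kappa> t x0 = y0" if "t \<in> {0..1}" for t using k(4)[OF that em(1)] em(2)
      by (simp add: \<kappa>_def)
  have ac: "continuous_map M M a" and ax: "\<And>g. g \<in> maps X Y \<Longrightarrow> a g x0 = g x0"
    using a by (auto simp: over_self_map_def)
  note am = over_self_map_in[OF a(1)]
  have rev: "continuous_map unit_interval M (\<lambda>t. \<kappa> (1 - t))"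
    by (rule continuous_map_compose2[OF kap])
       (auto simp: continuous_map_in_subtopology intro!: continuous_map_diff
           continuous_map_subtopology_ident continuous_intros)
  obtain N where N: "continuous_map (prod_topology unit_interval M) M N"
    "\<And>g. g \<in> maps X Y \<Longrightarrow> N (0, g) = b g"
    "\<And>t g. t \<in> {0..1} \<Longrightarrow> g \<in> maps X Y \<Longrightarrow> N (t, g) x0 = g x0"
    "\<And>t. t \<in> {0..1} \<Longrightarrow> N (t, e') = \<kappa> (1 - max 0 (2 * t - 1))"
    by (rule move_point[OF e' b rev]) (auto simp: kap0 kapx)
  define b' where "b' = (\<lambda>g. N (1, g))"
  have b'o: "over_self_map x0 X Y b'"
    unfolding over_self_map_def b'_def
    by (auto simp: N intro!: continuous_map_compose2[OF N(1)] continuous_map_pairedI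
        continuous_map_ident)
  have b'e: "b' e' = e" by (simp add: b'_def N kap0)
  have bb': "homotopic_self (same_value x0) M b b'"
    by (rule homotopic_selfI[OF N(1)]) (auto simp: N b'_def)
  define J where "J = (\<lambda>w. if fst w \<le> 1/2 then k (max 0 (min 1 (2 * fst w)), snd w)
     else N (max 0 (min 1 (2 * fst w - 1)), a (snd w)))"
  have fr: "continuous_map (prod_topology unit_interval M) euclideanreal fst"
    using continuous_map_into_fulltopology[OF continuous_map_fst] .
  have J: "continuous_map (prod_topology unit_interval M) M J"
    unfolding J_def
  proof (rule continuous_map_cases_le[OF fr])
    show "continuous_map (subtopology (prod_topology unit_interval M) {x \<in> topspace (prod_topology
        unit_interval M). fst x \<le> 1/2}) M
       (\<lambda>w. k (max 0 (min 1 (2 * fst w)), snd w))"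
      by (intro continuous_map_from_subtopology continuous_map_compose2[OF k(1)]
          continuous_map_pairedI
          continuous_map_clamp continuous_map_real_mult_left fr continuous_map_snd)
    show "continuous_map (subtopology (prod_topology unit_interval M) {x \<in> topspace (prod_topology
        unit_interval M). 1/2 \<le> fst x}) M
       (\<lambda>w. N (max 0 (min 1 (2 * fst w - 1)), a (snd w)))"
      by (intro continuous_map_from_subtopology continuous_map_compose2[OF N(1)]
          continuous_map_pairedI
          continuous_map_clamp continuous_map_diff continuous_map_real_mult_left fr
              continuous_map_compose2[OF ac continuous_map_snd]) auto
  qed (auto simp: k N am topspace_compact_open)
  have J0: "J (0, g) = g" for g by (simp add: J_def k)
  have J1: "J (1, g) = b' (a g)" for g by (simp add: J_def b'_def)
  have Jx: "J (z, g) x0 = g x0" if "z \<in> {0..1}" "g \<in> maps X Y" for z g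
    using that by (auto simp: J_def k(4) N(3) am ax)
  \<comment> \<open>The trace of \<open>J\<close> at \<open>e\<close> runs out along
    \<open>\<kappa>\<close> until time 1/2, rests until 3/4 because \<open>N\<close> starts with a
    delay, and returns along \<open>\<kappa>\<close>.\<close>
  define s :: "real \<Rightarrow> real" where "s z = min (min 1 (2 * z)) (4 - 4 * z)" for z
  have Je: "J (z, e) = \<kappa> (s z)" if "z \<in> {0..1}" for z
  proof (cases "z \<le> 1/2")
    case True
    then have "s z = 2 * z" "max 0 (min 1 (2 * z)) = 2 * z" using that by (auto simp: s_def)
    then show ?thesis using True by (simp add: J_def \<kappa>_def)
  next
    case False
    then have "max 0 (min 1 (2 * z - 1)) = 2 * z - 1" using that by auto
    then have "J (z, e) = \<kappa> (1 - max 0 (2 * (2 * z - 1) - 1))"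
      using False that N(4)[of "2 * z - 1"] by (simp add: J_def a(2))
    moreover have "1 - max 0 (2 * (2 * z - 1) - 1) = s z" using False
        by (simp add: s_def max_def min_def)
    ultimately show ?thesis by simp
  qed
  \<comment> \<open>The trace is contracted along itself by shrinking its parameter. As
    \<open>s\<close> vanishes at 0 and 1, the sides \<open>z = 0\<close>, \<open>z = 1\<close> and
    \<open>t = 1\<close> of the square are constant at \<open>e\<close>.\<close>
  define P where "P = (\<lambda>w. \<kappa> (max 0 (min 1 ((1 - snd w) * s (fst w)))))"
  have P: "continuous_map (prod_topology unit_interval unit_interval) M P"
  proof -
    have f1: "continuous_map (prod_topology unit_interval unit_interval) euclideanreal fst"
      and f2: "continuous_map (prod_topology unit_interval unit_interval) euclideanreal snd"
      using continuous_map_into_fulltopology[OF continuous_map_fst]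
          continuous_map_into_fulltopology[OF continuous_map_snd]
      by blast+
    show ?thesis unfolding P_def s_def
      by (intro continuous_map_compose2[OF kap] continuous_map_clamp continuous_map_real_mult
          continuous_map_diff
          continuous_map_real_min continuous_map_real_mult_left f1 f2) auto
  qed
  have s01: "max 0 (min 1 (s z)) = s z" if "z \<in> {0..1}" for z using that by (auto simp: s_def)
  obtain K where K: "continuous_map (prod_topology unit_interval (prod_topology unit_interval M)) M
      K"
    "\<And>z g. z \<in> {0..1} \<Longrightarrow> g \<in> maps X Y \<Longrightarrow> K (z, 0, g) = J (z, g)"
    "\<And>z t g. z \<in> {0..1} \<Longrightarrow> t \<in> {0..1} \<Longrightarrow> g \<in> maps X Y \<Longrightarrow> K (z, t, g) x0 = g x0"
    "\<And>z t. z \<in> {0..1} \<Longrightarrow> t \<in> {0..1} \<Longrightarrow> K (z, t, e) = P (z, max 0 (2 * t - 1))"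
  proof (rule evaluation_relative_homotopy_lifting[OF X nX nY em _ J _ P])
    show "fibrewise_contractible_near X Y e" using e by (simp add: good_point_def)
    show "P (z, 0) = J (z, e)" if "z \<in> {0..1}" for z
      using s01[OF that] Je[OF that] by (simp add: P_def)
    show "P (z, t) x0 = y0" for z t by (simp add: P_def kapx)
  qed (use Jx in blast)+
  have Kc: "continuous_map (prod_topology unit_interval M) M (\<lambda>w. K (z, w))" if "z \<in> {0..1}" for z
    by (intro continuous_map_compose2[OF K(1)] continuous_map_pairedI
        continuous_map_ident) (use that in auto)
  \<comment> \<open>Instead of following \<open>J\<close> along the side \<open>t = 0\<close>, the
    based homotopy goes round the other three sides of the square.\<close>
  have "continuous_map (prod_topology unit_interval M) M (\<lambda>w. K (fst w, 1, snd w))"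
    by (intro continuous_map_compose2[OF K(1)] continuous_map_pairedI continuous_map_fst
        continuous_map_snd) auto
  then have mid: "homotopic_self (based_over x0 e) M (\<lambda>g. K (0, 1, g)) (\<lambda>g. K (1, 1, g))"
    by (rule homotopic_selfI) (auto simp: K P_def kap0)
  have start: "homotopic_self (based_over x0 e) M id (\<lambda>g. K (0, 1, g))"
    by (rule homotopic_selfI[OF Kc[of 0]]) (auto simp: K J0 P_def s_def kap0)
  have stop: "homotopic_self (based_over x0 e) M (b' \<circ> a) (\<lambda>g. K (1, 1, g))"
    by (rule homotopic_selfI[OF Kc[of 1]]) (auto simp: K J1 P_def s_def kap0)
  have "homotopic_self (based_over x0 e) M (b' \<circ> a) id"
    by (rule homotopic_with_trans[OF stop
        homotopic_with_symD[OF homotopic_with_trans[OF start mid]]])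
  then show thesis using that[OF b'o b'e bb'] by blast
qed

lemma over_self_map_comp_homotopic:
  assumes ab: "homotopic_self (same_value x0) M a b" and h: "over_self_map x0 X Y h"
  shows "homotopic_self (same_value x0) M (h \<circ> a) (h \<circ> b)"
    and "homotopic_self (same_value x0) M (a \<circ> h) (b \<circ> h)"
proof -
  have hc: "continuous_map M M h" and hx: "\<And>g. g \<in> maps X Y \<Longrightarrow> h g x0 = g x0"
    using h by (auto simp: over_self_map_def)
  obtain k where k: "continuous_map (prod_topology unit_interval M) M k"
    "\<And>g. k (0, g) = a g" "\<And>g. k (1, g) = b g"
    "\<And>t g. t \<in> {0..1} \<Longrightarrow> g \<in> maps X Y \<Longrightarrow> k (t, g) x0 = g x0"
    using ab unfolding homotopic_with_def topspace_compact_open by auto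
  have km: "k (t, g) \<in> maps X Y" if "t \<in> {0..1}" "g \<in> maps X Y" for t g
    using k(1) that by (auto simp: continuous_map_def Pi_iff topspace_compact_open)
  show "homotopic_self (same_value x0) M (h \<circ> a) (h \<circ> b)"
    by (rule homotopic_selfI[OF continuous_map_compose2[OF hc k(1)]]) (auto simp: k hx km)
  have "continuous_map (prod_topology unit_interval M) M (\<lambda>w. k (fst w, h (snd w)))"
    by (intro continuous_map_compose2[OF k(1)] continuous_map_pairedI continuous_map_fst
        continuous_map_compose2[OF hc continuous_map_snd])
  then show "homotopic_self (same_value x0) M (a \<circ> h) (b \<circ> h)"
    by (rule homotopic_selfI) (auto simp: k hx over_self_map_in[OF h])
qed

text \<open>Moving \<open>h0\<close> along \<open>p\<close> gives a based map \<open>h\<close>. Now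
  \<open>k\<close> is a based left inverse of \<open>h\<close>, and \<open>h'\<close> one of
  \<open>k\<close>. Both \<open>h \<circ> k\<close> and \<open>h' \<circ> k\<close> are homotopic to
  \<open>h' \<circ> k \<circ> h \<circ> k\<close>, as for one-sided inverses in a monoid, so
  \<open>k\<close> is also a right inverse of \<open>h\<close>.\<close>

lemma based_over_equivalence:
  assumes e1: "good_point e1" and e2: "good_point e2"
    and h0: "over_self_map x0 X Y h0" and k0: "over_self_map x0 X Y k0"
    and kh: "homotopic_self (same_value x0) M (k0 \<circ> h0) id"
    and hk: "homotopic_self (same_value x0) M (h0 \<circ> k0) id"
    and p: "continuous_map unit_interval M p" "p 0 = h0 e1" "p 1 = e2" "\<And>t. t \<in> {0..1} \<Longrightarrow>
        p t x0 = y0"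
  obtains h k where "over_self_map x0 X Y h" "over_self_map x0 X Y k" "h e1 = e2" "k e2 = e1"
    "homotopic_self (based_over x0 e1) M (k \<circ> h) id"
    "homotopic_self (based_over x0 e2) M (h \<circ> k) id"
proof -
  obtain N where N: "continuous_map (prod_topology unit_interval M) M N"
    "\<And>g. g \<in> maps X Y \<Longrightarrow> N (0, g) = h0 g"
    "\<And>t g. t \<in> {0..1} \<Longrightarrow> g \<in> maps X Y \<Longrightarrow> N (t, g) x0 = g x0"
    "\<And>t. t \<in> {0..1} \<Longrightarrow> N (t, e1) = p (max 0 (2 * t - 1))"
    by (rule move_point[OF e1 h0 p(1,2,4)]) (assumption | (rule that; assumption))+
  define h where "h = (\<lambda>g. N (1, g))"
  have h: "over_self_map x0 X Y h"
    unfolding over_self_map_def h_def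
    by (auto simp: N intro!: continuous_map_compose2[OF N(1)] continuous_map_pairedI
        continuous_map_ident)
  have he: "h e1 = e2" by (simp add: h_def N p)
  have h0h: "homotopic_self (same_value x0) M h0 h"
    by (rule homotopic_selfI[OF N(1)]) (auto simp: N h_def)
  have "homotopic_self (same_value x0) M id (k0 \<circ> h)"
    by (rule homotopic_with_trans[OF homotopic_with_symD[OF kh] over_self_map_comp_homotopic(1)[OF
        h0h k0]])
  then obtain k where k: "over_self_map x0 X Y k" "k e2 = e1" "homotopic_self (same_value x0) M k0
      k"
    and kh': "homotopic_self (based_over x0 e1) M (k \<circ> h) id"
    by (rule based_left_inverse[OF e1 e2 h he k0])
  have "homotopic_self (same_value x0) M id (h0 \<circ> k)"
    by (rule homotopic_with_trans[OF homotopic_with_symD[OF hk] over_self_map_comp_homotopic(1)[OF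
        k(3) h0]])
  then obtain h' where h': "over_self_map x0 X Y h'" "h' e1 = e2"
    and hk': "homotopic_self (based_over x0 e2) M (h' \<circ> k) id"
    by (rule based_left_inverse[OF e2 e1 k(1,2) h0])
  have hx: "\<And>g. g \<in> maps X Y \<Longrightarrow> h g x0 = g x0" and hc: "continuous_map M M h"
    and kx: "\<And>g. g \<in> maps X Y \<Longrightarrow> k g x0 = g x0" and kc: "continuous_map M M k"
    and h'x: "\<And>g. g \<in> maps X Y \<Longrightarrow> h' g x0 = g x0" and h'c: "continuous_map M M h'"
    using h k h' by (auto simp: over_self_map_def)
  note hm = over_self_map_in[OF h] and km = over_self_map_in[OF k(1)]
  obtain H where H: "continuous_map (prod_topology unit_interval M) M H"
    "\<And>g. H (0, g) = h' (k g)" "\<And>g. H (1, g) = g"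
    "\<And>t g. t \<in> {0..1} \<Longrightarrow> g \<in> maps X Y \<Longrightarrow> H (t, g) x0 = g x0"
    "\<And>t. t \<in> {0..1} \<Longrightarrow> H (t, e2) = e2"
    using hk' e2 unfolding homotopic_with_def topspace_compact_open by (auto simp: good_point_def)
  obtain L where L: "continuous_map (prod_topology unit_interval M) M L"
    "\<And>g. L (0, g) = k (h g)" "\<And>g. L (1, g) = g"
    "\<And>t g. t \<in> {0..1} \<Longrightarrow> g \<in> maps X Y \<Longrightarrow> L (t, g) x0 = g x0"
    "\<And>t. t \<in> {0..1} \<Longrightarrow> L (t, e1) = e1"
    using kh' e1 unfolding homotopic_with_def topspace_compact_open by (auto simp: good_point_def)
  have Lm: "L (t, g) \<in> maps X Y" if "t \<in> {0..1}" "g \<in> maps X Y" for t g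
    using L(1) that by (auto simp: continuous_map_def Pi_iff topspace_compact_open)
  have "continuous_map (prod_topology unit_interval M) M (\<lambda>w. H (fst w, h (k (snd w))))"
    by (intro continuous_map_compose2[OF H(1)] continuous_map_pairedI continuous_map_fst
        continuous_map_compose2[OF hc] continuous_map_compose2[OF kc] continuous_map_snd)
  then have 1: "homotopic_self (based_over x0 e2) M (\<lambda>g. h' (k (h (k g)))) (h \<circ> k)"
    by (rule homotopic_selfI) (auto simp: H hx kx hm km k(2) he)
  have "continuous_map (prod_topology unit_interval M) M (\<lambda>w. h' (L (fst w, k (snd w))))"
    by (intro continuous_map_compose2[OF h'c] continuous_map_compose2[OF L(1)]
        continuous_map_pairedI
        continuous_map_fst continuous_map_compose2[OF kc] continuous_map_snd)
  then have 2: "homotopic_self (based_over x0 e2) M (\<lambda>g. h' (k (h (k g)))) (h' \<circ> k)"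
    by (rule homotopic_selfI) (auto simp: L Lm h'x kx hm km k(2) he h'(2))
  have "homotopic_self (based_over x0 e2) M (h \<circ> k) id"
    by (rule homotopic_with_trans[OF homotopic_with_trans[OF homotopic_with_symD[OF 1] 2] hk'])
  then show thesis using that[OF h k(1) he k(2) kh'] by blast
qed

end

section \<open>Local equiconnectedness and cell attachments\<close>

definition enorm :: "nat \<Rightarrow> (nat \<Rightarrow> real) \<Rightarrow> real" where
  "enorm n q = L2_set q {..<n}"

lemma enorm_nonneg: "0 \<le> enorm n q"
  by (simp add: enorm_def)

lemma enorm_scale: "enorm n (\<lambda>i. c * q i) = \<bar>c\<bar> * enorm n q"
  by (simp add: enorm_def L2_set_def power_mult_distrib real_sqrt_mult flip: sum_distrib_left)

lemma enorm_divide: "enorm n (\<lambda>i. q i / c) = enorm n q / \<bar>c\<bar>"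
  using enorm_scale[of n "1 / c" q] by simp

lemma enorm_triangle: "enorm n (\<lambda>i. p i + q i) \<le> enorm n p + enorm n q"
  unfolding enorm_def by (rule L2_set_triangle_ineq)

lemma enorm_zero: "enorm n (\<lambda>i. 0) = 0"
  by (simp add: enorm_def L2_set_def)

lemma enorm_eq_0: "q \<in> topspace (Euclidean_space n) \<Longrightarrow> enorm n q = 0 \<Longrightarrow> q = (\<lambda>i. 0)"
proof
  fix i assume q: "q \<in> topspace (Euclidean_space n)" "enorm n q = 0"
  show "q i = 0"
  proof (cases "i < n")
    case True
    then show ?thesis using q(2) by (simp add: enorm_def L2_set_eq_0_iff)
  qed (use q(1) in \<open>simp add: topspace_Euclidean_space\<close>)
qed

lemma enorm_convex:
  assumes "0 \<le> t" "t \<le> 1" "enorm n p \<le> R" "enorm n q \<le> R"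
  shows "enorm n (\<lambda>i. (1 - t) * p i + t * q i) \<le> R"
proof -
  have "enorm n (\<lambda>i. (1 - t) * p i + t * q i) \<le> (1 - t) * enorm n p + t * enorm n q"
    using enorm_triangle[of n "\<lambda>i. (1 - t) * p i" "\<lambda>i. t * q i"] assms by (simp add: enorm_scale)
  also have "\<dots> \<le> (1 - t) * R + t * R"
    using assms by (intro add_mono mult_left_mono) auto
  finally show ?thesis by (simp add: algebra_simps)
qed

lemma disc_enorm: "disc n = {q \<in> topspace (Euclidean_space n). enorm n q \<le> 1}"
  by (auto simp: disc_def enorm_def L2_set_def)

lemma open_disc_enorm: "open_disc n = {q \<in> topspace (Euclidean_space n). enorm n q < 1}"
  by (auto simp: open_disc_def enorm_def L2_set_def)

lemma continuous_map_into_subtopologyI: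
  "continuous_map X Y f \<Longrightarrow> (\<And>x. x \<in> topspace X \<Longrightarrow> f x \<in> S) \<Longrightarrow> continuous_map X (subtopology Y S) f"
  by (simp add: continuous_map_in_subtopology Pi_iff)

lemma continuous_map_into_Euclidean_space:
  "continuous_map W (Euclidean_space n) f \<longleftrightarrow>
     (\<forall>i<n. continuous_map W euclideanreal (\<lambda>w. f w i)) \<and> (\<forall>w\<in>topspace W. \<forall>i\<ge>n. f w i = 0)"
proof -
  have "continuous_map W euclideanreal (\<lambda>w. f w i)"
    if "\<forall>w\<in>topspace W. \<forall>i\<ge>n. f w i = 0" "i \<ge> n" for i
    by (rule continuous_map_eq[of _ _ "\<lambda>w. 0"]) (use that in auto)
  then show ?thesis
    unfolding Euclidean_space_def continuous_map_in_subtopology continuous_map_componentwise_UNIV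
    by (auto simp: Pi_iff) (metis not_less)
qed

lemma continuous_map_Euclidean_space_scale:
  assumes "continuous_map W euclideanreal c" "continuous_map W (Euclidean_space n) f"
  shows "continuous_map W (Euclidean_space n) (\<lambda>w i. c w * f w i)"
  using assms unfolding continuous_map_into_Euclidean_space
  by (auto intro: continuous_map_real_mult)

lemma continuous_map_enorm:
  assumes "continuous_map W (Euclidean_space n) f"
  shows "continuous_map W euclideanreal (\<lambda>w. enorm n (f w))"
  using assms unfolding continuous_map_into_Euclidean_space enorm_def L2_set_def
  by (intro continuous_map_sqrt continuous_map_sum continuous_map_real_pow) auto

lemma Hausdorff_Euclidean_space: "Hausdorff_space (Euclidean_space n)"
  unfolding Euclidean_space_def
  by (intro Hausdorff_space_subtopology) (simp add: Hausdorff_space_product_topology)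

lemma closedin_enorm_le: "closedin (Euclidean_space n) {q \<in> topspace (Euclidean_space n). enorm n q
    \<le> R}"
  using closedin_continuous_map_preimage[OF continuous_map_enorm[OF
      continuous_map_ident], of "{..R}" n] by simp

lemma compactin_enorm_le: "compactin (Euclidean_space n) {q \<in> topspace (Euclidean_space n). enorm n
    q \<le> R}"
proof -
  let ?K = "PiE UNIV (\<lambda>i. if i < n then {-R..R} else {0::real})"
  have "compactin (powertop_real UNIV) ?K"
    by (subst compactin_PiE) auto
  moreover have KE: "?K \<subseteq> topspace (Euclidean_space n)"
    by (auto simp: topspace_Euclidean_space PiE_iff) (metis not_less singletonD)
  ultimately have K: "compactin (Euclidean_space n) ?K"
    unfolding Euclidean_space_def compactin_subtopology by simp
  have "\<bar>q i\<bar> \<le> R" if "i < n" "enorm n q \<le> R" for q :: "nat \<Rightarrow> real" and i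
    using member_le_L2_set[of "{..<n}" i "\<lambda>i. \<bar>q i\<bar>"] that by (simp add: enorm_def L2_set_def)
  then have "{q \<in> topspace (Euclidean_space n). enorm n q \<le> R} \<subseteq> ?K"
    by (auto simp: PiE_iff topspace_Euclidean_space abs_le_iff) (smt (verit))
  then show ?thesis using closed_compactin[OF K _ closedin_enorm_le] by blast
qed

text \<open>
  Local equiconnectedness.  The diagonal is the exact zero set of \<open>w\<close>: points with small \<open>w\<close> are
  close to each other, on which the continuity of \<open>polar_retract\<close> below at \<open>\<delta> = 0\<close> depends.
\<close>

definition lec_data :: "'a topology \<Rightarrow> (real \<times> 'a \<times> 'a \<Rightarrow> 'a) \<Rightarrow> ('a \<times> 'a \<Rightarrow> real) \<Rightarrow> bool" where
  "lec_data Z c w \<longleftrightarrow>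
     continuous_map (prod_topology unit_interval (prod_topology Z Z)) Z c \<and>
     continuous_map (prod_topology Z Z) euclideanreal w \<and>
     (\<forall>a\<in>topspace Z. \<forall>y\<in>topspace Z. c (0, a, y) = y) \<and>
     (\<forall>a\<in>topspace Z. \<forall>t\<in>{0..1}. c (t, a, a) = a) \<and>
     (\<forall>a\<in>topspace Z. \<forall>y\<in>topspace Z. 0 \<le> w (a, y)) \<and>
     (\<forall>a\<in>topspace Z. \<forall>y\<in>topspace Z. w (a, y) = 0 \<longleftrightarrow> a = y) \<and>
     (\<forall>a\<in>topspace Z. \<forall>y\<in>topspace Z. w (a, y) < 1 \<longrightarrow> c (1, a, y) = a)"

lemma lec_dataD:
  assumes "lec_data Z c w"
  shows "continuous_map (prod_topology unit_interval (prod_topology Z Z)) Z c"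
    and "continuous_map (prod_topology Z Z) euclideanreal w"
    and "\<And>a y. a \<in> topspace Z \<Longrightarrow> y \<in> topspace Z \<Longrightarrow> c (0, a, y) = y"
    and "\<And>a t. a \<in> topspace Z \<Longrightarrow> t \<in> {0..1} \<Longrightarrow> c (t, a, a) = a"
    and "\<And>a y. a \<in> topspace Z \<Longrightarrow> y \<in> topspace Z \<Longrightarrow> 0 \<le> w (a, y)"
    and "\<And>a y. a \<in> topspace Z \<Longrightarrow> y \<in> topspace Z \<Longrightarrow> w (a, y) = 0 \<longleftrightarrow> a = y"
    and "\<And>a y. a \<in> topspace Z \<Longrightarrow> y \<in> topspace Z \<Longrightarrow> w (a, y) < 1 \<Longrightarrow> c (1, a, y) = a"
  using assms by (simp_all add: lec_data_def)

definition lec :: "'a topology \<Rightarrow> bool" where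
  "lec Z \<longleftrightarrow> (\<exists>c w. lec_data Z c w)"

section \<open>One attached cell: radial coordinates near its boundary\<close>

locale cell_attachment =
  fixes B :: "'b topology" and Z :: "'b set" and n :: nat and \<phi> :: "(nat \<Rightarrow> real) \<Rightarrow> 'b"
  assumes B: "compact_space B" "Hausdorff_space B" and Z: "closedin B Z"
    and phi: "continuous_map (subtopology (Euclidean_space n) (disc n)) B \<phi>"
    and bd: "\<And>q. q \<in> topspace (Euclidean_space n) \<Longrightarrow> enorm n q = 1 \<Longrightarrow> \<phi> q \<in> Z"
    and int: "\<And>q. q \<in> open_disc n \<Longrightarrow> \<phi> q \<notin> Z"
    and inj: "inj_on \<phi> (open_disc n)"
    and cover: "topspace B \<subseteq> Z \<union> \<phi> ` disc n"
begin

abbreviation E where "E \<equiv> Euclidean_space n"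
abbreviation nrm where "nrm \<equiv> enorm n"

definition pre :: "'b \<Rightarrow> nat \<Rightarrow> real" where "pre a = inv_into (open_disc n) \<phi> a"
definition depth :: "'b \<Rightarrow> real" where "depth a = (if a \<in> Z then 0 else 1 - nrm (pre a))"
text \<open>Radial projection to the boundary of the cell. At the centre, division by zero yields
  \<open>\<phi>\<close> of the origin; its uses are confined to the collar, where the norm is at
  least 1/2.\<close>

definition proj :: "'b \<Rightarrow> 'b" where
  "proj a = (if a \<in> Z then a else \<phi> (\<lambda>i. 1 / nrm (pre a) * pre a i))"
text \<open>On the collar this is the vector of length \<open>depth a\<close> in the direction of
  \<open>pre a\<close>. Unlike the direction it extends continuously by 0 over \<open>Z\<close>, so
  with \<open>proj\<close> it serves as polar coordinates of the collar.\<close>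

definition inward :: "'b \<Rightarrow> nat \<Rightarrow> real" where
  "inward a = (if a \<in> Z then (\<lambda>i. 0) else (\<lambda>i. (1 / nrm (pre a) - 1) * pre a i))"
text \<open>The factor \<open>depth a\<close> makes the cell coordinates extend by 0 over
  \<open>Z\<close>. Off \<open>Z\<close> they are recovered by dividing by the depth, so
  \<open>core\<close> and \<open>depth\<close> separate the points of the cell.\<close>

definition core :: "'b \<Rightarrow> nat \<Rightarrow> real" where
  "core a = (if a \<in> Z then (\<lambda>i. 0) else (\<lambda>i. depth a * pre a i))"

lemma ZB: "Z \<subseteq> topspace B" using Z closedin_subset by blast

lemma pre_phi: "q \<in> open_disc n \<Longrightarrow> pre (\<phi> q) = q"
  unfolding pre_def using inj by (rule inv_into_f_f)

lemma disc_cases: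
  assumes "q \<in> disc n"
  obtains "q \<in> topspace E" "nrm q = 1" "\<phi> q \<in> Z" | "q \<in> open_disc n" "\<phi> q \<notin> Z" "nrm q < 1"
  using assms bd int by (fastforce simp: disc_enorm open_disc_enorm)

lemma phi_in: "q \<in> disc n \<Longrightarrow> \<phi> q \<in> topspace B"
  using phi by (auto simp: continuous_map_def Pi_iff disc_enorm)

lemma point_cases:
  assumes "a \<in> topspace B"
  obtains "a \<in> Z" | q where "q \<in> open_disc n" "a = \<phi> q" "a \<notin> Z" "pre a = q"
proof (cases "a \<in> Z")
  case False
  then obtain q where q: "q \<in> disc n" "a = \<phi> q" using assms cover by blast
  have "q \<in> open_disc n" by (rule disc_cases[OF q(1)]) (use q(2) False in auto)
  then show thesis using that(2)[OF _ q(2) False] pre_phi[of q] q(2) by simp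
qed (use that in blast)

lemma depth_phi: "q \<in> disc n \<Longrightarrow> depth (\<phi> q) = 1 - nrm q"
  by (erule disc_cases) (auto simp: depth_def pre_phi)

lemma depth_pos: "a \<in> topspace B \<Longrightarrow> a \<notin> Z \<Longrightarrow> 0 < depth a"
  by (erule point_cases) (auto simp: depth_def open_disc_enorm)

lemma proj_phi: "q \<in> disc n \<Longrightarrow> proj (\<phi> q) = \<phi> (\<lambda>i. 1 / nrm q * q i)"
  by (erule disc_cases) (auto simp: proj_def pre_phi)

lemma inward_phi: "q \<in> disc n \<Longrightarrow> inward (\<phi> q) = (\<lambda>i. (1 / nrm q - 1) * q i)"
  by (erule disc_cases) (auto simp: inward_def pre_phi)

lemma core_phi: "q \<in> disc n \<Longrightarrow> core (\<phi> q) = (\<lambda>i. (1 - nrm q) * q i)"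
  by (erule disc_cases) (auto simp: core_def depth_def pre_phi)

lemma disc_E: "q \<in> disc n \<Longrightarrow> q \<in> topspace E" by (simp add: disc_enorm)

lemma scale_E: "q \<in> topspace E \<Longrightarrow> (\<lambda>i. c * q i) \<in> topspace E"
  by (simp add: topspace_Euclidean_space)

lemma unit_in: "q \<in> topspace E \<Longrightarrow> nrm q \<noteq> 0 \<Longrightarrow> \<phi> (\<lambda>i. 1 / nrm q * q i) \<in> Z"
  by (rule bd[OF scale_E]) (use enorm_nonneg[of n q] in \<open>auto simp: enorm_divide\<close>)

text \<open>Continuity is tested in two charts, on \<open>Z\<close> and in disc coordinates. The
  part of the disc lying over a closed \<open>S\<close> is compact, so the gluing lemma
  applies.\<close>

lemma continuous_map_from_part:
  assumes S: "closedin B S"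
    and F1: "continuous_map (subtopology B (Z \<inter> S)) W F"
    and F2: "continuous_map (subtopology E {q \<in> disc n. \<phi> q \<in> S}) W (\<lambda>q. F (\<phi> q))"
  shows "continuous_map (subtopology B S) W F"
proof (rule continuous_map_from_closed_Un_image[where D = "subtopology E {q \<in> disc n. \<phi> q \<in> S}"
    and \<phi> = \<phi>])
  let ?D = "subtopology E {q \<in> disc n. \<phi> q \<in> S}"
  show "closedin (subtopology B S) (Z \<inter> S)"
    using Z by (simp add: closedin_subtopology_Int_closed Int_commute)
  have sub: "subtopology (subtopology E (disc n)) {q \<in> disc n. \<phi> q \<in> S} = ?D"
    by (simp add: subtopology_subtopology Int_absorb1 subset_iff)
  have "continuous_map ?D B \<phi>"
    using continuous_map_from_subtopology[OF phi, of "{q \<in> disc n. \<phi> q \<in> S}"] unfolding sub .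
  then show "continuous_map ?D (subtopology B S) \<phi>"
    by (auto simp: continuous_map_in_subtopology)
  have dE: "topspace (subtopology E (disc n)) = disc n" by (auto simp: disc_enorm)
  have "closedin (subtopology E (disc n)) {q \<in> disc n. \<phi> q \<in> S}"
    using closedin_continuous_map_preimage[OF phi S] unfolding dE .
  moreover have "compact_space (subtopology E (disc n))"
    using compactin_enorm_le[of n 1] by (simp add: disc_enorm compact_space_subtopology)
  ultimately have "compactin (subtopology E (disc n)) {q \<in> disc n. \<phi> q \<in> S}"
    using closedin_compact_space by blast
  then have "compactin E {q \<in> disc n. \<phi> q \<in> S}" by (simp add: compactin_subtopology)
  then show "compact_space ?D" by (rule compact_space_subtopology)
  show "Hausdorff_space (subtopology B S)" using B by (simp add: Hausdorff_space_subtopology)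
  show "topspace (subtopology B S) \<subseteq> Z \<inter> S \<union> \<phi> ` topspace ?D"
    using cover disc_E by auto
  show "continuous_map (subtopology (subtopology B S) (Z \<inter> S)) W F"
    using F1 by (simp add: subtopology_subtopology Int_absorb1 Int_commute inf.absorb2)
qed (rule F2)

lemma disc_part_ident: "continuous_map (subtopology E S) E (\<lambda>q. q)"
  by (rule continuous_map_subtopology_ident)

lemma disc_part_nrm: "continuous_map (subtopology E S) euclideanreal nrm"
  by (rule continuous_map_enorm[OF disc_part_ident])

lemma depth_continuous: "continuous_map B euclideanreal depth"
proof -
  have "continuous_map (subtopology B (topspace B)) euclideanreal depth"
  proof (rule continuous_map_from_part)
    show "continuous_map (subtopology B (Z \<inter> topspace B)) euclideanreal depth"
      by (rule continuous_map_eq[of _ _ "\<lambda>_. 0"]) (auto simp: depth_def)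
    show "continuous_map (subtopology E {q \<in> disc n. \<phi> q \<in> topspace B}) euclideanreal (\<lambda>q. depth (\<phi>
        q))"
      by (rule continuous_map_eq[of _ _ "\<lambda>q. 1 - nrm q"])
         (auto simp: depth_phi intro!: continuous_map_diff disc_part_nrm)
  qed auto
  then show ?thesis by simp
qed

definition collar :: "'b set" where "collar = {a \<in> topspace B. depth a \<le> 1/2}"

lemma collar_closed: "closedin B collar"
  unfolding collar_def using closedin_continuous_map_preimage[OF depth_continuous, of "{..1/2}"]
      by simp

lemma collar_phi: "q \<in> disc n \<Longrightarrow> \<phi> q \<in> collar \<longleftrightarrow> 1/2 \<le> nrm q"
  using phi_in by (auto simp: collar_def depth_phi)

lemma inv_nrm_continuous:
  "continuous_map (subtopology E {q \<in> disc n. \<phi> q \<in> collar}) euclideanreal (\<lambda>q. 1 / nrm q)"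
  by (rule continuous_map_real_divide[OF _ disc_part_nrm]) (auto simp: collar_phi)

lemma proj_continuous: "continuous_map (subtopology B collar) (subtopology B Z) proj"
proof (rule continuous_map_from_part[OF collar_closed])
  show "continuous_map (subtopology B (Z \<inter> collar)) (subtopology B Z) proj"
    by (rule continuous_map_eq[of _ _ "\<lambda>a. a"])
       (auto simp: proj_def continuous_map_in_subtopology continuous_map_subtopology_ident)
  let ?D = "subtopology E {q \<in> disc n. \<phi> q \<in> collar}"
  have 1: "continuous_map ?D E (\<lambda>q i. 1 / nrm q * q i)"
    by (rule continuous_map_Euclidean_space_scale[OF inv_nrm_continuous disc_part_ident])
  have "continuous_map ?D (subtopology E (disc n)) (\<lambda>q i. 1 / nrm q * q i)"
    using 1 scale_E[of _ "1 / nrm _"]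
    by (auto simp: continuous_map_in_subtopology disc_enorm enorm_divide enorm_nonneg
        topspace_Euclidean_space)
  then have "continuous_map ?D B (\<lambda>q. \<phi> (\<lambda>i. 1 / nrm q * q i))"
    by (rule continuous_map_compose2[OF phi])
  moreover have "\<phi> (\<lambda>i. 1 / nrm q * q i) \<in> Z" if "q \<in> topspace ?D" for q
    by (rule unit_in) (use that in \<open>auto simp: collar_phi\<close>)
  ultimately have "continuous_map ?D (subtopology B Z) (\<lambda>q. \<phi> (\<lambda>i. 1 / nrm q * q i))"
    by (auto simp: continuous_map_in_subtopology)
  then show "continuous_map ?D (subtopology B Z) (\<lambda>q. proj (\<phi> q))"
    by (rule continuous_map_eq) (auto simp: proj_phi)
qed

lemma inward_continuous: "continuous_map (subtopology B collar) E inward"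
proof (rule continuous_map_from_part[OF collar_closed])
  show "continuous_map (subtopology B (Z \<inter> collar)) E inward"
    by (rule continuous_map_eq[of _ _ "\<lambda>a i. 0"]) (auto simp: inward_def topspace_Euclidean_space)
  have "continuous_map (subtopology E {q \<in> disc n. \<phi> q \<in> collar}) E (\<lambda>q i. (1 / nrm q - 1) * q i)"
    by (intro continuous_map_Euclidean_space_scale
        continuous_map_diff inv_nrm_continuous disc_part_ident) auto
  then show "continuous_map (subtopology E {q \<in> disc n. \<phi> q \<in> collar}) E (\<lambda>q. inward (\<phi> q))"
    by (rule continuous_map_eq) (auto simp: inward_phi)
qed

lemma core_continuous: "continuous_map B E core"
proof -
  have "continuous_map (subtopology B (topspace B)) E core"
  proof (rule continuous_map_from_part)
    show "continuous_map (subtopology B (Z \<inter> topspace B)) E core"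
      by (rule continuous_map_eq[of _ _ "\<lambda>a i. 0"]) (auto simp: core_def topspace_Euclidean_space)
    have "continuous_map (subtopology E {q \<in> disc n. \<phi> q \<in> topspace B}) E (\<lambda>q i. (1 - nrm q) * q i)"
      by (intro continuous_map_Euclidean_space_scale
          continuous_map_diff disc_part_nrm disc_part_ident) auto
    then show "continuous_map (subtopology E {q \<in> disc n. \<phi> q \<in> topspace B}) E (\<lambda>q. core (\<phi> q))"
      by (rule continuous_map_eq) (auto simp: core_phi)
  qed auto
  then show ?thesis by simp
qed

lemma nrm_inward: "a \<in> collar \<Longrightarrow> nrm (inward a) = depth a"
proof -
  assume a: "a \<in> collar"
  then have "a \<in> topspace B" by (simp add: collar_def)
  then show ?thesis
  proof (cases rule: point_cases)
    case (2 q)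
    then have "1/2 \<le> nrm q" "nrm q < 1" using a collar_phi[of q]
        by (auto simp: open_disc_enorm disc_enorm)
    then have "\<bar>1 / nrm q - 1\<bar> * nrm q = 1 - nrm q" by (simp add: field_simps)
    then show ?thesis using 2 by (simp add: inward_def depth_def enorm_scale)
  qed (simp add: inward_def depth_def enorm_zero)
qed

text \<open>The least depth at which cell coordinates are used. It keeps \<open>pre\<close> in the
  ball of radius 31/32, away from the boundary, where \<open>pre\<close> need not extend
  continuously.\<close>

definition inner :: "'b set" where "inner = {a \<in> topspace B. 1/32 \<le> depth a}"

lemma inner_closed: "closedin B inner"
  unfolding inner_def using closedin_continuous_map_preimage[OF depth_continuous, of "{1/32..}"]
      by simp

lemma pre_continuous: "continuous_map (subtopology B inner) (subtopology E {q \<in> topspace E. nrm q \<le>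
    1 - 1/32}) pre"
proof (rule continuous_map_from_part[OF inner_closed])
  have "Z \<inter> inner = {}" by (auto simp: inner_def depth_def)
  then show "continuous_map (subtopology B (Z \<inter> inner)) (subtopology E {q \<in> topspace E. nrm q \<le> 1 -
      1/32}) pre"
    by (auto simp: continuous_map_def)
  show "continuous_map (subtopology E {q \<in> disc n. \<phi> q \<in> inner}) (subtopology E {q \<in> topspace E.
      nrm q \<le> 1 - 1/32}) (\<lambda>q. pre (\<phi> q))"
    by (rule continuous_map_eq[of _ _ "\<lambda>q. q"])
       (auto simp: continuous_map_in_subtopology disc_part_ident inner_def depth_phi disc_enorm
           open_disc_enorm intro!: pre_phi[symmetric])
qed

lemma phi_pre: "a \<in> topspace B \<Longrightarrow> a \<notin> Z \<Longrightarrow> \<phi> (pre a) = a"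
  by (erule point_cases) auto

lemma pre_in: "a \<in> topspace B \<Longrightarrow> a \<notin> Z \<Longrightarrow> pre a \<in> open_disc n"
  by (erule point_cases) auto

lemma proj_Z: "a \<in> Z \<Longrightarrow> proj a = a"
  by (simp add: proj_def)

lemma top_ZZ: "topspace (subtopology B Z) = Z"
  using ZB by (simp add: Int_absorb1)

lemma proj_in: "a \<in> collar \<Longrightarrow> proj a \<in> Z"
  using proj_continuous by (auto simp: continuous_map_def Pi_iff collar_def)

section \<open>Contracting the collar\<close>

context
  fixes c :: "real \<times> 'b \<times> 'b \<Rightarrow> 'b" and w :: "'b \<times> 'b \<Rightarrow> real"
  assumes data: "lec_data (subtopology B Z) c w"
begin

lemmas contr_cont = lec_dataD(1)[OF data] and gauge_cont = lec_dataD(2)[OF data]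
  and contr_start = lec_dataD(3)[OF data, unfolded top_ZZ]
      and contr_diag = lec_dataD(4)[OF data, unfolded top_ZZ]
  and gauge_nonneg = lec_dataD(5)[OF data, unfolded top_ZZ]
      and gauge_zero = lec_dataD(6)[OF data, unfolded top_ZZ]
  and contr_end = lec_dataD(7)[OF data, unfolded top_ZZ]

abbreviation ZZ where "ZZ \<equiv> subtopology B Z"
abbreviation Sph where "Sph \<equiv> subtopology E {q \<in> topspace E. nrm q = 1}"
abbreviation Ball where "Ball \<equiv> subtopology E {q \<in> topspace E. nrm q \<le> 1/2}"

text \<open>
  Via \<open>a \<mapsto> (proj a, inward a)\<close> the collar of \<open>Z\<close> is embedded in \<open>Z \<times> Ball\<close> as the union of
  \<open>Z \<times> {0}\<close> and the points \<open>(\<phi> s, \<delta> s)\<close>.  The map below retracts all of \<open>Z \<times> Ball\<close>, in polar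
  coordinates, onto this subspace: if \<open>v\<close> is close to \<open>\<phi> s\<close> relative to \<open>\<delta>\<close>, it replaces \<open>v\<close> by \<open>\<phi> s\<close>;
  otherwise it projects to \<open>Z\<close>.  So the collar inherits local equiconnectedness from the product.
\<close>

definition polar_retract :: "'b \<times> (nat \<Rightarrow> real) \<times> real \<Rightarrow> 'b" where
  "polar_retract = (\<lambda>(v, s, \<delta>). if \<delta> \<le> w (\<phi> s, v) then v
     else if \<delta> / 2 \<le> w (\<phi> s, v) then c (max 0 (min 1 ((2 * \<delta> - 2 * w (\<phi> s, v)) / \<delta>)), \<phi> s, v)
     else \<phi> (\<lambda>i. (1 - \<delta> + 2 * w (\<phi> s, v)) * s i))"

lemma polar_retract_continuous:
  "continuous_map (prod_topology ZZ (prod_topology Sph (top_of_set {0..1/2}))) B polar_retract"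
proof -
  let ?D = "prod_topology ZZ (prod_topology Sph (top_of_set {0..1/2::real}))"
  let ?w = "\<lambda>x. w (\<phi> (fst (snd x)), fst x)"
  let ?c = "\<lambda>x. c (max 0 (min 1 ((2 * snd (snd x) - 2 * ?w x) / snd (snd x))), \<phi> (fst (snd x)), fst
      x)"
  let ?p = "\<lambda>x. \<phi> (\<lambda>i. (1 - snd (snd x) + 2 * ?w x) * fst (snd x) i)"
  have v: "continuous_map ?D ZZ fst" by (rule continuous_map_fst)
  have s: "continuous_map ?D E (\<lambda>x. fst (snd x))"
    using continuous_map_into_fulltopology[OF continuous_map_fst_snd] .
  have d: "continuous_map ?D euclideanreal (\<lambda>x. snd (snd x))"
    using continuous_map_into_fulltopology[OF continuous_map_snd_snd] .
  have "continuous_map ?D (subtopology E (disc n)) (\<lambda>x. fst (snd x))"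
    using s by (auto simp: continuous_map_in_subtopology disc_enorm)
  then have "continuous_map ?D B (\<lambda>x. \<phi> (fst (snd x)))"
    by (rule continuous_map_compose2[OF phi])
  then have ph: "continuous_map ?D ZZ (\<lambda>x. \<phi> (fst (snd x)))"
    by (auto simp: continuous_map_in_subtopology intro: bd)
  have wc: "continuous_map ?D euclideanreal (\<lambda>x. ?w x)"
    by (intro continuous_map_compose2[OF gauge_cont] continuous_map_pairedI ph v)
  let ?R = "{x \<in> topspace ?D. ?w x \<le> snd (snd x)}"
  let ?A = "subtopology ?D ?R"
  let ?R2 = "{x \<in> topspace ?A. snd (snd x) / 2 \<le> ?w x}"
  let ?A2 = "subtopology ?A ?R2"
  let ?R3 = "{x \<in> topspace ?A. ?w x \<le> snd (snd x) / 2}"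
  note sub = continuous_map_from_subtopology
  have pts: "fst x \<in> Z \<and> \<phi> (fst (snd x)) \<in> Z \<and> 0 \<le> snd (snd x) \<and> snd (snd x) \<le> 1/2"
      if "x \<in> topspace ?D" for x
    using that bd by auto
  have H: "continuous_map (prod_topology unit_interval ?A2) B (\<lambda>z. c (fst z, \<phi> (fst (snd (snd z))),
      fst (snd z)))"
    by (rule continuous_map_into_fulltopology[OF continuous_map_compose2[OF contr_cont]])
       (intro continuous_map_pairedI continuous_map_fst
           continuous_map_compose2[OF sub[OF sub[OF ph]] continuous_map_snd]
          continuous_map_compose2[OF sub[OF sub[OF v]] continuous_map_snd])
  have "continuous_map ?A2 B (\<lambda>x. (\<lambda>z. c (fst z, \<phi> (fst (snd (snd z))), fst (snd z)))
      (max 0 (min 1 ((2 * snd (snd x) - 2 * ?w x) / snd (snd x))), x))"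
  proof (rule continuous_map_singular_ratio[OF H])
    show "continuous_map ?A2 euclideanreal (\<lambda>x. 2 * snd (snd x) - 2 * ?w x)"
      by (intro sub continuous_map_diff continuous_map_real_mult_left d wc)
    show "continuous_map ?A2 euclideanreal (\<lambda>x. snd (snd x))"
      by (intro sub d)
    \<comment> \<open>At \<open>\<delta> = 0\<close> this region forces the gauge to vanish, hence
      \<open>v = \<phi> s\<close>, and there \<open>c\<close> is constant in time.\<close>
    fix x t assume x: "x \<in> topspace ?A2" and z: "snd (snd x) = 0" and t: "0 \<le> t" "t \<le> (1::real)"
    have xD: "x \<in> topspace ?D" and le: "?w x \<le> 0" using x z by auto
    have "0 \<le> ?w x" using gauge_nonneg pts[OF xD] by blast
    then have "?w x = 0" using le by linarith
    then have "\<phi> (fst (snd x)) = fst x" using gauge_zero pts[OF xD] by blast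
    then show "c (fst (t, x), \<phi> (fst (snd (snd (t, x)))), fst (snd (t, x))) =
        c (fst (0, x), \<phi> (fst (snd (snd (0, x)))), fst (snd (0, x)))"
      using t contr_diag pts[OF xD] by simp
  qed
  then have R2: "continuous_map ?A2 B (\<lambda>x. ?c x)" by simp
  have "continuous_map (subtopology ?A ?R3) (subtopology E (disc n))
     (\<lambda>x i. (1 - snd (snd x) + 2 * ?w x) * fst (snd x) i)"
  proof -
    have 1: "continuous_map (subtopology ?A ?R3) E (\<lambda>x i. (1 - snd (snd x) + 2 * ?w x) * fst (snd
        x) i)"
      by (intro continuous_map_Euclidean_space_scale sub continuous_map_add continuous_map_diff
          continuous_map_real_mult_left d wc s) auto
    have "(\<lambda>i. (1 - snd (snd x) + 2 * ?w x) * fst (snd x) i) \<in> disc n"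
      if x: "x \<in> topspace (subtopology ?A ?R3)" for x
    proof -
      have xD: "x \<in> topspace ?D" and le: "?w x \<le> snd (snd x) / 2" using x by auto
      have "0 \<le> ?w x" using gauge_nonneg pts[OF xD] by blast
      then have "\<bar>1 - snd (snd x) + 2 * ?w x\<bar> \<le> 1"
        using le pts[OF xD] by linarith
      moreover have "fst (snd x) \<in> topspace E" "nrm (fst (snd x)) = 1" using xD by auto
      ultimately show ?thesis by (simp add: disc_enorm enorm_scale scale_E)
    qed
    with 1 show ?thesis by (rule continuous_map_into_subtopologyI)
  qed
  then have R3: "continuous_map (subtopology ?A ?R3) B
     (\<lambda>x. ?p x)"
    by (rule continuous_map_compose2[OF phi])
  have R: "continuous_map ?A B (\<lambda>x. if snd (snd x) / 2 \<le> ?w x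
      then ?c x
      else ?p x)"
  proof (rule continuous_map_cases_le[OF _ _ R2 R3])
    fix x assume x: "x \<in> topspace ?A" and eq: "snd (snd x) / 2 = ?w x"
    have xD: "x \<in> topspace ?D" using x by auto
    note p = pts[OF xD]
    have e2: "2 * ?w x = snd (snd x)" using eq by simp
    show "?c x =
      ?p x"
    proof (cases "snd (snd x) = 0")
      case True
      then have "\<phi> (fst (snd x)) = fst x" using gauge_zero p eq by auto
      then show ?thesis using True e2 contr_diag p by simp
    next
      case False
      \<comment> \<open>On this edge the gauge is \<open>\<delta> / 2 \<le> 1/4 < 1\<close> and the
        time is 1, so \<open>c\<close> has arrived at \<open>\<phi> s\<close>.\<close>
      then show ?thesis using e2 contr_end p by simp
    qed
  next
    show "continuous_map ?A euclideanreal (\<lambda>x. snd (snd x) / 2)"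
      by (intro sub continuous_map_real_divide d) auto
    show "continuous_map ?A euclideanreal (\<lambda>x. ?w x)"
      by (rule sub[OF wc])
  qed
  show ?thesis
    unfolding polar_retract_def case_prod_unfold
  proof (rule continuous_map_cases_le[OF d wc _ R])
    show "continuous_map (subtopology ?D {x \<in> topspace ?D. snd (snd x) \<le> ?w x}) B fst"
      using continuous_map_into_fulltopology[OF v] by (rule sub)
    fix x assume x: "x \<in> topspace ?D" and eq: "snd (snd x) = ?w x"
    then show "fst x = (if snd (snd x) / 2 \<le> ?w x
      then ?c x
      else ?p x)"
      using pts[OF x] contr_start by simp
  qed
qed

definition retract :: "'b \<times> (nat \<Rightarrow> real) \<Rightarrow> 'b" where
  "retract = (\<lambda>(v, u). if nrm u = 0 then v else polar_retract (v, \<lambda>i. 1 / nrm u * u i, nrm u))"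

text \<open>Polar coordinates exhibit \<open>Z \<times> Ball\<close> as the image of a compact space
  together with the closed set \<open>Z \<times> {0}\<close>, on which the direction is lost. At
  radius 0 \<open>polar_retract\<close> returns \<open>v\<close> for every direction, because the
  gauge is nonnegative.\<close>

lemma retract_continuous: "continuous_map (prod_topology ZZ Ball) B retract"
proof (rule continuous_map_from_closed_Un_image)
  let ?D = "prod_topology ZZ (prod_topology Sph (top_of_set {0..1/2::real}))"
  have zero: "(\<lambda>i. 0) \<in> topspace E" by (simp add: topspace_Euclidean_space)
  have HB: "Hausdorff_space Ball" by (simp add: Hausdorff_space_subtopology
      Hausdorff_Euclidean_space)
  have "closedin Ball {\<lambda>i. 0}"
    using HB zero by (intro closedin_Hausdorff_singleton) (auto simp: enorm_zero)
  then show "closedin (prod_topology ZZ Ball) (Z \<times> {\<lambda>i. 0})"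
    using top_ZZ closedin_topspace[of ZZ] by (simp add: closedin_prod_Times_iff)
  show "Hausdorff_space (prod_topology ZZ Ball)"
    using HB B by (simp add: Hausdorff_space_prod_topology Hausdorff_space_subtopology)
  show "continuous_map ?D (prod_topology ZZ Ball) (\<lambda>x. (fst x, \<lambda>i. snd (snd x) * fst (snd x) i))"
  proof (rule continuous_map_pairedI[OF continuous_map_fst])
    have "continuous_map ?D E (\<lambda>x i. snd (snd x) * fst (snd x) i)"
      by (intro continuous_map_Euclidean_space_scale)
         (use continuous_map_into_fulltopology[OF continuous_map_fst_snd]
           continuous_map_into_fulltopology[OF continuous_map_snd_snd] in blast)+
    then show "continuous_map ?D Ball (\<lambda>x i. snd (snd x) * fst (snd x) i)"
      by (auto simp: continuous_map_in_subtopology enorm_scale scale_E)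
  qed
  have "compactin E {q \<in> topspace E. nrm q = 1}"
  proof (rule closed_compactin[OF compactin_enorm_le[of n 1]])
    show "closedin E {q \<in> topspace E. nrm q = 1}"
      using closedin_continuous_map_preimage[OF continuous_map_enorm[OF
          continuous_map_ident], of "{1}" n] by simp
  qed auto
  moreover have "compact_space ZZ" using B Z by (simp add: closedin_compact_space
      compact_space_subtopology)
  moreover have "compact_space (top_of_set {0..1/2::real})"
    by (intro compact_space_subtopology) simp
  ultimately show "compact_space ?D" by (simp add: compact_space_prod_topology
      compact_space_subtopology)
  show "topspace (prod_topology ZZ Ball) \<subseteq> Z \<times> {\<lambda>i. 0} \<union> (\<lambda>x. (fst x, \<lambda>i. snd (snd x) * fst (snd x)
      i)) ` topspace ?D"
  proof
    fix x assume x: "x \<in> topspace (prod_topology ZZ Ball)"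
    obtain v u where vu: "x = (v, u)" by fastforce
    have v: "v \<in> Z" "v \<in> topspace B" and u: "u \<in> topspace E" "nrm u \<le> 1/2" using x vu by auto
    show "x \<in> Z \<times> {\<lambda>i. 0} \<union> (\<lambda>x. (fst x, \<lambda>i. snd (snd x) * fst (snd x) i)) ` topspace ?D"
    proof (cases "nrm u = 0")
      case True
      then show ?thesis using enorm_eq_0[OF u(1)] vu v by simp
    next
      case False
      let ?x = "(v, (\<lambda>i. 1 / nrm u * u i), nrm u)"
      have "?x \<in> topspace ?D"
        using u v False enorm_nonneg[of n u] scale_E[OF u(1), of "1 / nrm u"]
            by (simp add: enorm_divide)
      moreover have "x = (fst ?x, \<lambda>i. snd (snd ?x) * fst (snd ?x) i)" using False vu by simp
      ultimately show ?thesis by blast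
    qed
  qed
  show "continuous_map (subtopology (prod_topology ZZ Ball) (Z \<times> {\<lambda>i. 0})) B retract"
  proof (rule continuous_map_eq)
    show "continuous_map (subtopology (prod_topology ZZ Ball) (Z \<times> {\<lambda>i. 0})) B fst"
      using continuous_map_into_fulltopology[OF continuous_map_fst] by (rule
          continuous_map_from_subtopology)
  qed (auto simp: retract_def enorm_zero)
  show "continuous_map ?D B (\<lambda>x. retract (fst x, \<lambda>i. snd (snd x) * fst (snd x) i))"
  proof (rule continuous_map_eq[OF polar_retract_continuous])
    fix x assume x: "x \<in> topspace ?D"
    obtain v s \<delta> where vs: "x = (v, s, \<delta>)" by (metis prod.collapse)
    have v: "v \<in> Z" and s: "s \<in> topspace E" "nrm s = 1" and d: "0 \<le> \<delta>" using x vs by auto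
    have "nrm (\<lambda>i. \<delta> * s i) = \<delta>" using s d by (simp add: enorm_scale)
    moreover have "(\<lambda>i. 1 / \<delta> * (\<delta> * s i)) = s" if "\<delta> \<noteq> 0" using that by simp
    moreover have "0 \<le> w (\<phi> s, v)" using gauge_nonneg bd[OF s] v by blast
    ultimately show "polar_retract x = retract (fst x, \<lambda>i. snd (snd x) * fst (snd x) i)"
      unfolding vs by (cases "\<delta> = 0") (simp_all add: retract_def polar_retract_def)
  qed
qed

text \<open>For a point of the cell \<open>v\<close> is \<open>\<phi> s\<close> itself, so the gauge
  is 0 and the last branch of \<open>polar_retract\<close> puts the point back at norm
  \<open>1 - \<delta>\<close>.\<close>

lemma retract_collar:
  assumes a: "a \<in> collar"
  shows "retract (proj a, inward a) = a"
proof -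
  have aB: "a \<in> topspace B" using a by (simp add: collar_def)
  then show ?thesis
  proof (cases rule: point_cases)
    case (2 q)
    have q: "q \<in> disc n" "1/2 \<le> nrm q" "nrm q < 1" "q \<in> topspace E"
      using a 2 collar_phi[of q] by (auto simp: open_disc_enorm disc_enorm)
    let ?s = "\<lambda>i. 1 / nrm q * q i"
    have n: "nrm (inward a) = 1 - nrm q" using nrm_inward[OF a] 2 q depth_phi by simp
    have "(1 / (1 - nrm q)) * (1 / nrm q - 1) = 1 / nrm q" using q by (simp add: field_simps)
    then have s: "(\<lambda>i. 1 / nrm (inward a) * inward a i) = ?s"
      unfolding n using 2 by (simp add: inward_def flip: mult.assoc)
    have sZ: "\<phi> ?s \<in> Z" using unit_in[OF q(4)] q by auto
    have "retract (proj a, inward a) = polar_retract (\<phi> ?s, ?s, 1 - nrm q)"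
      using n s q 2 by (simp add: retract_def proj_def)
    also have "\<dots> = \<phi> (\<lambda>i. nrm q * ?s i)"
      using q gauge_zero[OF sZ sZ] by (simp add: polar_retract_def)
    also have "(\<lambda>i. nrm q * ?s i) = q" using q by auto
    finally show ?thesis using 2 by simp
  qed (simp add: retract_def proj_def inward_def enorm_zero)
qed

definition collar_contract :: "real \<times> 'b \<times> 'b \<Rightarrow> 'b" where
  "collar_contract = (\<lambda>(t, a, y). retract (c (t, proj a, proj y), \<lambda>i. (1 - t) * inward y i + t *
      inward a i))"

abbreviation CC where "CC \<equiv> subtopology B collar"

lemma collar_contract_continuous:
  "continuous_map (prod_topology unit_interval (prod_topology CC CC)) B collar_contract"
proof -
  let ?D = "prod_topology unit_interval (prod_topology CC CC)"
  have t: "continuous_map ?D unit_interval fst" by (rule continuous_map_fst)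
  have tr: "continuous_map ?D euclideanreal fst" using continuous_map_into_fulltopology[OF
      continuous_map_fst] .
  have a: "continuous_map ?D CC (\<lambda>x. fst (snd x))" and y: "continuous_map ?D CC (\<lambda>x. snd (snd x))"
    using continuous_map_fst_snd
      continuous_map_snd_snd by blast+
  have "continuous_map ?D E (\<lambda>x i. (1 - fst x) * inward (snd (snd x)) i + fst x * inward (fst (snd
      x)) i)"
    by (intro continuous_map_Euclidean_space_add continuous_map_Euclidean_space_scale
        continuous_map_diff tr
        continuous_map_compose2[OF inward_continuous] a y) auto
  moreover have "nrm (\<lambda>i. (1 - fst x) * inward (snd (snd x)) i + fst x * inward (fst (snd x)) i) \<le>
      1/2"
    if "x \<in> topspace ?D" for x
    by (rule enorm_convex) (use that nrm_inward in \<open>auto simp: collar_def\<close>)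
  moreover have "(\<lambda>i. (1 - fst x) * inward (snd (snd x)) i + fst x * inward (fst (snd x)) i) \<in>
      topspace E"
    if "x \<in> topspace ?D" for x
    using continuous_map_image_subset_topspace[OF calculation(1)] that by blast
  ultimately have "continuous_map ?D Ball (\<lambda>x i. (1 - fst x) * inward (snd (snd x)) i + fst x *
      inward (fst (snd x)) i)"
    unfolding continuous_map_in_subtopology by blast
  then show ?thesis
    unfolding collar_contract_def case_prod_unfold
    by (intro continuous_map_compose2[OF retract_continuous] continuous_map_pairedI
        continuous_map_compose2[OF contr_cont]
        continuous_map_compose2[OF proj_continuous] t a y)
qed

lemma collar_contract_0: "a \<in> collar \<Longrightarrow> y \<in> collar \<Longrightarrow> collar_contract (0, a, y) = y"
  by (simp add: collar_contract_def contr_start proj_in retract_collar)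

lemma collar_contract_diag: "a \<in> collar \<Longrightarrow> t \<in> {0..1} \<Longrightarrow> collar_contract (t, a, a) = a"
proof -
  assume a: "a \<in> collar" "t \<in> {0..1}"
  have "(\<lambda>i. (1 - t) * inward a i + t * inward a i) = inward a" by (auto simp: algebra_simps)
  then show ?thesis using a by (simp add: collar_contract_def contr_diag proj_in retract_collar)
qed

lemma collar_contract_1: "a \<in> collar \<Longrightarrow> y \<in> collar \<Longrightarrow> w (proj a, proj y) < 1 \<Longrightarrow>
    collar_contract (1, a, y) = a"
  by (simp add: collar_contract_def contr_end proj_in retract_collar)

end

end

section \<open>Local equiconnectedness survives attaching a cell\<close>

context cell_attachment
begin

text \<open>Straight lines inside the cell are followed by the contraction of the collar, each
  damped to rest outside its range. If \<open>a\<close> has depth at least 1/8, the lines already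
  bring \<open>y\<close> to \<open>a\<close>, and the second contraction fixes the diagonal.
  Otherwise both points end up at depth at most 1/4, where the second contraction works at full
  strength.\<close>

lemma lec_cell_attachment:
  assumes "lec (subtopology B Z)"
  shows "lec B"
proof -
  obtain c w where data: "lec_data (subtopology B Z) c w"
    using assms by (auto simp: lec_def)
  note w = lec_dataD(2)[OF data] and w_nn = lec_dataD(5)[OF data, unfolded top_ZZ]
    and w0 = lec_dataD(6)[OF data, unfolded top_ZZ]
  define cc where "cc = collar_contract c w"
  have cc: "continuous_map (prod_topology unit_interval (prod_topology (subtopology B collar)
      (subtopology B collar))) B cc"
    unfolding cc_def by (rule collar_contract_continuous[OF data])
  have cc0: "cc (0, a, y) = y" if "a \<in> collar" "y \<in> collar" for a y
    unfolding cc_def using collar_contract_0[OF data that] .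
  have ccd: "cc (t, a, a) = a" if "a \<in> collar" "t \<in> {0..1}" for a t
    unfolding cc_def using collar_contract_diag[OF data that] .
  have cc1: "cc (1, a, y) = a" if "a \<in> collar" "y \<in> collar" "w (proj a, proj y) < 1" for a y
    unfolding cc_def using collar_contract_1[OF data that] .
  note sub = continuous_map_from_subtopology
  let ?P = "prod_topology B B"
  let ?D = "prod_topology unit_interval ?P"
  define md where "md = (\<lambda>a y. max (depth a) (depth y))"
  define chi where "chi = (\<lambda>a y. max 0 (min 1 (2 - 4 * md a y)))"
  define c2 where "c2 = (\<lambda>(t, a, y). if md a y \<le> 1/2 then cc (t * chi a y, a, y) else y)"
  \<comment> \<open>The gauge of \<open>Z\<close> has to be cut off, as \<open>proj\<close> is
    continuous only on the collar; up to depth 1/4 it is undamped.\<close>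
  define wr where "wr = (\<lambda>(a, y). if md a y \<le> 1/2 then chi a y * w (proj a, proj y) else 0)"
  have P1: "continuous_map ?P B fst" and P2: "continuous_map ?P B snd"
    by (rule continuous_map_fst continuous_map_snd)+
  have dP1: "continuous_map ?P euclideanreal (\<lambda>z. depth (fst z))"
      and dP2: "continuous_map ?P euclideanreal (\<lambda>z. depth (snd z))"
    by (rule continuous_map_compose2[OF depth_continuous P1]
        continuous_map_compose2[OF depth_continuous P2])+
  have mdP: "continuous_map ?P euclideanreal (\<lambda>z. md (fst z) (snd z))"
    unfolding md_def by (intro continuous_map_real_max dP1 dP2)
  have chiP: "continuous_map ?P euclideanreal (\<lambda>z. chi (fst z) (snd z))"
    unfolding chi_def by (intro continuous_map_real_max continuous_map_real_min
        continuous_map_diff continuous_map_real_mult_left mdP) auto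
  have tD: "continuous_map ?D euclideanreal fst"
    using continuous_map_into_fulltopology[OF continuous_map_fst] .
  have D1: "continuous_map ?D B (\<lambda>x. fst (snd x))" and D2: "continuous_map ?D B (\<lambda>x. snd (snd x))"
    by (rule continuous_map_compose2[OF P1 continuous_map_snd] continuous_map_compose2[OF P2
        continuous_map_snd])+
  have mdD: "continuous_map ?D euclideanreal (\<lambda>x. md (fst (snd x)) (snd (snd x)))"
    by (rule continuous_map_compose2[OF mdP continuous_map_snd])
  have chiD: "continuous_map ?D euclideanreal (\<lambda>x. chi (fst (snd x)) (snd (snd x)))"
    by (rule continuous_map_compose2[OF chiP continuous_map_snd])
  have chi01: "0 \<le> chi a y \<and> chi a y \<le> 1" for a y by (simp add: chi_def)
  have c2: "continuous_map ?D B c2"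
    unfolding c2_def case_prod_unfold
  proof (rule continuous_map_cases_le[OF mdD])
    let ?S = "{x \<in> topspace ?D. md (fst (snd x)) (snd (snd x)) \<le> 1/2}"
    have "continuous_map (subtopology ?D ?S) unit_interval (\<lambda>x. fst x * chi (fst (snd x)) (snd (snd
        x)))"
      by (rule continuous_map_into_subtopologyI) (use chi01 in \<open>auto intro!: sub
          continuous_map_real_mult tD chiD mult_le_one\<close>)
    moreover have "continuous_map (subtopology ?D ?S) (subtopology B collar) (\<lambda>x. fst (snd x))"
      by (rule continuous_map_into_subtopologyI[OF sub[OF D1]]) (auto simp: collar_def md_def)
    moreover have "continuous_map (subtopology ?D ?S) (subtopology B collar) (\<lambda>x. snd (snd x))"
      by (rule continuous_map_into_subtopologyI[OF sub[OF D2]]) (auto simp: collar_def md_def)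
    ultimately show "continuous_map (subtopology ?D ?S) B
        (\<lambda>x. cc (fst x * chi (fst (snd x)) (snd (snd x)), fst (snd x), snd (snd x)))"
      by (intro continuous_map_compose2[OF cc] continuous_map_pairedI)
    show "continuous_map (subtopology ?D {x \<in> topspace ?D. 1/2 \<le> md (fst (snd x)) (snd (snd x))}) B
        (\<lambda>x. snd (snd x))"
      by (rule sub[OF D2])
    fix x assume x: "x \<in> topspace ?D" and eq: "md (fst (snd x)) (snd (snd x)) = 1/2"
    have "fst (snd x) \<in> collar" "snd (snd x) \<in> collar" using x eq by (auto simp: collar_def md_def)
    then show "cc (fst x * chi (fst (snd x)) (snd (snd x)), fst (snd x), snd (snd x)) = snd (snd x)"
      using eq cc0[of "fst (snd x)" "snd (snd x)"] by (simp add: chi_def)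
  qed simp
  have wr: "continuous_map ?P euclideanreal wr"
    unfolding wr_def case_prod_unfold
  proof (rule continuous_map_cases_le[OF mdP])
    let ?S = "{x \<in> topspace ?P. md (fst x) (snd x) \<le> 1/2}"
    have "continuous_map (subtopology ?P ?S) (subtopology B collar) fst"
      by (rule continuous_map_into_subtopologyI[OF sub[OF P1]]) (auto simp: collar_def md_def)
    moreover have "continuous_map (subtopology ?P ?S) (subtopology B collar) snd"
      by (rule continuous_map_into_subtopologyI[OF sub[OF P2]]) (auto simp: collar_def md_def)
    ultimately show "continuous_map (subtopology ?P ?S) euclideanreal (\<lambda>x. chi (fst x) (snd x) * w
        (proj (fst x), proj (snd x)))"
      by (intro continuous_map_real_mult sub[OF chiP] continuous_map_compose2[OF w]
          continuous_map_pairedI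
          continuous_map_compose2[OF proj_continuous])
  qed (auto simp: chi_def)
  have wr_nn: "0 \<le> wr (a, y)" if "a \<in> topspace B" "y \<in> topspace B" for a y
    using that chi01[of a y] w_nn proj_in by (auto simp: wr_def md_def collar_def)
  have wr_diag: "wr (a, a) = 0" if "a \<in> topspace B" for a
    using that w0 proj_in by (auto simp: wr_def md_def collar_def)
  have c2_0: "c2 (0, a, y) = y" if "a \<in> topspace B" "y \<in> topspace B" for a y
    using that cc0 by (auto simp: c2_def md_def collar_def)
  have c2_diag: "c2 (t, a, a) = a" if "a \<in> topspace B" "t \<in> {0..1}" for a t
    using that ccd[of a "t * chi a a"] chi01[of a a]
        by (auto simp: c2_def md_def collar_def mult_le_one)
  define mi where "mi = (\<lambda>a y. min (depth a) (depth y))"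
  \<comment> \<open>This is 0 at depth 1/32, where the straight lines are abandoned, and 1 from
    depth 1/16 on.\<close>
  define psi where "psi = (\<lambda>a y. max 0 (min 1 (32 * mi a y - 1)))"
  define lin where "lin = (\<lambda>t a y i. (1 - t) * pre y i + t * pre a i)"
  define c1' where "c1' = (\<lambda>(t, a, y). if 1/32 \<le> mi a y then \<phi> (lin (t * psi a y) a y) else y)"
  have miD: "continuous_map ?D euclideanreal (\<lambda>x. mi (fst (snd x)) (snd (snd x)))"
    unfolding mi_def by (intro continuous_map_real_min
        continuous_map_compose2[OF depth_continuous] D1 D2)
  have psiD: "continuous_map ?D euclideanreal (\<lambda>x. psi (fst (snd x)) (snd (snd x)))"
    unfolding psi_def by (intro continuous_map_real_max continuous_map_real_min
        continuous_map_diff continuous_map_real_mult_left miD) auto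
  have psi01: "0 \<le> psi a y \<and> psi a y \<le> 1" for a y by (simp add: psi_def)
  have not_Z: "a \<notin> Z" if "0 < depth a" for a using that by (auto simp: depth_def)
  have nrm_pre: "nrm (pre a) \<le> 1 - 1/32" if "1/32 \<le> depth a" for a
  proof -
    have "a \<notin> Z" by (rule not_Z) (use that in linarith)
    then show ?thesis using that unfolding depth_def by simp
  qed
  have c1'c: "continuous_map ?D B c1'"
    unfolding c1'_def case_prod_unfold
  proof (rule continuous_map_cases_le[OF _ miD])
    let ?S = "{x \<in> topspace ?D. 1/32 \<le> mi (fst (snd x)) (snd (snd x))}"
    have pa: "continuous_map (subtopology ?D ?S) E (\<lambda>x. pre (fst (snd x)))"
      by (rule continuous_map_compose2[OF continuous_map_into_fulltopology[OF pre_continuous]])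
         (rule continuous_map_into_subtopologyI[OF sub[OF D1]], auto simp: inner_def mi_def)
    have py: "continuous_map (subtopology ?D ?S) E (\<lambda>x. pre (snd (snd x)))"
      by (rule continuous_map_compose2[OF continuous_map_into_fulltopology[OF pre_continuous]])
         (rule continuous_map_into_subtopologyI[OF sub[OF D2]], auto simp: inner_def mi_def)
    have 1: "continuous_map (subtopology ?D ?S) E (\<lambda>x. lin (fst x * psi (fst (snd x)) (snd (snd
        x))) (fst (snd x)) (snd (snd x)))"
      unfolding lin_def
      by (intro continuous_map_Euclidean_space_add continuous_map_Euclidean_space_scale
          continuous_map_diff
          continuous_map_real_mult sub[OF tD] sub[OF psiD] pa py) auto
    have "continuous_map (subtopology ?D ?S) (subtopology E (disc n)) (\<lambda>x. lin (fst x * psi (fst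
        (snd x)) (snd (snd x))) (fst (snd x)) (snd (snd x)))"
    proof (rule continuous_map_into_subtopologyI[OF 1])
      fix x assume x: "x \<in> topspace (subtopology ?D ?S)"
      let ?l = "lin (fst x * psi (fst (snd x)) (snd (snd x))) (fst (snd x)) (snd (snd x))"
      have "?l \<in> topspace E" using continuous_map_image_subset_topspace[OF 1] x by blast
      moreover have "nrm ?l \<le> 1 - 1/32"
        unfolding lin_def using x psi01[of "fst (snd x)" "snd (snd x)"]
        by (intro enorm_convex nrm_pre) (auto simp: mi_def mult_le_one)
      ultimately show "?l \<in> disc n" by (simp add: disc_enorm)
    qed
    then show "continuous_map (subtopology ?D ?S) B (\<lambda>x. \<phi> (lin (fst x * psi (fst (snd x)) (snd
        (snd x))) (fst (snd x)) (snd (snd x))))"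
      by (rule continuous_map_compose2[OF phi])
    show "continuous_map (subtopology ?D {x \<in> topspace ?D. mi (fst (snd x)) (snd (snd x)) \<le> 1/32})
        B (\<lambda>x. snd (snd x))"
      by (rule sub[OF D2])
    fix x assume x: "x \<in> topspace ?D" and eq: "1/32 = mi (fst (snd x)) (snd (snd x))"
    have "snd (snd x) \<notin> Z" using eq by (intro not_Z) (auto simp: mi_def)
    then show "\<phi> (lin (fst x * psi (fst (snd x)) (snd (snd x))) (fst (snd x)) (snd (snd x))) = snd
        (snd x)"
      using x phi_pre by (auto simp: psi_def lin_def simp flip: eq)
  qed simp
  have c1'_0: "c1' (0, a, y) = y" if "a \<in> topspace B" "y \<in> topspace B" for a y
    using that phi_pre[of y] not_Z[of y] by (auto simp: c1'_def lin_def mi_def)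
  have c1'_diag: "c1' (t, a, a) = a" if "a \<in> topspace B" for a t
  proof -
    have "lin r a a = pre a" for r by (auto simp: lin_def algebra_simps)
    then show ?thesis using that phi_pre[of a] not_Z[of a] by (auto simp: c1'_def mi_def)
  qed
  define cB where "cB = (\<lambda>(t, a, y). c2 (t, a, c1' (t, a, y)))"
  \<comment> \<open>This term makes the diagonal the exact zero set of the gauge: off
    \<open>Z\<close>, equal \<open>depth\<close> and \<open>core\<close> give equal
    \<open>pre\<close>; on \<open>Z\<close>, \<open>wr\<close> is the given gauge.\<close>
  define v where "v = (\<lambda>(a, y). max \<bar>depth a - depth y\<bar> (max (nrm (\<lambda>i. core a i - core y i)) (wr
      (a, y))))"
  \<comment> \<open>The factor 16 places \<open>y\<close> deeper than 1/16 if \<open>a\<close> has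
    depth at least 1/8; the factor 8 places the moved point above depth 1/4 if not. The collar terms
    are taken at \<open>c1' (1, a, y)\<close>, because \<open>cB\<close> applies \<open>c2\<close>
    to the point already moved by \<open>c1'\<close>.\<close>
  define wB where "wB = (\<lambda>(a, y). max (16 * \<bar>depth a - depth y\<bar>)
     (max (max (wr (a, c1' (1, a, y))) (8 * \<bar>depth a - depth (c1' (1, a, y))\<bar>)) (v (a, y))))"
  have cBc: "continuous_map ?D B cB"
    unfolding cB_def case_prod_unfold
    by (intro continuous_map_compose2[OF c2] continuous_map_pairedI continuous_map_fst D1)
       (simp add: c1'c)
  have "continuous_map ?P ?D (\<lambda>z. (1, fst z, snd z))"
    by (intro continuous_map_pairedI P1 P2) auto
  then have c11: "continuous_map ?P B (\<lambda>z. c1' (1, fst z, snd z))"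
    by (rule continuous_map_compose2[OF c1'c])
  have vc: "continuous_map ?P euclideanreal v"
    unfolding v_def case_prod_unfold
    by (intro continuous_map_real_max continuous_map_real_abs continuous_map_diff dP1 dP2
        continuous_map_enorm
        continuous_map_Euclidean_space_diff continuous_map_compose2[OF core_continuous] P1 P2)
            (simp add: wr)
  have wBc: "continuous_map ?P euclideanreal wB"
    unfolding wB_def case_prod_unfold
    by (intro continuous_map_real_max continuous_map_real_abs continuous_map_diff
        continuous_map_real_mult_left dP1 dP2
         continuous_map_compose2[OF wr] continuous_map_compose2[OF depth_continuous]
             continuous_map_pairedI P1 c11)
       (simp add: vc)
  have in1: "c1' (1, a, y) \<in> topspace B" if "a \<in> topspace B" "y \<in> topspace B" for a y
    using c1'c that by (auto simp: continuous_map_def Pi_iff)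
  have v_eq: "v (a, y) = 0 \<longleftrightarrow> a = y" if a: "a \<in> topspace B" and y: "y \<in> topspace B" for a y
  proof
    assume "a = y"
    then show "v (a, y) = 0" using wr_diag[OF y] by (simp add: v_def enorm_zero)
  next
    assume v0: "v (a, y) = 0"
    then have d: "depth a = depth y" and k: "nrm (\<lambda>i. core a i - core y i) \<le> 0"
        and r: "wr (a, y) \<le> 0"
      by (auto simp: v_def max_def split: if_splits)
    have "core a \<in> topspace E" "core y \<in> topspace E"
      using core_continuous a y by (auto simp: continuous_map_def Pi_iff)
    then have "(\<lambda>i. core a i - core y i) \<in> topspace E" by (simp add: topspace_Euclidean_space)
    then have "(\<lambda>i. core a i - core y i) = (\<lambda>i. 0)" using enorm_eq_0 k enorm_nonneg
        by (meson antisym)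
    then have k: "core a i = core y i" for i by (metis eq_iff_diff_eq_0)
    show "a = y"
    proof (cases "a \<in> Z")
      case True
      then have "depth y = 0" using d by (simp add: depth_def)
      then have yZ: "y \<in> Z" using depth_pos[OF y] by force
      then have "wr (a, y) = w (a, y)" using True by (simp add: wr_def md_def chi_def depth_def
          proj_Z)
      then have "w (a, y) = 0" using r w_nn[OF True yZ] by simp
      then show ?thesis using w0[OF True yZ] by blast
    next
      case False
      then have pos: "0 < depth a" using depth_pos a by blast
      then have yZ: "y \<notin> Z" using d not_Z by simp
      have "pre a i = pre y i" for i using k[of i] False yZ pos d by (simp add: core_def)
      then have "pre a = pre y" by blast
      then show ?thesis using phi_pre a y False yZ by metis
    qed
  qed
  have v_nn: "0 \<le> v (a, y)" for a y by (simp add: v_def le_max_iff_disj)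
  have arrive: "cB (1, a, y) = a" if a: "a \<in> topspace B" and y: "y \<in> topspace B"
      and lt: "wB (a, y) < 1" for a y
  proof (cases "1/8 \<le> depth a")
    case True
    have "16 * \<bar>depth a - depth y\<bar> < 1" using lt by (simp add: wB_def)
    then have "\<bar>depth a - depth y\<bar> < 1/16" by simp
    then have "depth a - depth y < 1/16" by (rule le_less_trans[OF abs_ge_self])
    then have "1/16 \<le> depth y" using True by simp
    then have "psi a y = 1" "1/32 \<le> mi a y" using True by (auto simp: psi_def mi_def)
    then have "c1' (1, a, y) = a"
      using phi_pre[OF a] not_Z[of a] True by (simp add: c1'_def lin_def)
    then show ?thesis using c2_diag[OF a] by (simp add: cB_def)
  next
    case False
    let ?y = "c1' (1, a, y)"
    have yB: "?y \<in> topspace B" using in1[OF a y] .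
    have wr1: "wr (a, ?y) < 1" and "8 * \<bar>depth a - depth ?y\<bar> < 1" using lt by (simp_all add: wB_def)
    then have "\<bar>depth a - depth ?y\<bar> < 1/8" by simp
    then have "- (depth a - depth ?y) < 1/8" by (rule le_less_trans[OF abs_ge_minus_self])
    then have "depth ?y < 1/4" using False by simp
    then have md: "md a ?y \<le> 1/4" using False by (simp add: md_def)
    then have chi: "chi a ?y = 1" by (simp add: chi_def)
    then have "w (proj a, proj ?y) < 1" using wr1 md by (simp add: wr_def)
    moreover have "a \<in> collar" "?y \<in> collar" using md a yB by (auto simp: collar_def md_def)
    ultimately show ?thesis using cc1 chi md by (simp add: cB_def c2_def)
  qed
  show ?thesis
    unfolding lec_def lec_data_def
  proof (intro exI[of _ cB] exI[of _ wB] conjI ballI impI)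
    show "continuous_map ?D B cB" "continuous_map ?P euclideanreal wB" by (fact cBc, fact wBc)
    fix a y assume a: "a \<in> topspace B"
    show "cB (t, a, a) = a" if "t \<in> {0..1}" for t
      using c1'_diag[OF a] c2_diag[OF a that] by (simp add: cB_def)
    assume y: "y \<in> topspace B"
    show "cB (0, a, y) = y" using c1'_0[OF a y] c2_0[OF a y] by (simp add: cB_def)
    show "0 \<le> wB (a, y)" by (simp add: wB_def le_max_iff_disj)
    show "wB (a, y) = 0 \<longleftrightarrow> a = y"
    proof
      assume "a = y"
      then show "wB (a, y) = 0" using v_eq[OF a a] wr_diag[OF a] c1'_diag[OF a]
          by (simp add: wB_def)
    next
      assume "wB (a, y) = 0"
      then have "v (a, y) \<le> 0" by (simp add: wB_def max_def split: if_splits)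
      then show "a = y" using v_eq[OF a y] v_nn[of a y] by linarith
    qed
    show "wB (a, y) < 1 \<Longrightarrow> cB (1, a, y) = a" using arrive[OF a y] .
  qed
qed

end

text \<open>
  The contraction reaches \<open>e\<close> at time \<open>w\<close> already.  This leaves time for points of an attached cell
  to be pushed to its boundary first, so that the contraction extends over the cell without
  changing it.
\<close>

definition contraction_near :: "'a topology \<Rightarrow> 'b topology \<Rightarrow> ('a \<Rightarrow> 'b) \<Rightarrow> (real \<times> 'a \<times> 'b \<Rightarrow> 'b) \<Rightarrow>
    ('a \<times> 'b \<Rightarrow> real) \<Rightarrow> bool" where
  "contraction_near X K e c w \<longleftrightarrow>
     continuous_map (prod_topology unit_interval (prod_topology X K)) K c \<and>
     continuous_map (prod_topology X K) euclideanreal w \<and>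
     (\<forall>x\<in>topspace X. \<forall>y\<in>topspace K. c (0, x, y) = y) \<and>
     (\<forall>x\<in>topspace X. \<forall>t\<in>{0..1}. c (t, x, e x) = e x) \<and>
     (\<forall>x\<in>topspace X. \<forall>y\<in>topspace K. 0 \<le> w (x, y) \<and> w (x, y) \<le> 1) \<and>
     (\<forall>x\<in>topspace X. w (x, e x) = 1/2) \<and>
     (\<forall>x\<in>topspace X. \<forall>y\<in>topspace K. \<forall>t\<in>{0..1}. w (x, y) < t \<longrightarrow> c (t, x, y) = e x)"

lemma contraction_nearD:
  assumes "contraction_near X K e c w"
  shows "continuous_map (prod_topology unit_interval (prod_topology X K)) K c"
    and "continuous_map (prod_topology X K) euclideanreal w"
    and "\<And>x y. x \<in> topspace X \<Longrightarrow> y \<in> topspace K \<Longrightarrow> c (0, x, y) = y"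
    and "\<And>x t. x \<in> topspace X \<Longrightarrow> t \<in> {0..1} \<Longrightarrow> c (t, x, e x) = e x"
    and "\<And>x y. x \<in> topspace X \<Longrightarrow> y \<in> topspace K \<Longrightarrow> 0 \<le> w (x, y) \<and> w (x, y) \<le> 1"
    and "\<And>x. x \<in> topspace X \<Longrightarrow> w (x, e x) = 1/2"
    and "\<And>x y t. x \<in> topspace X \<Longrightarrow> y \<in> topspace K \<Longrightarrow> t \<in> {0..1} \<Longrightarrow> w (x, y) < t \<Longrightarrow> c (t, x, y) = e x"
  using assms by (simp_all add: contraction_near_def)

text \<open>At double speed the contraction arrives by time 1/2 wherever the old gauge is below 1.
  Cutting the gauge off below at 1/2 and above at 1 turns it into a bound for the arrival
  time.\<close>

lemma lec_imp_contraction_near: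
  assumes "lec K" and e: "continuous_map X K e"
  shows "\<exists>c w. contraction_near X K e c w"
proof -
  obtain c w where data: "lec_data K c w" using assms(1) by (auto simp: lec_def)
  note cw = lec_dataD[OF data]
  have eK: "e x \<in> topspace K" if "x \<in> topspace X" for x using e that by (auto simp:
      continuous_map_def)
  have w_ee: "w (e x, e x) = 0" if "x \<in> topspace X" for x using cw(6) eK[OF that] by simp
  let ?c = "\<lambda>z. c (max 0 (min 1 (2 * fst z)), e (fst (snd z)), snd (snd z))"
  let ?w = "\<lambda>z. max (1/2) (min 1 (w (e (fst z), snd z)))"
  have "contraction_near X K e ?c ?w"
    unfolding contraction_near_def
  proof (intro conjI ballI impI)
    have "continuous_map (prod_topology unit_interval (prod_topology X K)) unit_interval (\<lambda>z. max 0
        (min 1 (2 * fst z)))"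
      by (intro continuous_map_clamp continuous_map_real_mult_left
          continuous_map_into_fulltopology[OF continuous_map_fst])
    then show "continuous_map (prod_topology unit_interval (prod_topology X K)) K ?c"
      by (intro continuous_map_compose2[OF cw(1)] continuous_map_pairedI
          continuous_map_compose2[OF e] continuous_map_fst_snd
          continuous_map_snd_snd)
    have "continuous_map (prod_topology X K) euclideanreal (\<lambda>z. w (e (fst z), snd z))"
      by (intro continuous_map_compose2[OF cw(2)] continuous_map_pairedI
          continuous_map_compose2[OF e] continuous_map_fst continuous_map_snd)
    then show "continuous_map (prod_topology X K) euclideanreal ?w"
      by (intro continuous_map_real_max continuous_map_real_min) auto
    fix x assume x: "x \<in> topspace X"
    show "?w (x, e x) = 1/2" using w_ee[OF x] by simp
    fix y t assume y: "y \<in> topspace K" and t: "t \<in> {0..1::real}"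
      and lt: "?w (x, y) < t"
    have "max 0 (min 1 (2 * t)) = 1" "w (e x, y) < 1" using lt t by auto
    then show "?c (t, x, y) = e x" using cw eK[OF x] y by simp
  qed (use cw eK in auto)
  then show ?thesis by blast
qed

section \<open>Extending a contraction over one cell\<close>

context cell_attachment
begin

text \<open>A point with disc coordinate \<open>q\<close> is pushed outwards by the factor
  \<open>1 + t\<close> and meets the boundary at time \<open>1 / nrm q - 1\<close>; from there it
  follows \<open>c\<close> for the remaining time. Points of norm below 1/2 do not reach the
  boundary by time 1.\<close>

lemma extend_contraction:
  assumes X: "compact_space X" "Hausdorff_space X"
    and near: "contraction_near X (subtopology B Z) e c w"
    and eZ: "\<And>x. x \<in> topspace X \<Longrightarrow> e x \<in> Z"
  obtains c' w' where "contraction_near X B e c' w'"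
    "\<And>t x y. y \<in> Z \<Longrightarrow> c' (t, x, y) = c (t, x, y)" "\<And>x y. y \<in> Z \<Longrightarrow> w' (x, y) = w (x, y)"
proof -
  let ?Z = "subtopology B Z"
  note N = contraction_nearD[OF near, unfolded top_ZZ]
  let ?u = "\<lambda>y i. 1 / nrm (pre y) * pre y i"
  define c' where "c' = (\<lambda>(t, x, y). if y \<in> Z then c (t, x, y)
     else if (1 + t) * nrm (pre y) \<le> 1 then \<phi> (\<lambda>i. (1 + t) * pre y i)
     else c (max 0 (min 1 (t - (1 / nrm (pre y) - 1))), x, \<phi> (?u y)))"
  \<comment> \<open>The arrival time of the boundary point plus the time of the way out, capped at
    1. At norm 1/2 the way out alone takes time 1, so the branches agree.\<close>
  define w' where "w' = (\<lambda>(x, y). if y \<in> Z then w (x, y)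
     else if 1/2 \<le> nrm (pre y) then min 1 (w (x, \<phi> (?u y)) + (1 / nrm (pre y) - 1)) else 1)"
  note sub = continuous_map_from_subtopology
  let ?Dn = "subtopology E (disc n)"
  have topDn: "topspace ?Dn = disc n" by (auto simp: disc_enorm)
  have Dnc: "compact_space ?Dn" using compactin_enorm_le[of n 1]
      by (simp add: disc_enorm compact_space_subtopology)
  have HI: "Hausdorff_space unit_interval" by (simp add: Hausdorff_space_subtopology)
  have CI: "compact_space unit_interval" by (intro compact_space_subtopology) simp
  have unit: "continuous_map (subtopology T S) ?Z (\<lambda>z. \<phi> (\<lambda>i. 1 / nrm (q z) * q z i))"
    if q: "continuous_map T E q" and S: "\<And>z. z \<in> topspace (subtopology T S) \<Longrightarrow> nrm (q z) \<noteq> 0"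
        for T :: "'z topology" and S q
  proof -
    have 1: "continuous_map (subtopology T S) E (\<lambda>z i. 1 / nrm (q z) * q z i)"
      by (intro continuous_map_Euclidean_space_scale continuous_map_real_divide sub
          continuous_map_enorm q S) auto
    have qE: "q z \<in> topspace E" if "z \<in> topspace (subtopology T S)" for z
      using q that by (auto simp: continuous_map_def)
    have "continuous_map (subtopology T S) ?Dn (\<lambda>z i. 1 / nrm (q z) * q z i)"
    proof (rule continuous_map_into_subtopologyI[OF 1])
      fix z assume z: "z \<in> topspace (subtopology T S)"
      have "nrm (\<lambda>i. 1 / nrm (q z) * q z i) = 1"
        using S[OF z] enorm_nonneg[of n "q z"] unfolding enorm_scale by simp
      then show "(\<lambda>i. 1 / nrm (q z) * q z i) \<in> disc n"
        unfolding disc_enorm using scale_E[OF qE[OF z], of "1 / nrm (q z)"] by simp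
    qed
    then have "continuous_map (subtopology T S) B (\<lambda>z. \<phi> (\<lambda>i. 1 / nrm (q z) * q z i))"
      by (rule continuous_map_compose2[OF phi])
    then show ?thesis
      by (rule continuous_map_into_subtopologyI) (use unit_in[OF qE] S in blast)
  qed
  have c'c: "continuous_map (prod_topology unit_interval (prod_topology X B)) B c'"
  proof (rule continuous_map_from_closed_Un_image)
    let ?A = "prod_topology unit_interval (prod_topology X B)"
    let ?D = "prod_topology unit_interval (prod_topology X ?Dn)"
    let ?f = "\<lambda>z. (fst z, fst (snd z), \<phi> (snd (snd z)))"
    show "closedin ?A ({0..1} \<times> topspace X \<times> Z)"
      using Z closedin_topspace[of unit_interval] by (simp add: closedin_prod_Times_iff)
    show "Hausdorff_space ?A" using HI X B by (simp add: Hausdorff_space_prod_topology)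
    show "compact_space ?D" using CI X Dnc by (simp add: compact_space_prod_topology)
    show f: "continuous_map ?D ?A ?f"
      by (intro continuous_map_pairedI continuous_map_fst continuous_map_fst_snd
          continuous_map_compose2[OF phi] continuous_map_snd_snd)
    show "topspace ?A \<subseteq> ({0..1} \<times> topspace X \<times> Z) \<union> ?f ` topspace ?D"
    proof
      fix z assume z: "z \<in> topspace ?A"
      obtain t x y where txy: "z = (t, x, y)" by (metis prod.collapse)
      show "z \<in> ({0..1} \<times> topspace X \<times> Z) \<union> ?f ` topspace ?D"
      proof (cases "y \<in> Z")
        case False
        then obtain q where "q \<in> disc n" "y = \<phi> q" using cover z txy by auto
        then have "(t, x, q) \<in> topspace ?D" "z = ?f (t, x, q)" using z txy topDn by auto
        then show ?thesis by blast
      qed (use z txy in auto)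
    qed
    have AZ: "subtopology ?A ({0..1} \<times> topspace X \<times> Z) = prod_topology unit_interval (prod_topology
        X ?Z)"
      by (simp add: prod_topology_subtopology subtopology_subtopology)
    show "continuous_map (subtopology ?A ({0..1} \<times> topspace X \<times> Z)) B c'"
      unfolding AZ by (rule continuous_map_eq[OF continuous_map_into_fulltopology[OF N(1)]]) (auto
          simp: c'_def)
    let ?u3 = "\<lambda>z. \<phi> (\<lambda>i. 1 / nrm (snd (snd z)) * snd (snd z) i)"
    let ?m3 = "\<lambda>z. max 0 (min 1 (fst z - (1 / nrm (snd (snd z)) - 1)))"
    let ?g = "\<lambda>z. if (1 + fst z) * nrm (snd (snd z)) \<le> 1 then \<phi> (\<lambda>i. (1 + fst z) * snd (snd z) i)
      else c (?m3 z, fst (snd z), ?u3 z)"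
    have tD: "continuous_map ?D euclideanreal fst"
      using continuous_map_into_fulltopology[OF continuous_map_fst] .
    have xD: "continuous_map ?D X (\<lambda>z. fst (snd z))"
      by (rule continuous_map_fst_snd)
    have qD: "continuous_map ?D E (\<lambda>z. snd (snd z))"
      using continuous_map_into_fulltopology[OF continuous_map_snd_snd] .
    have nD: "continuous_map ?D euclideanreal (\<lambda>z. (1 + fst z) * nrm (snd (snd z)))"
      by (intro continuous_map_real_mult continuous_map_add tD continuous_map_enorm qD) auto
    have g: "continuous_map ?D B ?g"
    proof (rule continuous_map_cases_le[OF nD])
      let ?S = "{z \<in> topspace ?D. (1 + fst z) * nrm (snd (snd z)) \<le> 1}"
      have 1: "continuous_map (subtopology ?D ?S) E (\<lambda>z i. (1 + fst z) * snd (snd z) i)"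
        by (intro continuous_map_Euclidean_space_scale sub continuous_map_add tD qD) auto
      have "continuous_map (subtopology ?D ?S) ?Dn (\<lambda>z i. (1 + fst z) * snd (snd z) i)"
        by (rule continuous_map_into_subtopologyI[OF 1]) (auto simp: disc_enorm enorm_scale scale_E)
      then show "continuous_map (subtopology ?D ?S) B (\<lambda>z. \<phi> (\<lambda>i. (1 + fst z) * snd (snd z) i))"
        by (rule continuous_map_compose2[OF phi])
      let ?T = "{z \<in> topspace ?D. 1 \<le> (1 + fst z) * nrm (snd (snd z))}"
      have nz: "nrm (snd (snd z)) \<noteq> 0" if "z \<in> topspace (subtopology ?D ?T)" for z using that
          by auto
      have "continuous_map (subtopology ?D ?T) euclideanreal (\<lambda>z. fst z - (1 / nrm (snd (snd z)) -
          1))"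
        by (intro continuous_map_diff continuous_map_real_divide sub tD
            continuous_map_enorm qD nz) auto
      then have "continuous_map (subtopology ?D ?T) unit_interval ?m3"
        by (rule continuous_map_clamp)
      then have "continuous_map (subtopology ?D ?T) ?Z
         (\<lambda>z. c (?m3 z, fst (snd z), ?u3 z))"
        by (intro continuous_map_compose2[OF N(1)] continuous_map_pairedI sub[OF xD] unit[OF qD nz])
      then show "continuous_map (subtopology ?D ?T) B
         (\<lambda>z. c (?m3 z, fst (snd z), ?u3 z))"
        by (rule continuous_map_into_fulltopology)
    next
      fix z assume z: "z \<in> topspace ?D" and eq: "(1 + fst z) * nrm (snd (snd z)) = 1"
      have nz: "nrm (snd (snd z)) \<noteq> 0" using eq by auto
      then have inv: "1 / nrm (snd (snd z)) = 1 + fst z" using eq by (simp add: field_simps)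
      have "?u3 z \<in> Z" using z nz by (intro unit_in) auto
      then show "\<phi> (\<lambda>i. (1 + fst z) * snd (snd z) i) =
          c (?m3 z, fst (snd z), ?u3 z)"
        using N(3) z unfolding inv by auto
    qed simp
    show "continuous_map ?D B (\<lambda>z. c' (?f z))"
    proof (rule continuous_map_eq[OF g])
      fix z assume z: "z \<in> topspace ?D"
      obtain t x q where z_eq: "z = (t, x, q)" by (metis prod.collapse)
      have t: "t \<in> {0..1}" and x: "x \<in> topspace X" and q: "q \<in> disc n" using z z_eq topDn by auto
      from q show "?g z = c' (?f z)"
      proof (cases rule: disc_cases)
        case 1
        have "(\<lambda>i. (1 + t) * q i) = q" if "t = 0" using that by simp
        then show ?thesis using 1 t N(3)[OF x] by (auto simp: z_eq c'_def)
      next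
        case 2
        then show ?thesis using pre_phi by (simp add: z_eq c'_def)
      qed
    qed
  qed
  have w'c: "continuous_map (prod_topology X B) euclideanreal w'"
  proof (rule continuous_map_from_closed_Un_image)
    let ?A = "prod_topology X B"
    let ?D = "prod_topology X ?Dn"
    let ?f = "\<lambda>z. (fst z, \<phi> (snd z))"
    show "closedin ?A (topspace X \<times> Z)"
      using Z by (simp add: closedin_prod_Times_iff)
    show "Hausdorff_space ?A" using X B by (simp add: Hausdorff_space_prod_topology)
    show "compact_space ?D" using X Dnc by (simp add: compact_space_prod_topology)
    show f: "continuous_map ?D ?A ?f"
      by (intro continuous_map_pairedI continuous_map_fst continuous_map_compose2[OF phi]
          continuous_map_snd)
    show "topspace ?A \<subseteq> (topspace X \<times> Z) \<union> ?f ` topspace ?D"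
      using cover topDn by (auto simp: image_iff) (metis imageE subsetD UnE)
    have AZ: "subtopology ?A (topspace X \<times> Z) = prod_topology X ?Z"
      by (simp add: prod_topology_subtopology subtopology_subtopology)
    show "continuous_map (subtopology ?A (topspace X \<times> Z)) euclideanreal w'"
      unfolding AZ by (rule continuous_map_eq[OF N(2)]) (auto simp: w'_def)
    let ?u2 = "\<lambda>z. \<phi> (\<lambda>i. 1 / nrm (snd z) * snd z i)"
    let ?g = "\<lambda>z. if 1/2 \<le> nrm (snd z) then min 1 (w (fst z, ?u2 z) + (1 / nrm (snd z) - 1)) else 1"
    have qD: "continuous_map ?D E snd"
      using continuous_map_into_fulltopology[OF continuous_map_snd] .
    have g: "continuous_map ?D euclideanreal ?g"
    proof (rule continuous_map_cases_le[OF _ continuous_map_enorm[OF qD]])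
      let ?T = "{z \<in> topspace ?D. 1/2 \<le> nrm (snd z)}"
      have nz: "nrm (snd z) \<noteq> 0" if "z \<in> topspace (subtopology ?D ?T)" for z using that by auto
      have wu: "continuous_map (subtopology ?D ?T) euclideanreal (\<lambda>z. w (fst z, ?u2 z))"
        by (intro continuous_map_compose2[OF N(2)] continuous_map_pairedI sub[OF
            continuous_map_fst] unit[OF qD nz])
      have "continuous_map (subtopology ?D ?T) euclideanreal (\<lambda>z. 1 / nrm (snd z) - 1)"
        by (intro continuous_map_diff continuous_map_real_divide sub
            continuous_map_enorm qD nz) auto
      then show "continuous_map (subtopology ?D ?T) euclideanreal (\<lambda>z. min 1 (w (fst z, ?u2 z) + (1
          / nrm (snd z) - 1)))"
        by (intro continuous_map_real_min continuous_map_add[OF wu]) auto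
    next
      fix z assume z: "z \<in> topspace ?D" and eq: "1/2 = nrm (snd z)"
      have "?u2 z \<in> Z" using z eq by (intro unit_in) auto
      then have nn: "0 \<le> w (fst z, ?u2 z)" using N(5) z by auto
      have inv: "1 / nrm (snd z) = 2" using arg_cong[OF eq, of "\<lambda>r. 1 / r"] by simp
      show "min 1 (w (fst z, ?u2 z) + (1 / nrm (snd z) - 1)) = 1"
        using nn unfolding inv by simp
    qed auto
    show "continuous_map ?D euclideanreal (\<lambda>z. w' (?f z))"
    proof (rule continuous_map_eq[OF g])
      fix z assume z: "z \<in> topspace ?D"
      obtain x q where z_eq: "z = (x, q)" by fastforce
      have x: "x \<in> topspace X" and q: "q \<in> disc n" using z z_eq topDn by auto
      from q show "?g z = w' (?f z)"
      proof (cases rule: disc_cases)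
        case 1
        then show ?thesis using N(5)[OF x] by (auto simp: z_eq w'_def)
      next
        case 2
        then show ?thesis using pre_phi by (simp add: z_eq w'_def)
      qed
    qed
  qed
  have uZ: "\<phi> (?u y) \<in> Z" if "y \<in> topspace B" "y \<notin> Z" "nrm (pre y) \<noteq> 0" for y
    using pre_in[OF that(1,2)] that(3) by (intro unit_in) (auto simp: open_disc_enorm)
  have pre_lt: "nrm (pre y) < 1" if "y \<in> topspace B" "y \<notin> Z" for y
    using pre_in[OF that] by (simp add: open_disc_enorm)
  have "contraction_near X B e c' w'"
    unfolding contraction_near_def
  proof (intro conjI ballI impI c'c w'c)
    fix x assume x: "x \<in> topspace X"
    show "w' (x, e x) = 1/2" using eZ[OF x] N(6)[OF x] by (simp add: w'_def)
    show "c' (t, x, e x) = e x" if "t \<in> {0..1}" for t using eZ[OF x] N(4)[OF x that]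
        by (simp add: c'_def)
    fix y assume y: "y \<in> topspace B"
    show "c' (0, x, y) = y"
      using N(3)[OF x] pre_lt[OF y] phi_pre[OF y] by (auto simp: c'_def)
    show "0 \<le> w' (x, y)"
    proof (cases "y \<in> Z \<or> nrm (pre y) < 1/2")
      case False
      then have "0 \<le> w (x, \<phi> (?u y))" using N(5)[OF x uZ[OF y]] by auto
      moreover have "1 \<le> 1 / nrm (pre y)" using False pre_lt[OF y] by auto
      ultimately show ?thesis using False by (simp add: w'_def)
    qed (use N(5)[OF x] in \<open>auto simp: w'_def\<close>)
    show "w' (x, y) \<le> 1" using N(5)[OF x] by (auto simp: w'_def)
    fix t assume t: "t \<in> {0..1::real}" and lt: "w' (x, y) < t"
    show "c' (t, x, y) = e x"
    proof (cases "y \<in> Z")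
      case True
      then show ?thesis using N(7)[OF x True t] lt by (simp add: c'_def w'_def)
    next
      case False
      have half: "1/2 \<le> nrm (pre y)"
      proof (rule ccontr)
        assume "\<not> 1/2 \<le> nrm (pre y)"
        then show False using lt t False by (simp add: w'_def)
      qed
      let ?r = "1 / nrm (pre y)"
      have lt': "w (x, \<phi> (?u y)) + (?r - 1) < t" using lt t half False by (auto simp: w'_def)
      have Zu: "\<phi> (?u y) \<in> Z" using uZ[OF y False] half by auto
      have wn: "0 \<le> w (x, \<phi> (?u y))" using N(5)[OF x Zu] by simp
      have r1: "1 \<le> ?r" using half pre_lt[OF y False] by auto
      have "?r < 1 + t" using lt' wn by linarith
      then have "?r * nrm (pre y) < (1 + t) * nrm (pre y)" using half
          by (intro mult_strict_right_mono) auto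
      then have gt: "\<not> (1 + t) * nrm (pre y) \<le> 1" using half by auto
      have cl: "max 0 (min 1 (t - (?r - 1))) = t - (?r - 1)" using lt' wn r1 t by auto
      have "c (t - (?r - 1), x, \<phi> (?u y)) = e x"
        by (rule N(7)[OF x Zu]) (use lt' wn r1 t in auto)
      then show ?thesis using False gt unfolding c'_def prod.case cl by simp
    qed
  qed
  then show thesis using that[of c' w'] by (simp add: c'_def w'_def)
qed

end

section \<open>CW complexes\<close>

definition subcomplex :: "'a topology \<Rightarrow> 'a set set \<Rightarrow> 'a set set \<Rightarrow> bool" where
  "subcomplex Y C F \<longleftrightarrow> F \<subseteq> C \<and> (\<forall>e\<in>F. Y closure_of e \<subseteq> \<Union>F)"

locale cw_space =
  fixes Y :: "'b topology" and C :: "'b set set" and dm :: "'b set \<Rightarrow> nat"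
  assumes cw: "cw_complex Y C dm"
begin

lemma Hausdorff: "Hausdorff_space Y" and union_cells: "\<Union>C = topspace Y" and disj: "disjoint C"
  and closure_finite: "\<And>e. e \<in> C \<Longrightarrow> finite {e'\<in>C. e' \<inter> Y closure_of e \<noteq> {}}"
  and weak: "\<And>S. S \<subseteq> topspace Y \<Longrightarrow> (\<And>e. e \<in> C \<Longrightarrow> closedin Y (S \<inter> Y closure_of e)) \<Longrightarrow> closedin Y S"
  using cw by (auto simp: cw_complex_def)

lemma cell_unique: "e \<in> C \<Longrightarrow> e' \<in> C \<Longrightarrow> p \<in> e \<Longrightarrow> p \<in> e' \<Longrightarrow> e = e'"
  using disj unfolding disjoint_def by blast

lemma cell_subset: "e \<in> C \<Longrightarrow> e \<subseteq> topspace Y"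
  using union_cells by blast

text \<open>The last property is new: the image of the disc is compact, hence closed, and each of
  its points is a limit along a radius of points of the open cell.\<close>

lemma characteristic_map:
  assumes e: "e \<in> C"
  obtains \<phi> where "continuous_map (subtopology (Euclidean_space (dm e)) (disc (dm e))) Y \<phi>"
    "\<phi> ` open_disc (dm e) = e" "inj_on \<phi> (open_disc (dm e))"
    "\<phi> ` (disc (dm e) - open_disc (dm e)) \<subseteq> \<Union>{e'\<in>C. dm e' < dm e}"
    "\<phi> ` disc (dm e) = Y closure_of e"
proof -
  let ?n = "dm e"
  let ?E = "Euclidean_space ?n"
  obtain \<phi> where phi: "continuous_map (subtopology ?E (disc ?n)) Y \<phi>"
    and hom: "homeomorphic_map (subtopology ?E (open_disc ?n)) (subtopology Y e) \<phi>"
    and bd: "\<phi> ` (disc ?n - open_disc ?n) \<subseteq> \<Union>{e'\<in>C. dm e' < ?n}"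
    using cw e unfolding cw_complex_def by blast
  have od: "topspace (subtopology ?E (open_disc ?n)) = open_disc ?n" by (auto simp: open_disc_enorm)
  have dd: "topspace (subtopology ?E (disc ?n)) = disc ?n" by (auto simp: disc_enorm)
  have im: "\<phi> ` open_disc ?n = e"
    using homeomorphic_imp_surjective_map[OF hom] cell_subset[OF e] od by (simp add: Int_absorb1)
  have inj: "inj_on \<phi> (open_disc ?n)"
    using homeomorphic_imp_injective_map[OF hom] od by simp
  have "compact_space (subtopology ?E (disc ?n))"
    using compactin_enorm_le[of ?n 1] by (simp add: disc_enorm compact_space_subtopology)
  then have "compactin Y (\<phi> ` disc ?n)"
    using image_compactin[OF _ phi] dd by (metis compact_space_def)
  then have cl: "closedin Y (\<phi> ` disc ?n)" using Hausdorff compactin_imp_closedin by blast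
  have sub: "open_disc ?n \<subseteq> disc ?n" by (auto simp: open_disc_enorm disc_enorm)
  have "Y closure_of e \<subseteq> \<phi> ` disc ?n"
    by (rule closure_of_minimal[OF _ cl]) (use im sub in blast)
  moreover have "\<phi> q \<in> Y closure_of e" if q: "q \<in> disc ?n" for q
  proof -
    have qE: "q \<in> topspace ?E" "enorm ?n q \<le> 1" using q by (auto simp: disc_enorm)
    have le: "\<bar>t\<bar> * enorm ?n q \<le> 1" if "t \<in> {0..1}" for t
      using that qE enorm_nonneg[of ?n q] by (auto intro: mult_le_one)
    have 1: "continuous_map unit_interval ?E (\<lambda>t i. t * q i)"
      using qE by (intro continuous_map_Euclidean_space_scale continuous_map_subtopology_ident) auto
    have "continuous_map unit_interval (subtopology ?E (disc ?n)) (\<lambda>t i. t * q i)"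
      by (rule continuous_map_into_subtopologyI[OF 1])
         (use qE le in \<open>auto simp: disc_enorm enorm_scale topspace_Euclidean_space\<close>)
    then have f: "continuous_map unit_interval Y (\<lambda>t. \<phi> (\<lambda>i. t * q i))"
      by (rule continuous_map_compose2[OF phi])
    have "(1::real) \<in> unit_interval closure_of {0..<1}"
    proof -
      have "{0..1} \<inter> {0..<1} = {0..<1::real}" by auto
      then show ?thesis by (simp add: closure_of_subtopology)
    qed
    then have "\<phi> (\<lambda>i. 1 * q i) \<in> Y closure_of ((\<lambda>t. \<phi> (\<lambda>i. t * q i)) ` {0..<1})"
      using continuous_map_image_closure_subset[OF f, of "{0..<1}"] by blast
    moreover have "(\<lambda>t. \<phi> (\<lambda>i. t * q i)) ` {0..<1} \<subseteq> e"
    proof clarify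
      fix t :: real assume t: "t \<in> {0..<1}"
      have "t * enorm ?n q \<le> t * 1" using t qE by (intro mult_left_mono) auto
      then have "(\<lambda>i. t * q i) \<in> open_disc ?n"
        using t qE by (auto simp: open_disc_enorm enorm_scale topspace_Euclidean_space)
      then show "\<phi> (\<lambda>i. t * q i) \<in> e" using im by blast
    qed
    ultimately show ?thesis using closure_of_mono by fastforce
  qed
  ultimately have "\<phi> ` disc ?n = Y closure_of e" by blast
  then show thesis using that phi im inj bd by blast
qed

lemma cell_in_closure: "e \<in> C \<Longrightarrow> e \<subseteq> Y closure_of e"
  by (simp add: cell_subset closure_of_subset)

lemma closure_cell_compact: "e \<in> C \<Longrightarrow> compactin Y (Y closure_of e)"
proof -
  assume e: "e \<in> C"
  obtain \<phi> where phi: "continuous_map (subtopology (Euclidean_space (dm e)) (disc (dm e))) Y \<phi>"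
    "\<phi> ` disc (dm e) = Y closure_of e"
    by (rule characteristic_map[OF e])
  have "compact_space (subtopology (Euclidean_space (dm e)) (disc (dm e)))"
    using compactin_enorm_le[of "dm e" 1] by (simp add: disc_enorm compact_space_subtopology)
  moreover have "topspace (subtopology (Euclidean_space (dm e)) (disc (dm e))) = disc (dm e)"
    by (auto simp: disc_enorm)
  ultimately show ?thesis using image_compactin[OF _ phi(1)] phi(2) by (metis compact_space_def)
qed

lemma cell_meets_closure:
  assumes e: "e \<in> C" and e': "e' \<in> C" and p: "p \<in> e'" "p \<in> Y closure_of e" and ne: "e' \<noteq> e"
  shows "dm e' < dm e"
proof -
  obtain \<phi> where phi: "\<phi> ` open_disc (dm e) = e"
    "\<phi> ` (disc (dm e) - open_disc (dm e)) \<subseteq> \<Union>{e'\<in>C. dm e' < dm e}"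
    "\<phi> ` disc (dm e) = Y closure_of e"
    by (rule characteristic_map[OF e])
  obtain q where q: "q \<in> disc (dm e)" "p = \<phi> q" using p phi(3) by blast
  have "p \<notin> e" using cell_unique[OF e e' _ p(1)] ne by blast
  then have "q \<notin> open_disc (dm e)" using phi(1) q by blast
  then obtain e'' where e'': "e'' \<in> C" "dm e'' < dm e" "p \<in> e''" using phi(2) q by blast
  then have "e'' = e'" using cell_unique e' p by blast
  then show ?thesis using e'' by simp
qed

abbreviation sc :: "'b set set \<Rightarrow> bool" where "sc \<equiv> subcomplex Y C"

lemma subcomplex_closed_cells:
  assumes "sc F"
  shows "\<Union>F = (\<Union>e\<in>F. Y closure_of e)"
proof
  show "\<Union>F \<subseteq> (\<Union>e\<in>F. Y closure_of e)"
    using assms cell_in_closure unfolding subcomplex_def by blast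
  show "(\<Union>e\<in>F. Y closure_of e) \<subseteq> \<Union>F"
    using assms unfolding subcomplex_def by blast
qed

lemma subcomplex_compact: "sc F \<Longrightarrow> finite F \<Longrightarrow> compactin Y (\<Union>F)"
  unfolding subcomplex_closed_cells
  by (rule compactin_Union) (use closure_cell_compact in \<open>auto simp: subcomplex_def\<close>)

lemma subcomplex_closed: "sc F \<Longrightarrow> finite F \<Longrightarrow> closedin Y (\<Union>F)"
  using subcomplex_compact Hausdorff compactin_imp_closedin by blast

lemma subcomplex_Un: "sc F \<Longrightarrow> sc G \<Longrightarrow> sc (F \<union> G)"
  unfolding subcomplex_def by blast

lemma subcomplex_UN:
  assumes "\<And>i. i \<in> I \<Longrightarrow> sc (F i)"
  shows "sc (\<Union>i\<in>I. F i)"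
  unfolding subcomplex_def
proof (intro conjI ballI)
  show "(\<Union>i\<in>I. F i) \<subseteq> C" using assms unfolding subcomplex_def by blast
  fix e assume "e \<in> (\<Union>i\<in>I. F i)"
  then obtain i where i: "i \<in> I" "e \<in> F i" by blast
  then have "Y closure_of e \<subseteq> \<Union>(F i)" using assms[OF i(1)] unfolding subcomplex_def by blast
  then show "Y closure_of e \<subseteq> \<Union>(\<Union>i\<in>I. F i)" using i(1) by blast
qed

lemma subcomplex_insert:
  "sc F \<Longrightarrow> e \<in> C \<Longrightarrow> Y closure_of e \<subseteq> \<Union>(insert e F) \<Longrightarrow> sc (insert e F)"
  unfolding subcomplex_def by auto

text \<open>Induction on the dimension: the closure meets only finitely many other cells, all of
  lower dimension.\<close>

lemma finite_subcomplex: "e \<in> C \<Longrightarrow> \<exists>F. finite F \<and> sc F \<and> e \<in> F"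
proof (induction "dm e" arbitrary: e rule: less_induct)
  case less
  let ?G = "{e'\<in>C. e' \<inter> Y closure_of e \<noteq> {}} - {e}"
  have fin: "finite ?G" using closure_finite[OF less.prems] by simp
  have "\<exists>F. finite F \<and> sc F \<and> e' \<in> F" if e': "e' \<in> ?G" for e'
  proof -
    have "dm e' < dm e" using cell_meets_closure[OF less.prems] e' by blast
    then show ?thesis using less.hyps e' by blast
  qed
  then obtain F where "\<forall>e'\<in>?G. finite (F e') \<and> sc (F e') \<and> e' \<in> F e'"
    using bchoice[of ?G "\<lambda>e' F. finite F \<and> sc F \<and> e' \<in> F"] by blast
  then have F: "\<And>e'. e' \<in> ?G \<Longrightarrow> finite (F e') \<and> sc (F e') \<and> e' \<in> F e'" by blast
  let ?F = "insert e (\<Union>e'\<in>?G. F e')"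
  have "Y closure_of e \<subseteq> \<Union>?F"
  proof
    fix p assume p: "p \<in> Y closure_of e"
    then have "p \<in> topspace Y" by (rule subsetD[OF closure_of_subset_topspace])
    then obtain e' where e': "e' \<in> C" "p \<in> e'" using union_cells by blast
    show "p \<in> \<Union>?F"
    proof (cases "e' = e")
      case False
      then have G: "e' \<in> ?G" using e' p by blast
      then have "e' \<in> F e'" using F by simp
      then show ?thesis using G e'(2) by (intro UnionI[of e']) auto
    qed (use e' in simp)
  qed
  moreover have "sc (\<Union>e'\<in>?G. F e')" using F by (intro subcomplex_UN) blast
  ultimately have "sc ?F" using subcomplex_insert less.prems by simp
  moreover have "finite ?F" using fin F by simp
  ultimately show ?case by (intro exI[of _ ?F]) simp
qed

text \<open>No other closed cell of \<open>F\<close> meets \<open>e\<close>: closures of cells of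
  \<open>G\<close> stay in \<open>G\<close>, and a closure of another cell can meet \<open>e\<close>
  only if that cell has larger dimension. So \<open>e\<close> may be attached last.\<close>

lemma subcomplex_remove_max:
  assumes F: "sc F" and G: "sc G" and e: "e \<in> F - G" and max: "\<And>e'. e' \<in> F - G \<Longrightarrow> dm e' \<le> dm e"
  shows "sc (F - {e})"
  unfolding subcomplex_def
proof (intro conjI ballI subsetI)
  show "\<And>e'. e' \<in> F - {e} \<Longrightarrow> e' \<in> C" using F by (auto simp: subcomplex_def)
  fix e' p assume e': "e' \<in> F - {e}" and p: "p \<in> Y closure_of e'"
  have eC: "e \<in> C" "e' \<in> C" using F e e' by (auto simp: subcomplex_def)
  have "p \<in> \<Union>F" using F e' p by (auto simp: subcomplex_def)
  moreover have "p \<notin> e"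
  proof
    assume pe: "p \<in> e"
    show False
    proof (cases "e' \<in> G")
      case True
      then obtain e'' where e'': "e'' \<in> G" "p \<in> e''" using G p unfolding subcomplex_def by blast
      then have "e'' = e" using cell_unique eC(1) pe G unfolding subcomplex_def by blast
      then show False using e e'' by blast
    next
      case False
      then show False using cell_meets_closure[OF eC(2,1) pe p] max[of e'] e' by fastforce
    qed
  qed
  ultimately show "p \<in> \<Union>(F - {e})" by blast
qed

section \<open>Attaching the cells of a finite subcomplex one at a time\<close>

lemma attach:
  assumes F: "sc F" "finite F" and F': "sc (insert e F)" and e: "e \<notin> F"
  shows "\<exists>\<phi>. cell_attachment (subtopology Y (\<Union>(insert e F))) (\<Union>F) (dm e) \<phi>"
proof -
  have eC: "e \<in> C" using F' by (simp add: subcomplex_def)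
  obtain \<phi> where phi: "continuous_map (subtopology (Euclidean_space (dm e)) (disc (dm e))) Y \<phi>"
    "\<phi> ` open_disc (dm e) = e" "inj_on \<phi> (open_disc (dm e))"
    "\<phi> ` (disc (dm e) - open_disc (dm e)) \<subseteq> \<Union>{e'\<in>C. dm e' < dm e}"
    "\<phi> ` disc (dm e) = Y closure_of e"
    by (rule characteristic_map[OF eC])
  let ?B = "subtopology Y (\<Union>(insert e F))"
  have cF: "closedin Y (\<Union>F)" using subcomplex_closed F by blast
  have cl: "Y closure_of e \<subseteq> \<Union>(insert e F)" using F' by (auto simp: subcomplex_def)
  have "cell_attachment ?B (\<Union>F) (dm e) \<phi>"
  proof
    show "compact_space ?B"
      by (rule compact_space_subtopology[OF subcomplex_compact[OF F']]) (use F in simp)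
    show "Hausdorff_space ?B" using Hausdorff by (rule Hausdorff_space_subtopology)
    show "closedin ?B (\<Union>F)"
      using cF by (rule closedin_subset_topspace) auto
    show "continuous_map (subtopology (Euclidean_space (dm e)) (disc (dm e))) ?B \<phi>"
    proof (rule continuous_map_into_subtopologyI[OF phi(1)])
      fix q assume "q \<in> topspace (subtopology (Euclidean_space (dm e)) (disc (dm e)))"
      then have "\<phi> q \<in> Y closure_of e" unfolding phi(5)[symmetric] by simp
      then show "\<phi> q \<in> \<Union>(insert e F)" by (rule subsetD[OF cl])
    qed
    show "inj_on \<phi> (open_disc (dm e))" by (rule phi(3))
    show "topspace ?B \<subseteq> \<Union>F \<union> \<phi> ` disc (dm e)"
      using phi(5) cell_in_closure[OF eC] by auto
    have FC: "F \<subseteq> C" using F by (simp add: subcomplex_def)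
    show "\<phi> q \<notin> \<Union>F" if q: "q \<in> open_disc (dm e)" for q
    proof
      assume "\<phi> q \<in> \<Union>F"
      then obtain e' where e': "e' \<in> F" "\<phi> q \<in> e'" by blast
      moreover have "\<phi> q \<in> e" using phi(2) q by blast
      ultimately have "e' = e" using cell_unique FC eC by blast
      then show False using e e' by simp
    qed
    show "\<phi> q \<in> \<Union>F" if q: "q \<in> topspace (Euclidean_space (dm e))" "enorm (dm e) q = 1" for q
    proof -
      have qd: "q \<in> disc (dm e) - open_disc (dm e)" using q
          by (simp add: disc_enorm open_disc_enorm)
      then obtain e' where e': "e' \<in> C" "dm e' < dm e" "\<phi> q \<in> e'" using phi(4) by blast
      have "\<phi> q \<in> \<Union>(insert e F)" using phi(5) cl qd by blast
      then obtain e'' where e'': "e'' \<in> insert e F" "\<phi> q \<in> e''" by blast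
      then have "e'' = e'" using cell_unique[of e'' e'] e' FC eC by blast
      then show ?thesis using e' e'' by blast
    qed
  qed
  then show ?thesis by blast
qed

lemma subtopology_subcomplex: "F \<subseteq> F' \<Longrightarrow> subtopology (subtopology Y (\<Union>F')) (\<Union>F) = subtopology Y (\<Union>F)"
  by (simp add: subtopology_subtopology Int_absorb1 Union_mono)

lemma obtain_max_cell:
  assumes "finite D" "D \<noteq> {}"
  obtains e where "e \<in> D" "\<And>e'. e' \<in> D \<Longrightarrow> dm e' \<le> dm e"
proof -
  have "Max (dm ` D) \<in> dm ` D" using assms by (intro Max_in) auto
  then obtain e where "e \<in> D" "dm e = Max (dm ` D)" by auto
  then show thesis using that assms by simp
qed

lemma finite_subcomplex_lec:
  assumes "finite F" "sc F"
  shows "lec (subtopology Y (\<Union>F))"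
  using assms
proof (induction "card F" arbitrary: F rule: less_induct)
  case less
  show ?case
  proof (cases "F = {}")
    case True
    then have "subtopology Y (\<Union>F) = trivial_topology" by simp
    then show ?thesis unfolding lec_def lec_data_def by auto
  next
    case False
    then obtain e where e: "e \<in> F" "\<And>e'. e' \<in> F \<Longrightarrow> dm e' \<le> dm e"
      using obtain_max_cell less.prems(1) by blast
    have empty: "sc {}" by (simp add: subcomplex_def)
    have G: "sc (F - {e})" using subcomplex_remove_max[OF less.prems(2) empty] e by simp
    have F: "insert e (F - {e}) = F" using e by blast
    have "card (F - {e}) < card F" using e less.prems(1) by (meson card_Diff1_less)
    then have IH: "lec (subtopology Y (\<Union>(F - {e})))" using less.hyps G less.prems(1) by simp
    obtain \<phi> where "cell_attachment (subtopology Y (\<Union>F)) (\<Union>(F - {e})) (dm e) \<phi>"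
      using attach[of "F - {e}" e, unfolded F] G less.prems by blast
    then interpret cell_attachment "subtopology Y (\<Union>F)" "\<Union>(F - {e})" "dm e" \<phi> .
    show ?thesis using lec_cell_attachment IH subtopology_subcomplex[of "F - {e}" F] by simp
  qed
qed

text \<open>The cells of \<open>F - G\<close> are attached in order of dimension. That the data on
  \<open>G\<close> do not change is carried along, so that infinitely many extensions can later be
  joined into one map.\<close>

lemma extend_contraction_subcomplex:
  assumes X: "compact_space X" "Hausdorff_space X"
    and G: "finite G" "sc G" and near: "contraction_near X (subtopology Y (\<Union>G)) f c w"
    and f: "\<And>x. x \<in> topspace X \<Longrightarrow> f x \<in> \<Union>G"
    and F: "finite F" "sc F" "G \<subseteq> F"
  shows "\<exists>c' w'. contraction_near X (subtopology Y (\<Union>F)) f c' w' \<and>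
     (\<forall>t x. \<forall>y\<in>\<Union>G. c' (t, x, y) = c (t, x, y) \<and> w' (x, y) = w (x, y))"
  using F
proof (induction "card (F - G)" arbitrary: F rule: less_induct)
  case less
  show ?case
  proof (cases "F = G")
    case True
    then show ?thesis using near by blast
  next
    case False
    then have "F - G \<noteq> {}" using less.prems by blast
    then obtain e where e: "e \<in> F - G" "\<And>e'. e' \<in> F - G \<Longrightarrow> dm e' \<le> dm e"
      using obtain_max_cell[of "F - G"] less.prems(1) by blast
    have H: "sc (F - {e})" using subcomplex_remove_max[OF less.prems(2) G(2)] e by simp
    have FF: "insert e (F - {e}) = F" using e by blast
    have "(F - {e} - G) \<subset> F - G" using e by blast
    then have "card (F - {e} - G) < card (F - G)" using less.prems(1)
        by (simp add: psubset_card_mono)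
    moreover have "G \<subseteq> F - {e}" using less.prems e by blast
    ultimately have "\<exists>c' w'. contraction_near X (subtopology Y (\<Union>(F - {e}))) f c' w' \<and>
       (\<forall>t x. \<forall>y\<in>\<Union>G. c' (t, x, y) = c (t, x, y) \<and> w' (x, y) = w (x, y))"
      using less.hyps[of "F - {e}"] H less.prems(1) by simp
    then obtain c1 w1 where 1: "contraction_near X (subtopology Y (\<Union>(F - {e}))) f c1 w1"
      "\<forall>t x. \<forall>y\<in>\<Union>G. c1 (t, x, y) = c (t, x, y) \<and> w1 (x, y) = w (x, y)"
      by (elim exE conjE) (rule that)
    obtain \<phi> where "cell_attachment (subtopology Y (\<Union>F)) (\<Union>(F - {e})) (dm e) \<phi>"
      using attach[of "F - {e}" e, unfolded FF] H less.prems by blast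
    then interpret cell_attachment "subtopology Y (\<Union>F)" "\<Union>(F - {e})" "dm e" \<phi> .
    have sub: "\<Union>G \<subseteq> \<Union>(F - {e})" using less.prems e by blast
    obtain c' w' where E1: "contraction_near X (subtopology Y (\<Union>F)) f c' w'"
      and E2: "\<And>t x y. y \<in> \<Union>(F - {e}) \<Longrightarrow> c' (t, x, y) = c1 (t, x, y)"
      and E3: "\<And>x y. y \<in> \<Union>(F - {e}) \<Longrightarrow> w' (x, y) = w1 (x, y)"
    proof (rule extend_contraction[OF X, of f c1 w1])
      show "contraction_near X (subtopology (subtopology Y (\<Union>F)) (\<Union>(F - {e}))) f c1 w1"
        using 1(1) subtopology_subcomplex[of "F - {e}" F] by simp
      show "f x \<in> \<Union>(F - {e})" if "x \<in> topspace X" for x using f[OF that] sub by blast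
    qed blast
    have "c' (t, x, y) = c (t, x, y) \<and> w' (x, y) = w (x, y)" if "y \<in> \<Union>G" for t x y
    proof -
      have "c1 (t, x, y) = c (t, x, y) \<and> w1 (x, y) = w (x, y)" using 1(2) that by blast
      then show ?thesis using E2[OF subsetD[OF sub that]] E3[OF subsetD[OF sub that]] by simp
    qed
    then show ?thesis using E1 by blast
  qed
qed

text \<open>Pick a point of \<open>K\<close> in every cell it meets. A closed cell contains finitely
  many of these points, so by the weak topology every set of them is closed. An infinite set of them
  would have no accumulation point, against compactness.\<close>

lemma compact_in_finite_subcomplex:
  assumes K: "compactin Y K"
  obtains F where "finite F" "sc F" "K \<subseteq> \<Union>F"
proof -
  let ?D = "{e\<in>C. e \<inter> K \<noteq> {}}"
  have "finite ?D"
  proof (rule ccontr)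
    assume inf: "infinite ?D"
    define p where "p e = (SOME x. x \<in> e \<inter> K)" for e
    have p: "p e \<in> e \<inter> K" if "e \<in> ?D" for e
      unfolding p_def by (rule someI_ex) (use that in blast)
    have inj: "inj_on p ?D"
    proof (rule inj_onI)
      fix e e' assume "e \<in> ?D" "e' \<in> ?D" "p e = p e'"
      then show "e = e'" using p[of e] p[of e'] cell_unique[of e e' "p e"] by auto
    qed
    have TK: "p ` ?D \<subseteq> K" using p by blast
    have KY: "K \<subseteq> topspace Y" using K compactin_subset_topspace by blast
    have closed: "closedin Y S" if S: "S \<subseteq> p ` ?D" for S
    proof (rule weak)
      show "S \<subseteq> topspace Y" using S TK KY by blast
      fix e assume e: "e \<in> C"
      have "S \<inter> Y closure_of e \<subseteq> p ` {e'\<in>C. e' \<inter> Y closure_of e \<noteq> {}}"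
        using S p by blast
      then have "finite (S \<inter> Y closure_of e)"
        using closure_finite[OF e] by (meson finite_imageI finite_subset)
      then show "closedin Y (S \<inter> Y closure_of e)"
        by (intro closedin_Hausdorff_finite[OF Hausdorff]) (use closure_of_subset_topspace[of Y e]
            in auto)
    qed
    have "infinite (p ` ?D)" using inf inj finite_imageD by blast
    then have "K \<inter> Y derived_set_of (p ` ?D) \<noteq> {}"
      by (intro compactin_imp_Bolzano_Weierstrass[OF K] conjI TK)
    then obtain z where z: "z \<in> Y derived_set_of (p ` ?D)" by blast
    have "openin Y (topspace Y - (p ` ?D - {z}))" using closed[of "p ` ?D - {z}"]
        by (simp add: openin_diff)
    then have zU: "z \<in> topspace Y - (p ` ?D - {z}) \<and> openin Y (topspace Y - (p ` ?D - {z}))"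
        using z by (simp add: in_derived_set_of)
    have "\<forall>T. z \<in> T \<and> openin Y T \<longrightarrow> (\<exists>y. y \<noteq> z \<and> y \<in> p ` ?D \<and> y \<in> T)"
      using z unfolding in_derived_set_of by (rule conjunct2)
    from this[rule_format, OF zU] have "\<exists>y. y \<noteq> z \<and> y \<in> p ` ?D \<and> y \<in> topspace Y - (p ` ?D - {z})" .
    then show False by blast
  qed
  moreover have "\<forall>e\<in>?D. \<exists>F. finite F \<and> sc F \<and> e \<in> F" using finite_subcomplex by blast
  then obtain F where "\<forall>e\<in>?D. finite (F e) \<and> sc (F e) \<and> e \<in> F e"
    using bchoice[of ?D "\<lambda>e F. finite F \<and> sc F \<and> e \<in> F"] by blast
  then have F: "\<And>e. e \<in> ?D \<Longrightarrow> finite (F e) \<and> sc (F e) \<and> e \<in> F e" by blast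
  ultimately have "finite (\<Union>e\<in>?D. F e)" by blast
  moreover have "sc (\<Union>e\<in>?D. F e)" using F by (intro subcomplex_UN) blast
  moreover have "K \<subseteq> \<Union>(\<Union>e\<in>?D. F e)"
  proof
    fix x assume x: "x \<in> K"
    then obtain e where "e \<in> C" "x \<in> e" using union_cells compactin_subset_topspace[OF K] by blast
    then show "x \<in> \<Union>(\<Union>e\<in>?D. F e)" using x F by blast
  qed
  ultimately show thesis by (rule that)
qed

text \<open>
  Currying moves the compact factor \<open>T\<close> into the target, which reduces the claim to the weak
  topology of \<open>Y\<close> itself.
\<close>

lemma continuous_map_from_subcomplexes:
  assumes T: "compact_space T" "Hausdorff_space T"
    and K: "\<And>i. sc (K i)" "\<And>i. finite (K i)" and all: "(\<Union>i. K i) = C" and mono: "\<And>i j. i \<le> j \<Longrightarrow>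
        K i \<subseteq> (K j :: 'b set set)"
    and F: "\<And>i::nat. continuous_map (prod_topology T (subtopology Y (\<Union>(K i)))) W F"
  shows "continuous_map (prod_topology T Y) W F"
proof -
  let ?G = "\<lambda>y. restrict (\<lambda>t. F (t, y)) (topspace T)"
  have G: "continuous_map (subtopology Y (\<Union>(K i))) (compact_open T W) ?G" for i
  proof -
    have "continuous_map (prod_topology (subtopology Y (\<Union>(K i))) T) W (\<lambda>z. F (snd z, fst z))"
      by (intro continuous_map_compose2[OF F[of i]] continuous_map_pairedI continuous_map_fst
          continuous_map_snd)
    from continuous_map_curry[OF this] show ?thesis by simp
  qed
  have in_K: "\<exists>i. y \<in> \<Union>(K i)" if "y \<in> topspace Y" for y using that all union_cells by blast
  have "continuous_map Y (compact_open T W) ?G"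
    unfolding continuous_map_closedin
  proof (intro conjI allI impI)
    show "?G \<in> topspace Y \<rightarrow> topspace (compact_open T W)"
    proof
      fix y assume y: "y \<in> topspace Y"
      then obtain i where "y \<in> topspace (subtopology Y (\<Union>(K i)))" using in_K by fastforce
      then show "?G y \<in> topspace (compact_open T W)" using G[of i] by (auto simp:
          continuous_map_def Pi_iff)
    qed
    fix D assume D: "closedin (compact_open T W) D"
    show "closedin Y {y \<in> topspace Y. ?G y \<in> D}"
    proof (rule weak)
      fix e assume e: "e \<in> C"
      then obtain i where i: "e \<in> K i" using all by blast
      have ei: "Y closure_of e \<subseteq> \<Union>(K i)" using K(1)[of i] i by (auto simp: subcomplex_def)
      have "closedin (subtopology Y (\<Union>(K i))) {y \<in> topspace (subtopology Y (\<Union>(K i))). ?G y \<in> D}"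
        by (rule closedin_continuous_map_preimage[OF G D])
      then have "closedin Y {y \<in> topspace (subtopology Y (\<Union>(K i))). ?G y \<in> D}"
        using closedin_trans_full subcomplex_closed[OF K] by blast
      then have "closedin Y ({y \<in> topspace (subtopology Y (\<Union>(K i))). ?G y \<in> D} \<inter> Y closure_of e)"
        by (simp add: closedin_Int)
      moreover have "{y \<in> topspace (subtopology Y (\<Union>(K i))). ?G y \<in> D} \<inter> Y closure_of e =
          {y \<in> topspace Y. ?G y \<in> D} \<inter> Y closure_of e"
        using ei by auto
      ultimately show "closedin Y ({y \<in> topspace Y. ?G y \<in> D} \<inter> Y closure_of e)" by (simp only:)
    qed auto
  qed
  then have "continuous_map (prod_topology T Y) W (\<lambda>z. (\<lambda>(g, t). g t) (?G (snd z), fst z))"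
    by (intro continuous_map_compose2[OF continuous_map_eval[OF T]] continuous_map_pairedI
        continuous_map_compose2[OF _ continuous_map_snd] continuous_map_fst)
  then show ?thesis
    by (rule continuous_map_eq) auto
qed

text \<open>Countability yields an increasing sequence of finite subcomplexes, the first containing
  the compact image of \<open>f\<close>. The contractions extend along it without changing earlier
  values, so they have a common union, which is continuous because each closed cell lies in some
  member of the sequence.\<close>

lemma fibrewise_contractible_near_map:
  assumes C: "countable C" "C \<noteq> {}" and X: "compact_space X" "Hausdorff_space X"
      and f: "continuous_map X Y f"
  shows "fibrewise_contractible_near X Y f"
proof -
  have "compactin Y (f ` topspace X)"
    using X f image_compactin unfolding compact_space_def by blast
  then obtain F0 where F0: "finite F0" "sc F0" "f ` topspace X \<subseteq> \<Union>F0"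
    by (rule compact_in_finite_subcomplex)
  have "\<exists>F. finite F \<and> sc F \<and> from_nat_into C i \<in> F" for i
    using finite_subcomplex from_nat_into[OF C(2)] by blast
  then obtain L where L: "\<And>i. finite (L i) \<and> sc (L i) \<and> from_nat_into C i \<in> L i" by metis
  define K where "K i = F0 \<union> (\<Union>j<i. L j)" for i :: nat
  have Kf: "finite (K i)" for i using F0 L by (simp add: K_def)
  have Ks: "sc (K i)" for i unfolding K_def using F0 L by (intro subcomplex_Un subcomplex_UN) auto
  have Km: "K i \<subseteq> K j" if "i \<le> j" for i j using that by (auto simp: K_def)
  have KC: "(\<Union>i. K i) = C"
  proof
    show "(\<Union>i. K i) \<subseteq> C" using Ks unfolding subcomplex_def by blast
    show "C \<subseteq> (\<Union>i. K i)"
    proof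
      fix e assume "e \<in> C"
      then obtain i where "from_nat_into C i = e" using from_nat_into_surj[OF C(1)] by metis
      then have "e \<in> K (Suc i)" using L[of i] by (auto simp: K_def)
      then show "e \<in> (\<Union>i. K i)" by blast
    qed
  qed
  let ?K = "\<lambda>i. subtopology Y (\<Union>(K i))"
  have fK: "f x \<in> \<Union>(K i)" if "x \<in> topspace X" for x i using F0(3) that by (auto simp: K_def)
  have "lec (?K 0)" using finite_subcomplex_lec Kf Ks by blast
  moreover have "continuous_map X (?K 0) f"
    by (rule continuous_map_into_subtopologyI[OF f fK])
  ultimately have base: "\<exists>p. contraction_near X (?K 0) f (fst p) (snd p)"
    using lec_imp_contraction_near by fastforce
  have step: "\<exists>q. contraction_near X (?K (Suc i)) f (fst q) (snd q) \<and>
      (\<forall>t x. \<forall>y\<in>\<Union>(K i). fst q (t, x, y) = fst p (t, x, y) \<and> snd q (x, y) = snd p (x, y))"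
    if "contraction_near X (?K i) f (fst p) (snd p)" for p i
    using extend_contraction_subcomplex[OF X Kf Ks that fK Kf Ks Km]
        by (metis fst_conv le_SucI order_refl snd_conv)
  obtain p where p: "\<And>i. contraction_near X (?K i) f (fst (p i)) (snd (p i))"
    and p_Suc: "\<And>i t x y. y \<in> \<Union>(K i) \<Longrightarrow> fst (p (Suc i)) (t, x, y) = fst (p i) (t, x, y) \<and>
        snd (p (Suc i)) (x, y) = snd (p i) (x, y)"
    using dependent_nat_choice[of "\<lambda>i p. contraction_near X (?K i) f (fst p) (snd p)"
       "\<lambda>i p q. \<forall>t x. \<forall>y\<in>\<Union>(K i). fst q (t, x, y) = fst p (t, x, y) \<and>
           snd q (x, y) = snd p (x, y)", OF base step]
    by blast
  have p_le: "fst (p j) (t, x, y) = fst (p i) (t, x, y) \<and> snd (p j) (x, y) = snd (p i) (x, y)"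
    if "i \<le> j" "y \<in> \<Union>(K i)" for i j t x y
    using that(1)
  proof (induction j rule: dec_induct)
    case (step j)
    have "y \<in> \<Union>(K j)" using Km[OF step.hyps(1)] that(2) by blast
    then show ?case using p_Suc step.IH by simp
  qed simp
  define m where "m y = (LEAST i. y \<in> \<Union>(K i))" for y
  define c where "c = (\<lambda>(t, x, y). fst (p (m y)) (t, x, y))"
  define w where "w = (\<lambda>(x, y). snd (p (m y)) (x, y))"
  have cw: "c (t, x, y) = fst (p i) (t, x, y) \<and> w (x, y) = snd (p i) (x, y)" if y: "y \<in> \<Union>(K i)"
      for t x y i
  proof -
    have "m y \<le> i" "y \<in> \<Union>(K (m y))" using y unfolding m_def by (rule Least_le, rule LeastI)
    then show ?thesis using p_le unfolding c_def w_def by simp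
  qed
  have ex: "\<exists>i. y \<in> \<Union>(K i)" if "y \<in> topspace Y" for y using that KC union_cells by blast
  have CI: "compact_space unit_interval" by (intro compact_space_subtopology) simp
  have T: "compact_space (prod_topology unit_interval X)" "Hausdorff_space (prod_topology
      unit_interval X)"
    using X CI by (simp_all add: compact_space_prod_topology Hausdorff_space_prod_topology
        Hausdorff_space_subtopology)
  have topK: "topspace (?K i) = \<Union>(K i)" for i
    using closedin_subset[OF subcomplex_closed[OF Ks Kf]] by (simp add: Int_absorb1)
  note N = contraction_nearD[OF p, unfolded topK]
  have "continuous_map (prod_topology (prod_topology unit_interval X) Y) Y (\<lambda>z. c (fst (fst z), snd
      (fst z), snd z))"
  proof (rule continuous_map_from_subcomplexes[OF T Ks Kf KC Km])
    fix i
    have "continuous_map (prod_topology (prod_topology unit_interval X) (?K i)) (?K i)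
        (\<lambda>z. fst (p i) (fst (fst z), snd (fst z), snd z))"
      by (intro continuous_map_compose2[OF N(1)] continuous_map_pairedI continuous_map_snd
          continuous_map_compose2[OF continuous_map_fst continuous_map_fst]
          continuous_map_compose2[OF continuous_map_snd continuous_map_fst])
    then show "continuous_map (prod_topology (prod_topology unit_interval X) (?K i)) Y
        (\<lambda>z. c (fst (fst z), snd (fst z), snd z))"
    proof (rule continuous_map_eq[OF continuous_map_into_fulltopology])
      fix z assume "z \<in> topspace (prod_topology (prod_topology unit_interval X) (?K i))"
      then have "snd z \<in> \<Union>(K i)" unfolding topspace_prod_topology topK by auto
      then show "fst (p i) (fst (fst z), snd (fst z), snd z) = c (fst (fst z), snd (fst z), snd z)"
        using cw by simp
    qed
  qed
  from continuous_map_compose2[OF this, of "prod_topology unit_interval (prod_topology X Y)" "\<lambda>z.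
      ((fst z, fst (snd z)), snd (snd z))"]
  have cc: "continuous_map (prod_topology unit_interval (prod_topology X Y)) Y c"
    by (simp add: continuous_map_pairedI continuous_map_fst continuous_map_fst_snd
        continuous_map_snd_snd)
  have wc: "continuous_map (prod_topology X Y) euclideanreal w"
  proof (rule continuous_map_from_subcomplexes[OF X Ks Kf KC Km])
    fix i
    show "continuous_map (prod_topology X (?K i)) euclideanreal w"
    proof (rule continuous_map_eq[OF N(2)])
      fix z assume "z \<in> topspace (prod_topology X (?K i))"
      then have "snd z \<in> \<Union>(K i)" unfolding topspace_prod_topology topK by auto
      then show "snd (p i) z = w z" using cw[of "snd z" i _ "fst z"] by simp
    qed
  qed
  show ?thesis
    unfolding fibrewise_contractible_near_def
  \<comment> \<open>The rescaling sends the value 1/2 on the graph to 0 and keeps the threshold 1,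
    below which the contraction has arrived by time 1.\<close>
  proof (intro exI[of _ c] exI[of _ "\<lambda>z. max 0 (2 * w z - 1)"] conjI ballI impI cc)
    show "continuous_map (prod_topology X Y) euclideanreal (\<lambda>z. max 0 (2 * w z - 1))"
      by (intro continuous_map_real_max continuous_map_diff continuous_map_real_mult_left wc) auto
    fix x assume x: "x \<in> topspace X"
    show "c (t, x, f x) = f x" if "t \<in> {0..1}" for t
      using cw[OF fK[OF x, of 0]] N(4)[OF x that, of 0] by simp
    show "max 0 (2 * w (x, f x) - 1) = 0"
      using cw[OF fK[OF x, of 0]] N(6)[OF x, of 0] by simp
    fix y assume "y \<in> topspace Y"
    then obtain i where i: "y \<in> \<Union>(K i)" using ex by blast
    show "c (0, x, y) = y" using cw[OF i] N(3)[OF x i] by simp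
    assume "max 0 (2 * w (x, y) - 1) < 1"
    then have "snd (p i) (x, y) < 1" using cw[OF i] by simp
    then show "c (1, x, y) = f x" using cw[OF i] N(7)[OF x i, of 1] by simp
  qed
qed

lemma finite_compact: "finite C \<Longrightarrow> compact_space Y"
proof -
  assume "finite C"
  moreover have "sc C"
    unfolding subcomplex_def using union_cells closure_of_subset_topspace by fastforce
  ultimately show ?thesis using subcomplex_compact union_cells by (metis compact_space_def)
qed

end

section \<open>Path components of mapping spaces\<close>

lemma homotopic_self_path_component:
  assumes ab: "homotopic_self R M a b" and g: "g \<in> topspace M"
  shows "path_component_of M (a g) (b g)"
proof -
  obtain k where k: "continuous_map (prod_topology unit_interval M) M k"
    "\<And>g. k (0, g) = a g" "\<And>g. k (1, g) = b g"
    using ab unfolding homotopic_with_def by blast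
  have "continuous_map unit_interval M (\<lambda>t. k (t, g))"
    by (intro continuous_map_compose2[OF k(1)] continuous_map_pairedI
        continuous_map_ident) (use g in auto)
  then show ?thesis
    unfolding path_component_of_def pathin_def by (intro exI[of _ "\<lambda>t. k (t, g)"]) (simp add: k)
qed

lemma continuous_map_path_components:
  assumes a: "continuous_map M M a" and e: "path_component_of M (a e) e'"
  shows "continuous_map (subtopology M (path_component_of_set M e)) (subtopology M
      (path_component_of_set M e')) a"
proof (rule continuous_map_into_subtopologyI[OF continuous_map_from_subtopology[OF a]])
  fix g assume "g \<in> topspace (subtopology M (path_component_of_set M e))"
  then have "path_component_of M (a e) (a g)"
    using path_component_of_continuous_image[OF a] by auto
  then show "a g \<in> path_component_of_set M e'"
    using e path_component_of_sym path_component_of_trans by (metis mem_Collect_eq)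
qed

text \<open>A homotopy ending at the identity cannot leave a path component: its remaining part
  joins the moved point to \<open>g\<close>.\<close>

lemma homotopic_self_path_components:
  assumes ab: "homotopic_self R M a b" and b: "\<And>g. b g = g"
  shows "homotopic_self R (subtopology M (path_component_of_set M e)) a b"
proof -
  let ?U = "path_component_of_set M e"
  obtain k where k: "continuous_map (prod_topology unit_interval M) M k"
    "\<And>g. k (0, g) = a g" "\<And>g. k (1, g) = b g"
    and R: "\<And>t g. t \<in> {0..1} \<Longrightarrow> g \<in> topspace M \<Longrightarrow> R g (k (t, g))"
    using ab unfolding homotopic_with_def by blast
  have "continuous_map (prod_topology unit_interval (subtopology M ?U)) (subtopology M ?U) k"
  proof (rule continuous_map_into_subtopologyI)
    have "prod_topology unit_interval (subtopology M ?U) = subtopology (prod_topology unit_interval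
        M) ({0..1} \<times> ?U)"
      by (simp add: prod_topology_subtopology(2))
    then show "continuous_map (prod_topology unit_interval (subtopology M ?U)) M k"
      using continuous_map_from_subtopology[OF k(1)] by metis
    fix z assume z: "z \<in> topspace (prod_topology unit_interval (subtopology M ?U))"
    obtain t g where tg: "z = (t, g)" by fastforce
    have t: "t \<in> {0..1}" and g: "g \<in> topspace M" "path_component_of M e g" using z tg by auto
    have c: "continuous_map unit_interval M (\<lambda>r. k (max 0 (min 1 (t + r * (1 - t))), g))"
      by (intro continuous_map_compose2[OF k(1)] continuous_map_pairedI continuous_map_clamp)
         (use g in \<open>auto intro!: continuous_intros\<close>)
    have "path_component_of M (k (t, g)) g"
      unfolding path_component_of_def pathin_def
      by (rule exI[of _ "\<lambda>r. k (max 0 (min 1 (t + r * (1 - t))), g)"]) (use c t k b in \<open>auto simp: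
          max_def min_def\<close>)
    then have "path_component_of M e (k (t, g))"
      using g(2) path_component_of_sym path_component_of_trans by metis
    then show "k z \<in> ?U" by (simp add: tg)
  qed
  then show ?thesis
    unfolding homotopic_with_def by (intro exI[of _ k]) (use k R in auto)
qed

section \<open>The equivalence between the components of \<open>f\<close> and
  \<open>f + d\<close>\<close>

theorem theorem3p10:
  fixes X :: "'a topology" and Y :: "'b topology"
    and x0 :: 'a and y0 :: 'b
    and CX :: "'a set set" and dimX :: "'a set \<Rightarrow> nat"
    and CY :: "'b set set" and dimY :: "'b set \<Rightarrow> nat"
    and \<sigma> :: "'a \<Rightarrow> 'a \<times> 'a"
    and d f :: "'a \<Rightarrow> 'b"
  assumes "cw_complex X CX dimX" and "countable CX"
    and "connected_space X" and "nondegenerate_basepoint X x0"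
    and "cw_complex Y CY dimY" and "countable CY"
    and "connected_space Y" and "nondegenerate_basepoint Y y0"
    and "co_H_space X x0 \<sigma>"
    and "cyclic_map X x0 Y y0 d"
    and "based_map X x0 Y y0 f"
  shows "map_component X Y f homotopy_equivalent_space
           map_component X Y (co_H_add x0 \<sigma> f d) \<and>
         (finite CX \<longrightarrow>
           fibre_homotopy_equivalent
             (map_component X Y f) (map_basepoint X f) (evaluation x0)
             (map_component X Y (co_H_add x0 \<sigma> f d)) (map_basepoint X (co_H_add x0 \<sigma> f d))
             (evaluation x0) Y)"
proof -
  interpret cwX: cw_space X CX dimX by unfold_locales (fact assms(1))
  interpret cwY: cw_space Y CY dimY by unfold_locales (fact assms(5))
  note HX = cwX.Hausdorff
  have x0: "x0 \<in> topspace X" and y0: "y0 \<in> topspace Y"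
    using assms(4,8) by (auto simp: nondegenerate_basepoint_def)
  have fc: "continuous_map X Y f" and fx0: "f x0 = y0" using assms(11) by (auto simp: based_map_def)
  obtain \<Gamma> where G: "continuous_map (prod_topology X Y) Y \<Gamma>"
    and Gw: "\<And>z. z \<in> topspace (wedge X x0 Y y0) \<Longrightarrow> \<Gamma> z = wedge_case y0 d id z" and dx0: "d x0 = y0"
    using assms(10) unfolding cyclic_map_def based_map_def by blast
  note tw = topspace_wedge[OF x0 y0]
  have Gx0: "\<Gamma> (x0, y) = y" if "y \<in> topspace Y" for y
    using Gw[of "(x0, y)"] that tw dx0 by (simp add: wedge_case_def)
  have Gy0: "\<Gamma> (x, y0) = d x" if "x \<in> topspace X" for x
    using Gw[of "(x, y0)"] that tw by (simp add: wedge_case_def)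
  obtain Q s where Q: "continuous_map (prod_topology euclideanreal X) X Q" "continuous_map X
      euclideanreal s"
    "\<And>x. x \<in> topspace X \<Longrightarrow> Q (0, x) = x" "\<And>t. Q (t, x0) = x0" "s x0 = 0"
    "\<And>x. x \<in> topspace X \<Longrightarrow> s x < 1 \<Longrightarrow> Q (-1, x) = x0"
    "\<And>x. x \<in> topspace X \<Longrightarrow> s x > -1 \<Longrightarrow> Q (1, x) = x0"
    by (rule co_H_space_contractions[OF assms(9,4)]) (rule that; assumption)
  interpret contracting_family X Y x0 Q s \<Gamma>
    by unfold_locales (use Q x0 G Gx0 in auto)
  let ?M = "compact_open X Y"
  define h0 where "h0 = act X \<Gamma>"
  define k0 where "k0 = act X inv_fam"
  let ?e1 = "map_basepoint X f" and ?e2 = "map_basepoint X (co_H_add x0 \<sigma> f d)"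
  have h0: "over_self_map x0 X Y h0" and k0: "over_self_map x0 X Y k0"
    using continuous_map_act_single[OF HX G] continuous_map_act_single[OF HX inv_fam_continuous]
        inv_fam_x0 x0
    by (auto simp: over_self_map_def h0_def k0_def act_apply Gx0 maps_apply)
  have snd_act: "act X snd g = g" if "g \<in> maps X Y" for g
    unfolding act_def by (rule restrict_eq_map[OF that]) simp
  have snd_id: "homotopic_self (same_value x0) ?M (act X snd) id"
    by (rule homotopic_with_equal)
       (auto simp: snd_act topspace_compact_open intro!: continuous_map_act_single[OF HX
           continuous_map_snd])
  have comp: "homotopic_self (same_value x0) ?M (act X A \<circ> act X B) id"
    if A: "over_self_map x0 X Y (act X A)" and B: "over_self_map x0 X Y (act X B)"
      and AB: "homotopic_with (fixes_fibre x0 Y) (prod_topology X Y) Y (\<lambda>z. A (fst z, B z)) snd"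
          for A B
  proof (rule homotopic_with_trans[OF _ homotopic_with_trans[OF homotopic_self_act[OF HX x0 AB]
      snd_id]])
    show "homotopic_self (same_value x0) ?M (act X A \<circ> act X B) (act X (\<lambda>z. A (fst z, B z)))"
    proof (rule homotopic_with_equal)
      show "continuous_map ?M ?M (act X A \<circ> act X B)"
        using A B continuous_map_compose unfolding over_self_map_def by blast
      show same: "(act X A \<circ> act X B) g = act X (\<lambda>z. A (fst z, B z)) g" if "g \<in> topspace ?M" for g
        using that by (simp add: act_act topspace_compact_open)
      show fib: "\<forall>g\<in>topspace ?M. (act X A \<circ> act X B) g x0 = g x0"
        using A B over_self_map_in[OF B] by (simp add: over_self_map_def topspace_compact_open)
      show "\<forall>g\<in>topspace ?M. act X (\<lambda>z. A (fst z, B z)) g x0 = g x0"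
        using same fib by metis
    qed
  qed
  have kh: "homotopic_self (same_value x0) ?M (k0 \<circ> h0) id"
    unfolding k0_def h0_def by (rule comp[OF k0[unfolded k0_def] h0[unfolded h0_def] inv_fam_left])
  have hk: "homotopic_self (same_value x0) ?M (h0 \<circ> k0) id"
    unfolding k0_def h0_def by (rule comp[OF h0[unfolded h0_def] k0[unfolded k0_def] inv_fam_right])
  have e1: "?e1 \<in> maps X Y" unfolding map_basepoint_def by (rule maps_restrict[OF fc])
  obtain D where D: "continuous_map (prod_topology unit_interval X) (prod_topology X X) D"
    "\<And>x. D (0, x) = \<sigma> x" "\<And>x. D (1, x) = (x, x)" "\<And>t. t \<in> {0..1} \<Longrightarrow> D (t, x0) = (x0, x0)"
    and sw: "continuous_map X (wedge X x0 X x0) \<sigma>"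
    using assms(9) unfolding co_H_space_def homotopic_with_def based_map_def by blast
  \<comment> \<open>The homotopy \<open>D\<close> from \<open>\<sigma>\<close> to the diagonal is
    run backwards, its first coordinate feeding \<open>f\<close> and its second
    \<open>\<Gamma>\<close>. On the diagonal this is \<open>h0\<close> applied to
    \<open>f\<close>.\<close>
  define p where "p = (\<lambda>t. restrict (\<lambda>x. \<Gamma> (snd (D (1 - t, x)), f (fst (D (1 - t, x))))) (topspace
      X))"
  have pc: "continuous_map unit_interval ?M p"
  proof -
    have "continuous_map unit_interval unit_interval (\<lambda>t. 1 - t)"
      by (rule continuous_map_into_subtopologyI) (auto intro!: continuous_intros)
    then have r: "continuous_map (prod_topology unit_interval X) (prod_topology X X) (\<lambda>z. D (1 -
        fst z, snd z))"
      by (intro continuous_map_compose2[OF D(1)] continuous_map_pairedI continuous_map_snd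
          continuous_map_compose2[OF _ continuous_map_fst])
    have "continuous_map (prod_topology unit_interval X) Y (\<lambda>z. \<Gamma> (snd (D (1 - fst z, snd z)), f
        (fst (D (1 - fst z, snd z)))))"
      by (intro continuous_map_compose2[OF G] continuous_map_pairedI continuous_map_compose2[OF fc]
          continuous_map_compose2[OF continuous_map_fst r] continuous_map_compose2[OF
              continuous_map_snd r])
    from continuous_map_curry[OF this] show ?thesis by (simp add: p_def)
  qed
  have p0: "p 0 = h0 ?e1"
    by (auto simp: p_def D h0_def act_def map_basepoint_def)
  have p1: "p 1 = ?e2"
    unfolding p_def map_basepoint_def
  proof (rule restrict_ext)
    fix x assume x: "x \<in> topspace X"
    then have "\<sigma> x \<in> topspace X \<times> {x0} \<union> {x0} \<times> topspace X"
      using sw topspace_wedge[OF x0 x0] by (auto simp: continuous_map_def Pi_iff)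
    \<comment> \<open>On the first summand \<open>\<Gamma> (x0, -)\<close> is the identity and
      leaves \<open>f\<close>; on the second \<open>f\<close> contributes \<open>y0\<close>, and
      \<open>\<Gamma> (-, y0)\<close> is \<open>d\<close>. The interchange of coordinates yields
      \<open>f + d\<close> rather than \<open>d + f\<close>.\<close>
    then consider q where "\<sigma> x = (q, x0)" "q \<in> topspace X"
      | q where "\<sigma> x = (x0, q)" "q \<in> topspace X" "q \<noteq> x0" by fastforce
    then show "\<Gamma> (snd (D (1 - 1, x)), f (fst (D (1 - 1, x)))) = co_H_add x0 \<sigma> f d x"
    proof cases
      case 1
      then have "f q \<in> topspace Y" using fc by (auto simp: continuous_map_def)
      then show ?thesis using 1 by (simp add: D co_H_add_def wedge_case_def Gx0)
    next
      case 2
      then show ?thesis by (simp add: D co_H_add_def wedge_case_def fx0 Gy0)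
    qed
  qed
  \<comment> \<open>The deformation of \<open>\<sigma>\<close> is based, so the path stays in the
    fibre over \<open>y0\<close>. Moving \<open>h0\<close> along it to a based map relies on
    this.\<close>
  have px0: "p t x0 = y0" if "t \<in> {0..1}" for t
    using D(4)[of "1 - t"] that x0 y0 by (simp add: p_def fx0 Gx0)
  have path: "path_component_of ?M (h0 ?e1) ?e2"
    unfolding path_component_of_def pathin_def by (intro exI[of _ p]) (simp add: pc p0 p1)
  have e2: "?e2 \<in> maps X Y"
    using path_component_in_topspace[OF path] by (simp add: topspace_compact_open)
  have e2x0: "?e2 x0 = y0" using px0[of 1] p1 by simp
  have e1x0: "?e1 x0 = y0" using x0 fx0 by (simp add: map_basepoint_def)
  have equiv: "map_component X Y f homotopy_equivalent_space map_component X Y (co_H_add x0 \<sigma> f d)"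
  proof -
    have hc: "continuous_map ?M ?M h0" and kc: "continuous_map ?M ?M k0"
      using h0 k0 by (simp_all add: over_self_map_def)
    \<comment> \<open>For \<open>k0\<close> to map the component of \<open>f + d\<close> to that of
      \<open>f\<close>, one point suffices; it is traced back along the path \<open>p\<close> and
      the homotopy from \<open>k0 \<circ> h0\<close> to the identity.\<close>
    have "path_component_of ?M (k0 ?e2) (k0 (h0 ?e1))"
      by (rule path_component_of_sym[OF path_component_of_continuous_image[OF kc path]])
    moreover have "path_component_of ?M (k0 (h0 ?e1)) ?e1"
      using homotopic_self_path_component[OF kh] e1 by (simp add: topspace_compact_open)
    ultimately have return: "path_component_of ?M (k0 ?e2) ?e1" by (rule path_component_of_trans)
    have 1: "homotopic_with (\<lambda>x. True) (map_component X Y f) (map_component X Y f) (k0 \<circ> h0) id"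
      unfolding map_component_def
      by (rule homotopic_with_mono[OF homotopic_self_path_components[OF kh]]) auto
    have 2: "homotopic_with (\<lambda>x. True) (map_component X Y (co_H_add x0 \<sigma> f d)) (map_component X Y
        (co_H_add x0 \<sigma> f d)) (h0 \<circ> k0) id"
      unfolding map_component_def
      by (rule homotopic_with_mono[OF homotopic_self_path_components[OF hk]]) auto
    show ?thesis
      unfolding homotopy_equivalent_space_def
    proof (intro exI conjI)
      show "continuous_map (map_component X Y f) (map_component X Y (co_H_add x0 \<sigma> f d)) h0"
        unfolding map_component_def by (rule continuous_map_path_components[OF hc path])
      show "continuous_map (map_component X Y (co_H_add x0 \<sigma> f d)) (map_component X Y f) k0"
        unfolding map_component_def by (rule continuous_map_path_components[OF kc return])
    qed (fact 1, fact 2)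
  qed
  have fibre: "fibre_homotopy_equivalent (map_component X Y f) ?e1 (evaluation x0)
      (map_component X Y (co_H_add x0 \<sigma> f d)) ?e2 (evaluation x0) Y" if fin: "finite CX"
  proof -
    have X: "compact_space X" using cwX.finite_compact fin by blast
    interpret ev: evaluation_fibration X Y x0 y0
      by unfold_locales (use X HX assms(4,8) in auto)
    have ne: "CY \<noteq> {}" using cwY.union_cells y0 by auto
    have good: "ev.good_point e" if "e \<in> maps X Y" "e x0 = y0" for e
      unfolding ev.good_point_def
      using that cwY.fibrewise_contractible_near_map[OF assms(6) ne X HX maps_continuous] by blast
    obtain h k where h: "over_self_map x0 X Y h" and k: "over_self_map x0 X Y k"
      and he: "h ?e1 = ?e2" and ke: "k ?e2 = ?e1"
      and kh': "homotopic_self (based_over x0 ?e1) ?M (k \<circ> h) id"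
      and hk': "homotopic_self (based_over x0 ?e2) ?M (h \<circ> k) id"
      by (rule ev.based_over_equivalence[OF good[OF e1 e1x0] good[OF e2 e2x0] h0 k0 kh hk pc p0 p1
          px0])
         (assumption | (rule that; assumption))+
    have hc: "continuous_map ?M ?M h" and hx: "\<And>g. g \<in> maps X Y \<Longrightarrow> h g x0 = g x0"
      and kc: "continuous_map ?M ?M k" and kx: "\<And>g. g \<in> maps X Y \<Longrightarrow> k g x0 = g x0"
      using h k by (auto simp: over_self_map_def)
    have sub: "g \<in> maps X Y" if "g \<in> topspace (map_component X Y f')" for g f'
      using that by (simp add: map_component_def topspace_compact_open)
    have ev_cont: "continuous_map (map_component X Y f') Y (evaluation x0)" for f'
      using continuous_map_from_subtopology[OF continuous_map_eval_at[OF x0]]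
      by (simp add: map_component_def evaluation_def[abs_def])
    have in1: "?e1 \<in> topspace (map_component X Y f)"
        and in2: "?e2 \<in> topspace (map_component X Y (co_H_add x0 \<sigma> f d))"
      using e1 e2 by (simp_all add: map_component_def topspace_compact_open path_component_of_refl)
    show ?thesis
      unfolding fibre_homotopy_equivalent_def based_map_def
    proof (intro exI conjI ballI)
      show "continuous_map (map_component X Y f) Y (evaluation x0)"
        "continuous_map (map_component X Y (co_H_add x0 \<sigma> f d)) Y (evaluation x0)"
            by (rule ev_cont)+
      show "continuous_map (map_component X Y f) (map_component X Y (co_H_add x0 \<sigma> f d)) h"
        unfolding map_component_def
        by (rule continuous_map_path_components[OF hc]) (simp add: he path_component_of_refl
            topspace_compact_open e2)
      show "continuous_map (map_component X Y (co_H_add x0 \<sigma> f d)) (map_component X Y f) k"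
        unfolding map_component_def
        by (rule continuous_map_path_components[OF kc]) (simp add: ke path_component_of_refl
            topspace_compact_open e1)
      show "h ?e1 = ?e2" "k ?e2 = ?e1" by (fact he, fact ke)
      show "evaluation x0 (h g) = evaluation x0 g" if "g \<in> topspace (map_component X Y f)" for g
        using hx[OF sub[OF that]] by (simp add: evaluation_def)
      show "evaluation x0 (k g) = evaluation x0 g" if "g \<in> topspace (map_component X Y (co_H_add x0
          \<sigma> f d))" for g
        using kx[OF sub[OF that]] by (simp add: evaluation_def)
      show "homotopic_with (\<lambda>F. F ?e1 = ?e1 \<and> (\<forall>x\<in>topspace (map_component X Y f). evaluation x0 (F
          x) = evaluation x0 x))
          (map_component X Y f) (map_component X Y f) (k \<circ> h) id"
        unfolding evaluation_def map_component_def
        by (rule homotopic_with_mono[OF homotopic_self_path_components[OF kh']])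
           (use in1 in \<open>auto simp: map_component_def\<close>)
      show "homotopic_with (\<lambda>H. H ?e2 = ?e2 \<and> (\<forall>x\<in>topspace (map_component X Y (co_H_add x0 \<sigma> f d)).
          evaluation x0 (H x) = evaluation x0 x))
          (map_component X Y (co_H_add x0 \<sigma> f d)) (map_component X Y (co_H_add x0 \<sigma> f d)) (h \<circ> k)
              id"
        unfolding evaluation_def map_component_def
        by (rule homotopic_with_mono[OF homotopic_self_path_components[OF hk']])
           (use in2 in \<open>auto simp: map_component_def\<close>)
    qed
  qed
  show ?thesis using equiv fibre by blast
qed

end
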